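(* Let $m\ge 2$ and consider Impartial Culture on $m$ candidates with $n$ voters. Let $I$ be the $(m-1)\times(m-1)$ identity matrix, $J$ the $(m-1)\times(m-1)$ all-ones matrix, and $H=\frac16\big(I+\frac12J\big)$, so that $H^{-1}=6\big(I-\frac{1}{m+1}J\big)$ and $\det H=\frac{m+1}{2}\cdot\frac{1}{6^{m-1}}$. Then, as $n\to+\infty$, \[ \mathbb{P}(m\text{ is the Condorcet winner})=a_0+a_{1,n}n^{-1/2}+O(n^{-1}), \] where \[ a_0=\frac{1}{\sqrt{(2\pi)^{m-1}\det H}}\int_{(0,+\infty)^{m-1}}e^{-\mathbf{u}^TH^{-1}\mathbf{u}/2}\,d\mathbf{u}, \] and $a_{1,n}=0$ if $n$ is odd, while if $n$ is even \[ a_{1,n}=-\frac{6}{m+1}\cdot\frac{1}{\sqrt{(2\pi)^{m-1}\det H}}\int_{(0,+\infty)^{m-1}}\mathbf{1}^T\mathbf{u}\;e^{-\mathbf{u}^TH^{-1}\mathbf{u}/2}\,d\mathbf{u}. \]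
   Context: Impartial Culture: each of the $n$ voters independently draws a strict ranking of the candidates $\{1,\dots,m\}$ uniformly at random among the $m!$ rankings. Candidate $m$ is the Condorcet winner if for every other candidate $j$, strictly more than $n/2$ voters rank $m$ above $j$. $\mathbf{1}$ denotes the all-ones vector. *)

theory Defs
  imports "HOL-Analysis.Analysis" "HOL-Probability.Probability"
          "HOL-Combinatorics.Multiset_Permutations" "HOL-Library.Landau_Symbols"
begin

definition rankings :: "nat \<Rightarrow> nat list set" where
  "rankings m = permutations_of_set {1..m}"

definition ranks_above :: "nat list \<Rightarrow> nat \<Rightarrow> nat \<Rightarrow> bool" where
  "ranks_above r a b \<longleftrightarrow> (\<exists>i j. i < j \<and> j < length r \<and> r ! i = a \<and> r ! j = b)"

definition profiles :: "nat \<Rightarrow> nat \<Rightarrow> (nat \<Rightarrow> nat list) set" where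
  "profiles m n = PiE {..<n} (\<lambda>_. rankings m)"

definition condorcet_winner :: "nat \<Rightarrow> nat \<Rightarrow> (nat \<Rightarrow> nat list) \<Rightarrow> nat \<Rightarrow> bool" where
  "condorcet_winner m n P c \<longleftrightarrow>
     (\<forall>j \<in> {1..m} - {c}. 2 * card {v \<in> {..<n}. ranks_above (P v) c j} > n)"

text \<open>Impartial Culture: uniform distribution on profiles (voters independent and
uniform over the m! rankings).\<close>
definition prob_CW_IC :: "nat \<Rightarrow> nat \<Rightarrow> real" where
  "prob_CW_IC m n =
     measure_pmf.prob (pmf_of_set (profiles m n)) {P. condorcet_winner m n P m}"

definition Hinv :: "nat \<Rightarrow> nat \<Rightarrow> nat \<Rightarrow> real" where
  "Hinv m i j = 6 * ((if i = j then 1 else 0) - 1 / (real m + 1))"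

definition detH :: "nat \<Rightarrow> real" where
  "detH m = (real m + 1) / 2 * (1 / 6 ^ (m - 1))"

definition quadH :: "nat \<Rightarrow> (nat \<Rightarrow> real) \<Rightarrow> real" where
  "quadH m u = (\<Sum>i<m-1. \<Sum>j<m-1. u i * Hinv m i j * u j)"

abbreviation lebesgue_dim :: "nat \<Rightarrow> (nat \<Rightarrow> real) measure" where
  "lebesgue_dim k \<equiv> PiM {..<k} (\<lambda>_. lborel)"

definition pos_orthant :: "nat \<Rightarrow> (nat \<Rightarrow> real) set" where
  "pos_orthant k = {u \<in> space (lebesgue_dim k). \<forall>i<k. u i > 0}"

definition a0 :: "nat \<Rightarrow> real" where
  "a0 m = 1 / sqrt ((2 * pi) ^ (m - 1) * detH m) *
     (\<integral>u \<in> pos_orthant (m - 1). exp (- quadH m u / 2) \<partial>lebesgue_dim (m - 1))"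

definition a1 :: "nat \<Rightarrow> nat \<Rightarrow> real" where
  "a1 m n = (if odd n then 0 else
     - (6 / (real m + 1)) * (1 / sqrt ((2 * pi) ^ (m - 1) * detH m)) *
     (\<integral>u \<in> pos_orthant (m - 1). (\<Sum>i<m-1. u i) * exp (- quadH m u / 2) \<partial>lebesgue_dim (m - 1)))"

end

theory Submission
  imports Defs "HOL-Real_Asymp.Real_Asymp"
begin

text \<open>
  Write \<open>d = m - 1\<close>. Inserting the candidates into a uniformly random order by means of independent
  uniform positions shows that a voter, given the position of candidate \<open>m\<close>, ranks \<open>m\<close> above the
  other \<open>d\<close> candidates independently with the same probability \<open>(1 + s) / 2\<close>, where \<open>s\<close> is uniform on
  \<open>[-1, 1]\<close>. Hence the probability in question is the expectation of \<open>win n s ^ d\<close>, where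
  \<open>win n s\<close> is the probability that a sum of \<open>n\<close> independent signs with means \<open>s v\<close> is positive, and
  the problem becomes one-dimensional.

  For even \<open>n\<close> a positive sum is a sum exceeding \<open>1\<close>, so that shifting by the parity reduces to odd
  integers, for which the sign function has a Dirichlet kernel representation. Comparing
  characteristic functions gives \<open>win n s = Phi ((B - \<epsilon>) / sqrt V) + O(1/n)\<close> in mean, where \<open>B\<close> and
  \<open>V\<close> are the conditional mean and variance, and \<open>\<epsilon> \<in> {0, 1}\<close> is the parity shift; the conditional third
  cumulant is a centred sum and contributes only \<open>O(1/n)\<close>. The fluctuation of \<open>V\<close> is uncorrelated
  with \<open>B\<close> and also contributes \<open>O(1/n)\<close>. As the third moment of \<open>s\<close> vanishes, Lindeberg's replacement
  of \<open>B / sqrt n\<close> by a normal variable costs \<open>O(1/n)\<close>, and a first-order expansion in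
  \<open>\<epsilon> / sqrt n\<close> gives both coefficients. They agree with the orthant integrals because the
  normal law with covariance \<open>H\<close> is the law of \<open>\<xi> i / sqrt 6 + Z / sqrt 12\<close> with independent
  standard normal \<open>\<xi> i\<close> and \<open>Z\<close>.
\<close>

section \<open>The law of a single ranking\<close>

text \<open>The obstacle is the lattice structure in dimension d: the vote counts against the rivals
  are dependent integers, and an expansion with error O(1/n) has to see their parity. Conditioning
  makes the rivals independent with equal laws, so parity enters through one sum of signs, for which
  inversion is explicit, and the dimension survives only as the exponent d. The price is a random
  conditional law, each of whose first-order effects must be shown to cancel in mean. Origin of the
  constants: two signs of one voter have covariance E s^2 = 1/3, so the sign sums have covariance 4
  H per voter; H itself belongs to the 0-1 indicators, with variance 1/4 and covariance 1/12. The
  conditional variance per voter has mean 1 - 1/3 = 2/3, and sqrt (1/3) / sqrt (2/3) = 1 / sqrt 2 is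
  the scale in \<open>Phi (z / sqrt 2)\<close>. The Gaussian estimates need a conditional variance
  of at least n/3, half its mean; profiles of latent values that violate this are paid for by a
  Chebyshev-type bound of order 1/n.\<close>

definition below :: "nat \<Rightarrow> nat list \<Rightarrow> nat set" where
  "below a r = {b. ranks_above r a b}"

text \<open>Distinctness pins the occurrence of \<open>a\<close> to a single index, so the two
  existential positions in \<open>ranks_above\<close> reduce to membership in the suffix.\<close>

lemma ranks_above_split:
  assumes "distinct (xs @ a # ys)"
  shows "ranks_above (xs @ a # ys) a b \<longleftrightarrow> b \<in> set ys"
proof
  let ?r = "xs @ a # ys"
  assume "ranks_above ?r a b"
  then obtain i j where ij: "i < j" "j < length ?r" "?r ! i = a" "?r ! j = b"
    unfolding ranks_above_def by blast
  have "?r ! length xs = a" by simp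
  then have "i = length xs"
    using ij assms nth_eq_iff_index_eq[of ?r i "length xs"] by simp
  then show "b \<in> set ys"
    using ij by (auto simp: nth_append nth_Cons split: nat.splits if_splits)
next
  assume "b \<in> set ys"
  then obtain k where k: "k < length ys" "ys ! k = b" by (auto simp: in_set_conv_nth)
  show "ranks_above (xs @ a # ys) a b"
    unfolding ranks_above_def
    by (rule exI[of _ "length xs"], rule exI[of _ "Suc (length xs + k)"])
       (use k in \<open>auto simp: nth_append\<close>)
qed

text \<open>A ranking with exactly \<open>A\<close> below \<open>a\<close> is
  \<open>xs @ a # ys\<close>, with \<open>ys\<close> an ordering of \<open>A\<close> and
  \<open>xs\<close> an ordering of the remaining candidates; the decomposition is unique because
  \<open>a\<close> occurs in neither list. The count depends on \<open>A\<close> only through its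
  size and has the shape of a Beta integral.\<close>

lemma card_permutations_below:
  assumes A: "finite X" "a \<in> X" "A \<subseteq> X - {a}"
  shows "card {r \<in> permutations_of_set X. below a r = A} = fact (card A) * fact (card X - 1 - card A)"
proof -
  let ?P = "permutations_of_set (X - {a} - A) \<times> permutations_of_set A"
  let ?f = "\<lambda>(xs, ys). xs @ a # ys"
  have inj: "inj_on ?f ?P"
  proof (rule inj_onI, clarsimp)
    fix xs ys xs' ys'
    assume "xs \<in> permutations_of_set (X - {a} - A)" "ys \<in> permutations_of_set A"
      "xs' \<in> permutations_of_set (X - {a} - A)" "ys' \<in> permutations_of_set A"
      and eq: "xs @ a # ys = xs' @ a # ys'"
    then have "a \<notin> set xs" "a \<notin> set xs'" by (auto simp: permutations_of_set_def)
    then show "xs = xs' \<and> ys = ys'"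
      using eq by (auto simp: append_eq_append_conv2 Cons_eq_append_conv append_eq_Cons_conv)
  qed
  have img: "?f ` ?P = {r \<in> permutations_of_set X. below a r = A}"
  proof (intro equalityI subsetI)
    fix r assume "r \<in> ?f ` ?P"
    then obtain xs ys where r: "r = xs @ a # ys"
      and xs: "set xs = X - {a} - A" "distinct xs" and ys: "set ys = A" "distinct ys"
      by (auto simp: permutations_of_set_def)
    have d: "distinct (xs @ a # ys)" using xs ys A by auto
    have "below a r = A" using ranks_above_split[OF d] ys by (auto simp: below_def r)
    moreover have "r \<in> permutations_of_set X" using xs ys A d by (auto simp: permutations_of_set_def r)
    ultimately show "r \<in> {r \<in> permutations_of_set X. below a r = A}" by simp
  next
    fix r assume "r \<in> {r \<in> permutations_of_set X. below a r = A}"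
    then have r: "set r = X" "distinct r" "below a r = A" by (auto simp: permutations_of_set_def)
    then obtain xs ys where sp: "r = xs @ a # ys" using A by (metis split_list)
    have "set ys = A" using ranks_above_split[of xs a ys] r sp by (auto simp: below_def)
    moreover have "set xs = X - {a} - A" using calculation r sp by auto
    ultimately have "(xs, ys) \<in> ?P" using r sp by (auto simp: permutations_of_set_def)
    then show "r \<in> ?f ` ?P" using sp by force
  qed
  have "card {r \<in> permutations_of_set X. below a r = A} = card ?P"
    using card_image[OF inj] img by simp
  also have "\<dots> = fact (card (X - {a} - A)) * fact (card A)"
    using A finite_subset[OF A(3)] by (simp add: card_cartesian_product)
  also have "card (X - {a} - A) = card X - 1 - card A"
    using A finite_subset[OF A(3)] by (simp add: card_Diff_subset)
  finally show ?thesis by simp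
qed

lemma below_permutation:
  assumes "r \<in> permutations_of_set X"
  shows "below a r \<subseteq> X - {a}"
proof
  fix b assume "b \<in> below a r"
  then obtain i j where "i < j" "j < length r" "r ! i = a" "r ! j = b"
    unfolding below_def ranks_above_def by blast
  then show "b \<in> X - {a}"
    using assms nth_eq_iff_index_eq[of r i j] by (auto simp: permutations_of_set_def)
qed

text \<open>Applied with \<open>b\<close> sending a ranking to the set below \<open>m\<close>: the
  winning condition sees a profile only through these sets, and each fibre is again a product, so
  its size is a product of counts for single voters.\<close>

lemma sum_PiE_fibres:
  fixes F :: "('i \<Rightarrow> 'b) \<Rightarrow> real"
  assumes I: "finite I" and R: "finite R" and T: "finite T" "b ` R \<subseteq> T"
  shows "(\<Sum>P\<in>PiE I (\<lambda>_. R). F (\<lambda>i\<in>I. b (P i))) =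
         (\<Sum>D\<in>PiE I (\<lambda>_. T). (\<Prod>i\<in>I. real (card {r\<in>R. b r = D i})) * F D)"
proof -
  let ?g = "\<lambda>P. \<lambda>i\<in>I. b (P i)"
  have fin: "finite (PiE I (\<lambda>_. R))" "finite (PiE I (\<lambda>_. T))"
    using I R T by (auto intro: finite_PiE)
  have "(\<Sum>P\<in>PiE I (\<lambda>_. R). F (?g P)) =
     (\<Sum>D\<in>PiE I (\<lambda>_. T). \<Sum>P\<in>{P \<in> PiE I (\<lambda>_. R). ?g P = D}. F (?g P))"
    by (rule sum.group[symmetric]) (use fin T in \<open>auto simp: PiE_iff image_subset_iff\<close>)
  also have "\<dots> = (\<Sum>D\<in>PiE I (\<lambda>_. T). (\<Prod>i\<in>I. real (card {r\<in>R. b r = D i})) * F D)"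
  proof (rule sum.cong[OF refl])
    fix D assume D: "D \<in> PiE I (\<lambda>_. T)"
    have eq: "{P \<in> PiE I (\<lambda>_. R). ?g P = D} = PiE I (\<lambda>i. {r\<in>R. b r = D i})" (is "?L = ?Q")
    proof (intro equalityI subsetI)
      fix P assume P: "P \<in> ?L"
      then have "b (P i) = D i" if "i \<in> I" for i using that by (auto dest: fun_cong[of _ _ i])
      then show "P \<in> ?Q" using P by (auto simp: PiE_iff)
    next
      fix P assume P: "P \<in> ?Q"
      have "?g P = D"
        by (rule PiE_ext[of _ I "\<lambda>_. T"]) (use P D T in \<open>auto simp: PiE_iff extensional_def\<close>)
      then show "P \<in> ?L" using P by (auto simp: PiE_iff)
    qed
    have "(\<Sum>P\<in>?L. F (?g P)) = (\<Sum>P\<in>?L. F D)" by (rule sum.cong) auto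
    also have "\<dots> = (\<Prod>i\<in>I. real (card {r\<in>R. b r = D i})) * F D"
      using I by (simp add: eq card_PiE)
    finally show "(\<Sum>P\<in>?L. F (?g P)) = \<dots>" .
  qed
  finally show ?thesis .
qed

lemma Beta_integral_fact:
  "((\<lambda>t. t ^ k * (1 - t) ^ l) has_integral (fact k * fact l / fact (k + l + 1) :: real)) {0..1}"
proof -
  have "((\<lambda>t. t powr (real (Suc k) - 1) * (1 - t) powr (real (Suc l) - 1)) has_integral
      Beta (real (Suc k)) (real (Suc l))) {0..1}"
    by (rule has_integral_Beta_real) auto
  moreover have "Beta (real (Suc k)) (real (Suc l)) = fact k * fact l / fact (k + l + 1)"
  proof -
    have "Gamma (real (Suc k)) = fact k" "Gamma (real (Suc l)) = fact l"
      "Gamma (1 + real (Suc (k + l))) = fact (Suc (k + l))"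
      using Gamma_fact[of k, where 'a=real] Gamma_fact[of l, where 'a=real] Gamma_fact[of "Suc (k + l)", where 'a=real]
      by (simp_all del: fact_Suc)
    moreover have "real (Suc k) + real (Suc l) = 1 + real (Suc (k + l))" by simp
    ultimately show ?thesis by (simp only: Beta_def add_Suc_right Suc_eq_plus1 [symmetric])
  qed
  ultimately have *: "((\<lambda>t. t powr (real (Suc k) - 1) * (1 - t) powr (real (Suc l) - 1)) has_integral
      fact k * fact l / fact (k + l + 1)) {0..1}" by simp
  \<comment> \<open>At \<open>t = 0\<close> with \<open>k = 0\<close>, and at \<open>t = 1\<close>
    with \<open>l = 0\<close>, \<open>powr\<close> yields 0 where the power yields 1, hence the two
    exceptional points.\<close>
  show ?thesis
    by (rule has_integral_spike_finite[OF _ _ *, of "{0, 1}"]) (auto simp: powr_realpow)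
qed

section \<open>Conditional independence given a uniform latent variable\<close>

text \<open>The latent position is rescaled from \<open>[0, 1]\<close> to \<open>[-1, 1]\<close> so
  that its value is the conditional mean of the sign of one comparison; it is then centred, with all
  odd moments zero.\<close>

definition unif :: "real measure" where
  "unif = uniform_measure lborel {-1..1}"

lemma prob_space_unif: "prob_space unif"
  unfolding unif_def by (rule prob_space_uniform_measure) auto

lemma sets_unif [measurable_cong, simp]: "sets unif = sets borel"
  by (simp add: unif_def)

lemma space_unif [simp]: "space unif = UNIV"
  by (simp add: unif_def)

lemma AE_unif: "AE x in unif. \<bar>x\<bar> \<le> 1"
  unfolding unif_def by (rule AE_uniform_measureI) auto

lemma product_prob_space_unif: "product_prob_space (\<lambda>_. unif)"
  by (intro product_prob_spaceI prob_space_unif)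

text \<open>Reduces integrals against \<open>unif\<close> to gauge integrals, where antiderivatives
  and substitutions are at hand. Continuity on the compact interval provides absolute integrability,
  and 2 is the length of the interval.\<close>

lemma unif_has_integral:
  fixes f :: "real \<Rightarrow> real"
  assumes f: "continuous_on {-1..1} f" "(f has_integral I) {-1..1}" and [measurable]: "f \<in> borel_measurable borel"
  shows "integral\<^sup>L unif f = I / 2" "integrable unif f"
proof -
  have si: "set_integrable lborel {-1..1} f"
    by (rule borel_integrable_atLeastAtMost') (rule f)
  have I: "(LINT x:{-1..1}|lborel. f x) = I"
    using set_borel_integral_eq_integral(2)[OF si] f(2) by (simp add: integral_unique)
  have "unif = density lborel (\<lambda>x. ennreal (indicator {-1..1} x / 2))"
    unfolding unif_def uniform_measure_def
    by (rule density_cong) (auto simp: indicator_def divide_ennreal[symmetric] divide_ennreal_def)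
  note u = this
  have "integral\<^sup>L unif f = (LBINT x. (indicator {-1..1} x / 2) *\<^sub>R f x)"
    unfolding u by (rule integral_density) simp_all
  also have "\<dots> = (LBINT x. indicator {-1..1} x *\<^sub>R f x) / 2"
    by simp
  also have "\<dots> = I / 2"
    using I by (simp add: set_lebesgue_integral_def)
  finally show "integral\<^sup>L unif f = I / 2" .
  have "integrable lborel (\<lambda>x. (indicator {-1..1} x / 2) *\<^sub>R f x)"
    using si by (simp add: set_integrable_def)
  then show "integrable unif f"
    unfolding u by (subst integrable_density) simp_all
qed

text \<open>Substitute \<open>t = (1 + s) / 2\<close>. By \<open>card_permutations_below\<close> the
  value is the probability that a prescribed set of \<open>k\<close> out of \<open>k + l\<close>
  rivals is the set below \<open>m\<close>, so this identity is what exhibits the comparisons of one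
  voter as conditionally independent.\<close>

lemma Beta_integral_unif:
  "(\<integral>s. ((1 + s) / 2) ^ k * ((1 - s) / 2) ^ l \<partial>unif) = fact k * fact l / fact (k + l + 1)"
  "integrable unif (\<lambda>s. ((1 + s) / 2) ^ k * ((1 - s) / 2) ^ l)"
proof -
  let ?f = "\<lambda>s::real. ((1 + s) / 2) ^ k * ((1 - s) / 2) ^ l"
  define c :: real where "c = fact k * fact l / fact (k + l + 1)"
  have "((\<lambda>t. t ^ k * (1 - t) ^ l) has_integral c) {0..1}"
    unfolding c_def by (rule Beta_integral_fact)
  then have "((\<lambda>x. ((1/2) * x + 1/2) ^ k * (1 - ((1/2) * x + 1/2)) ^ l) has_integral 2 * c) ((\<lambda>x. 2 * x - 1) ` {0..1})"
    using has_integral_affinity[of "\<lambda>t::real. t ^ k * (1 - t) ^ l" c 0 1 "1/2" "1/2"] by simp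
  moreover have "(\<lambda>x::real. 2 * x - 1) ` {0..1} = {-1..1}"
    using image_affinity_atLeastAtMost[of 2 "-1" 0 "1::real"] by simp
  moreover have "(1/2) * x + 1/2 = (1 + x) / 2" "1 - (1 + x) / 2 = (1 - x) / 2" for x :: real
    by (simp_all add: field_simps)
  ultimately have hi: "(?f has_integral 2 * (fact k * fact l / fact (k + l + 1))) {-1..1}"
    unfolding c_def by (simp only:)
  have cont: "continuous_on {-1..1} ?f" by (intro continuous_intros) auto
  have meas: "?f \<in> borel_measurable borel" by measurable
  show "integral\<^sup>L unif ?f = fact k * fact l / fact (k + l + 1)" "integrable unif ?f"
    using unif_has_integral[OF cont hi meas] by (simp_all del: fact_Suc)
qed

abbreviation vweight :: "(nat \<Rightarrow> real) \<Rightarrow> nat set \<Rightarrow> nat \<Rightarrow> real" where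
  "vweight s D v \<equiv> if v \<in> D then (1 + s v) / 2 else (1 - s v) / 2"

text \<open>\<open>D\<close> ranges over the possible sets of voters who prefer \<open>m\<close> to
  one fixed rival; \<open>n < 2 * card D\<close> says that the corresponding sum of signs is
  positive.\<close>

definition win :: "nat \<Rightarrow> (nat \<Rightarrow> real) \<Rightarrow> real" where
  "win n s = (\<Sum>D\<in>{D \<in> Pow {..<n}. n < 2 * card D}. \<Prod>v<n. vweight s D v)"

text \<open>The \<open>d\<close> factors belong to the \<open>d\<close> rivals. Expanding the
  product gives a sum over a voter set for each rival, and reading the same incidence relation by
  voters gives a set of rivals for each voter, with a weight that factors over the voters.\<close>

lemma win_power:
  "win n s ^ d = (\<Sum>D\<in>PiE {..<n} (\<lambda>_. Pow {1..d}).
     (if \<forall>j\<in>{1..d}. n < 2 * card {v\<in>{..<n}. j \<in> D v} then 1 else 0) *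
     (\<Prod>v<n. ((1 + s v) / 2) ^ card (D v) * ((1 - s v) / 2) ^ (d - card (D v))))"
proof -
  let ?w = "\<lambda>D v. vweight s D v"
  have "win n s ^ d = (\<Prod>j\<in>{1..d}. \<Sum>D\<in>Pow {..<n}. (if n < 2 * card D then 1 else 0) * (\<Prod>v<n. ?w D v))"
    unfolding win_def
    by (simp add: sum.inter_filter[symmetric] if_distrib[of "\<lambda>x. x * _"] cong: if_cong)
  also have "\<dots> = (\<Sum>E\<in>PiE {1..d} (\<lambda>_. Pow {..<n}). \<Prod>j\<in>{1..d}. (if n < 2 * card (E j) then 1 else 0) * (\<Prod>v<n. ?w (E j) v))"
    by (rule prod_sum_PiE) auto
  also have "\<dots> = (\<Sum>D\<in>PiE {..<n} (\<lambda>_. Pow {1..d}).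
     (\<Prod>j\<in>{1..d}. (if n < 2 * card {v\<in>{..<n}. j \<in> D v} then 1 else 0) * (\<Prod>v<n. if j \<in> D v then (1 + s v) / 2 else (1 - s v) / 2)))"
  \<comment> \<open>The bijection is the transposition of the relation "voter \<open>v\<close>
    prefers \<open>m\<close> to rival \<open>j\<close>", written as families of sets in the two
    directions.\<close>
  proof (rule sum.reindex_bij_witness[where i = "\<lambda>D. \<lambda>j\<in>{1..d}. {v\<in>{..<n}. j \<in> D v}" and j = "\<lambda>E. \<lambda>v\<in>{..<n}. {j\<in>{1..d}. v \<in> E j}"], goal_cases)
    case (1 E) then show ?case by (auto simp: PiE_iff extensional_def fun_eq_iff)
  next
    case (2 E) then show ?case by (auto simp: PiE_iff)
  next
    case (3 D)
    have "{j \<in> {1..d}. j \<in> D v} = D v" if "v < n" for v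
      using PiE_mem[OF 3, of v] that by auto
    then show ?case
      by (intro PiE_ext[OF _ 3]) (use 3 in \<open>auto simp: PiE_iff cong: conj_cong\<close>)
  next
    case (4 D) then show ?case by (auto simp: PiE_iff)
  next
    case (5 E)
    have "{v \<in> {..<n}. j \<in> (\<lambda>v\<in>{..<n}. {j\<in>{1..d}. v \<in> E j}) v} = E j" if "j \<in> {1..d}" for j
      using 5 that by (auto simp: PiE_iff)
    moreover have "(j \<in> (\<lambda>v\<in>{..<n}. {j\<in>{1..d}. v \<in> E j}) v) = (v \<in> E j)" if "j \<in> {1..d}" "v < n" for j v
      using that by auto
    ultimately show ?case by (intro prod.cong) (auto simp del: restrict_apply)
  qed
  also have "\<dots> = (\<Sum>D\<in>PiE {..<n} (\<lambda>_. Pow {1..d}).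
     (if \<forall>j\<in>{1..d}. n < 2 * card {v\<in>{..<n}. j \<in> D v} then 1 else 0) *
     (\<Prod>v<n. ((1 + s v) / 2) ^ card (D v) * ((1 - s v) / 2) ^ (d - card (D v))))"
  proof (rule sum.cong[OF refl])
    fix D assume D: "D \<in> PiE {..<n} (\<lambda>_. Pow {1..d})"
    have "(\<Prod>j\<in>{1..d}. if n < 2 * card {v\<in>{..<n}. j \<in> D v} then 1 else (0::real)) =
      (if \<forall>j\<in>{1..d}. n < 2 * card {v\<in>{..<n}. j \<in> D v} then 1 else 0)"
      by auto
    moreover have "(\<Prod>j\<in>{1..d}. if j \<in> D v then (1 + s v) / 2 else (1 - s v) / 2) =
       ((1 + s v) / 2) ^ card (D v) * ((1 - s v) / 2) ^ (d - card (D v))" if "v < n" for v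
    proof -
      have sub: "D v \<subseteq> {1..d}" using D that by (auto simp: PiE_iff)
      have "(\<Prod>j\<in>{1..d}. if j \<in> D v then (1 + s v) / 2 else (1 - s v) / 2) =
        (\<Prod>j\<in>{1..d} \<inter> {j. j \<in> D v}. (1 + s v) / 2) * (\<Prod>j\<in>{1..d} \<inter> - {j. j \<in> D v}. (1 - s v) / 2)"
        by (rule prod.If_cases) simp
      also have "{1..d} \<inter> {j. j \<in> D v} = D v" using sub by auto
      also have "card ({1..d} \<inter> - {j. j \<in> D v}) = d - card (D v)"
        using sub by (simp add: Diff_eq[symmetric] card_Diff_subset finite_subset[OF sub])
      then have "(\<Prod>j\<in>{1..d} \<inter> - {j. j \<in> D v}. (1 - s v) / 2) = ((1 - s v) / 2) ^ (d - card (D v))"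
        by simp
      finally show ?thesis by simp
    qed
    moreover have "(\<Prod>j\<in>{1..d}. \<Prod>v<n. if j \<in> D v then (1 + s v) / 2 else (1 - s v) / 2) =
      (\<Prod>v<n. \<Prod>j\<in>{1..d}. if j \<in> D v then (1 + s v) / 2 else (1 - s v) / 2)"
      by (rule prod.swap)
    ultimately show "(\<Prod>j\<in>{1..d}. (if n < 2 * card {v\<in>{..<n}. j \<in> D v} then 1 else 0) * (\<Prod>v<n. if j \<in> D v then (1 + s v) / 2 else (1 - s v) / 2)) =
     (if \<forall>j\<in>{1..d}. n < 2 * card {v\<in>{..<n}. j \<in> D v} then 1 else 0) *
     (\<Prod>v<n. ((1 + s v) / 2) ^ card (D v) * ((1 - s v) / 2) ^ (d - card (D v)))"
      by (simp add: prod.distrib)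
  qed
  finally show ?thesis .
qed

text \<open>The frequency of each set below \<open>m\<close> is a Beta integral, so by Fubini the
  product over the voters is one integral over independent latent values; exchanging it with the
  finite sum leaves the expansion of \<open>win n s ^ d\<close> as integrand.\<close>

lemma prob_CW_IC_eq_integral:
  assumes m: "m \<ge> 1"
  shows "prob_CW_IC m n = (\<integral>s. win n s ^ (m - 1) \<partial>PiM {..<n} (\<lambda>_. unif))"
proof -
  interpret product_prob_space "\<lambda>_::nat. unif" by (rule product_prob_space_unif)
  define d where "d = m - 1"
  have md: "m = Suc d" using m by (simp add: d_def)
  let ?D = "PiE {..<n} (\<lambda>_. Pow {1..d})"
  define F :: "(nat \<Rightarrow> nat set) \<Rightarrow> real"
    where "F D = (if \<forall>j\<in>{1..d}. n < 2 * card {v\<in>{..<n}. j \<in> D v} then 1 else 0)" for D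
  let ?R = "rankings m"
  have fR: "finite ?R" "card ?R = fact m" "?R \<noteq> {}"
    by (auto simp: rankings_def)
  have fP: "finite (profiles m n)" "card (profiles m n) = fact m ^ n" "profiles m n \<noteq> {}"
    using fR by (auto simp: profiles_def card_PiE PiE_eq_empty_iff intro!: finite_PiE)
  have rest: "{1..m} - {m} = {1..d}" using md by auto
  have cw: "(if condorcet_winner m n P m then 1 else 0) = F (\<lambda>v\<in>{..<n}. below m (P v))" for P
  proof -
    have "{v \<in> {..<n}. j \<in> (\<lambda>v\<in>{..<n}. below m (P v)) v} = {v \<in> {..<n}. ranks_above (P v) m j}" for j
      by (auto simp: below_def)
    then show ?thesis unfolding condorcet_winner_def F_def rest by presburger
  qed
  have "prob_CW_IC m n = real (card (profiles m n \<inter> {P. condorcet_winner m n P m})) / fact m ^ n"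
    unfolding prob_CW_IC_def using fP by (simp add: measure_pmf_of_set)
  also have "real (card (profiles m n \<inter> {P. condorcet_winner m n P m})) =
      (\<Sum>P\<in>profiles m n. F (\<lambda>v\<in>{..<n}. below m (P v)))"
    using fP by (simp add: cw[symmetric] sum.If_cases)
  also have "\<dots> = (\<Sum>D\<in>?D. (\<Prod>v<n. real (card {r\<in>?R. below m r = D v})) * F D)"
    unfolding profiles_def
    by (rule sum_PiE_fibres)
       (use fR below_permutation[where X="{1..m}" and a=m] rest in \<open>auto simp: rankings_def\<close>)
  also have "\<dots> / fact m ^ n = (\<Sum>D\<in>?D. F D * (\<Prod>v<n. real (card {r\<in>?R. below m r = D v}) / fact m))"
    by (simp add: sum_divide_distrib prod_dividef mult.commute)
  also have "\<dots> = (\<Sum>D\<in>?D. F D * (\<Prod>v<n. \<integral>s. ((1 + s) / 2) ^ card (D v) * ((1 - s) / 2) ^ (d - card (D v)) \<partial>unif))"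
  proof (intro sum.cong[OF refl] arg_cong2[where f="(*)"] prod.cong refl)
    fix D v assume "D \<in> ?D" "v \<in> {..<n}"
    then have sub: "D v \<subseteq> {1..d}" by (auto simp: PiE_iff)
    then have "card (D v) \<le> d" using card_mono[OF _ sub] by simp
    moreover have "card {r\<in>?R. below m r = D v} = fact (card (D v)) * fact (d - card (D v))"
      using card_permutations_below[of "{1..m}" m "D v"] m sub rest by (simp add: rankings_def d_def)
    ultimately show "real (card {r\<in>?R. below m r = D v}) / fact m =
      (\<integral>s. ((1 + s) / 2) ^ card (D v) * ((1 - s) / 2) ^ (d - card (D v)) \<partial>unif)"
      by (simp add: Beta_integral_unif md)
  qed
  also have "\<dots> = (\<Sum>D\<in>?D. F D * (\<integral>s. (\<Prod>v<n. ((1 + s v) / 2) ^ card (D v) * ((1 - s v) / 2) ^ (d - card (D v))) \<partial>PiM {..<n} (\<lambda>_. unif)))"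
    by (subst product_integral_prod) (auto intro: Beta_integral_unif(2))
  also have "\<dots> = (\<integral>s. (\<Sum>D\<in>?D. F D * (\<Prod>v<n. ((1 + s v) / 2) ^ card (D v) * ((1 - s v) / 2) ^ (d - card (D v)))) \<partial>PiM {..<n} (\<lambda>_. unif))"
    by (subst Bochner_Integration.integral_sum)
       (auto intro!: product_integrable_prod Beta_integral_unif(2))
  also have "\<dots> = (\<integral>s. win n s ^ d \<partial>PiM {..<n} (\<lambda>_. unif))"
    by (simp add: win_power F_def)
  finally show ?thesis by (simp add: d_def)
qed

section \<open>The normal distribution function and its Fourier representation\<close>

abbreviation "\<phi> \<equiv> std_normal_density"

lemma integral_even_half:
  fixes f :: "real \<Rightarrow> real"
  assumes f: "integrable lborel f" and even: "\<And>x. f (- x) = f x"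
  shows "(LBINT x. indicator {0<..} x * f x) = (LBINT x. f x) / 2"
proof -
  have i: "integrable lborel (\<lambda>x. indicator A x * f x)" if "A \<in> sets borel" for A
    using f that by (auto simp: integrable_mult_indicator[where 'b=real, simplified])
  have "(LBINT x. f x) = (LBINT x. indicator {0<..} x * f x + indicator {..<0} x * f x)"
    by (rule integral_cong_AE)
       (use f AE_lborel_singleton[of 0] in \<open>auto simp: indicator_def elim!: eventually_mono\<close>)
  also have "\<dots> = (LBINT x. indicator {0<..} x * f x) + (LBINT x. indicator {..<0} x * f x)"
    by (intro Bochner_Integration.integral_add i) auto
  also have "(LBINT x. indicator {..<0} x * f x) = (LBINT x. indicator {0<..} x * f x)"
    by (subst lborel_integral_real_affine[where c="-1" and t=0])
       (auto simp: even indicator_def intro!: Bochner_Integration.integral_cong)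
  finally show ?thesis by simp
qed

lemma integrable_power_exp_square:
  fixes c :: real
  assumes "c > 0"
  shows "integrable lborel (\<lambda>x. \<bar>x\<bar> ^ k * exp (- c * x\<^sup>2))"
proof -
  have "integrable lborel (\<lambda>x. \<phi> (0 + sqrt (2 * c) * x) * \<bar>0 + sqrt (2 * c) * x\<bar> ^ k)"
    using assms by (intro lborel_integrable_real_affine[OF integrable_std_normal_moment_abs]) auto
  then have "integrable lborel (\<lambda>x. (sqrt (2 * pi) / sqrt (2 * c) ^ k) *
       (\<phi> (0 + sqrt (2 * c) * x) * \<bar>0 + sqrt (2 * c) * x\<bar> ^ k))"
    by (rule integrable_mult_right)
  also have "(\<lambda>x. (sqrt (2 * pi) / sqrt (2 * c) ^ k) *
       (\<phi> (0 + sqrt (2 * c) * x) * \<bar>0 + sqrt (2 * c) * x\<bar> ^ k)) = (\<lambda>x. \<bar>x\<bar> ^ k * exp (- c * x\<^sup>2))"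
    using assms by (auto simp: std_normal_density_def abs_mult power_mult_distrib fun_eq_iff)
  finally show ?thesis .
qed

text \<open>The real part of the characteristic function of the normal law, with the normalising
  constant of the density moved across.\<close>

lemma integral_cos_gauss:
  "(LBINT x. cos (y * x) * exp (- x\<^sup>2 / 2)) = sqrt (2 * pi) * exp (- y\<^sup>2 / 2)"
proof -
  have int: "integrable std_normal_distribution (\<lambda>x. iexp (y * x))"
  proof -
    interpret real_distribution std_normal_distribution by (rule real_dist_normal_dist)
    show ?thesis by (rule integrable_const_bound[of _ 1]) auto
  qed
  have "(\<integral>x. cos (y * x) \<partial>std_normal_distribution) = Re (char std_normal_distribution y)"
    unfolding char_def using integral_Re[OF int] by (simp add: Re_exp)
  also have "\<dots> = exp (- y\<^sup>2 / 2)"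
    by (simp only: char_std_normal_distribution Re_complex_of_real)
  finally have "(LBINT x. \<phi> x * cos (y * x)) = exp (- y\<^sup>2 / 2)"
    by (subst (asm) integral_density) auto
  moreover have "(LBINT x. \<phi> x * cos (y * x)) =
     (1 / sqrt (2 * pi)) * (LBINT x. cos (y * x) * exp (- x\<^sup>2 / 2))"
    by (subst integral_mult_right_zero[symmetric]) (simp add: std_normal_density_def mult_ac)
  ultimately show ?thesis by (simp add: field_simps)
qed

definition Phi :: "real \<Rightarrow> real" where
  "Phi x = measure std_normal_distribution {..x}"

lemma Phi_bounds: "0 \<le> Phi x" "Phi x \<le> 1"
proof -
  interpret real_distribution std_normal_distribution by (rule real_dist_normal_dist)
  show "0 \<le> Phi x" "Phi x \<le> 1" by (auto simp: Phi_def)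
qed

lemma measure_std_normal_greaterThan: "measure std_normal_distribution {x<..} = Phi (- x)"
proof -
  have "emeasure std_normal_distribution {x<..} = (\<integral>\<^sup>+w. ennreal (\<phi> w * indicator {x<..} w) \<partial>lborel)"
    by (subst emeasure_density) (auto simp: indicator_def intro!: nn_integral_cong)
  also have "\<dots> = (\<integral>\<^sup>+w. ennreal (\<phi> w * indicator {..<-x} w) \<partial>lborel)"
    by (subst nn_integral_real_affine[where c="-1" and t=0])
       (auto simp: indicator_def std_normal_density_def intro!: nn_integral_cong)
  also have "\<dots> = (\<integral>\<^sup>+w. ennreal (\<phi> w * indicator {..-x} w) \<partial>lborel)"
    by (rule nn_integral_cong_AE)
       (use AE_lborel_singleton[of "-x"] in \<open>auto simp: indicator_def elim!: eventually_mono\<close>)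
  also have "\<dots> = emeasure std_normal_distribution {..-x}"
    by (subst emeasure_density) (auto simp: indicator_def intro!: nn_integral_cong)
  finally show ?thesis by (simp add: Phi_def measure_def)
qed

lemma Phi_minus: "Phi (- x) = 1 - Phi x"
proof -
  interpret real_distribution std_normal_distribution by (rule real_dist_normal_dist)
  have "UNIV - {..x} = {x<..}" by auto
  then show ?thesis
    using prob_compl[of "{..x}"] measure_std_normal_greaterThan[of x] by (simp add: Phi_def)
qed

lemma Phi_0: "Phi 0 = 1 / 2"
  using Phi_minus[of 0] by simp

text \<open>The integrand is the density of the normal law with mean \<open>c\<close> and deviation
  \<open>1 / a\<close>. The formula serves the orthant integrals, where each coordinate has such a
  conditional law.\<close>

lemma nn_integral_normal_halfline:
  assumes "a > 0"
  shows "(\<integral>\<^sup>+u. ennreal (indicator {0<..} u * (a * \<phi> (a * (u - c)))) \<partial>lborel) = ennreal (Phi (a * c))"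
proof -
  interpret real_distribution std_normal_distribution by (rule real_dist_normal_dist)
  have "(\<integral>\<^sup>+u. ennreal (indicator {0<..} u * (a * \<phi> (a * (u - c)))) \<partial>lborel) =
     (\<integral>\<^sup>+w. ennreal (1 / a) * ennreal (indicator {0<..} (c + w / a) * (a * \<phi> w)) \<partial>lborel)"
    using assms by (subst nn_integral_real_affine[where c="1/a" and t=c])
       (auto simp: nn_integral_cmult field_simps)
  also have "\<dots> = (\<integral>\<^sup>+w. ennreal (\<phi> w) * indicator {- (a * c)<..} w \<partial>lborel)"
    using assms
    by (intro nn_integral_cong) (auto simp: indicator_def ennreal_mult[symmetric] field_simps)
  also have "\<dots> = emeasure std_normal_distribution {- (a * c)<..}"
    by (subst emeasure_density) auto
  also have "\<dots> = ennreal (Phi (a * c))"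
    using measure_std_normal_greaterThan[of "- (a * c)"] by (simp add: emeasure_eq_measure)
  finally show ?thesis .
qed

lemma DERIV_Phi: "(Phi has_real_derivative \<phi> x) (at x)"
proof -
  interpret real_distribution std_normal_distribution by (rule real_dist_normal_dist)
  have cont: "continuous_on A \<phi>" for A
    unfolding std_normal_density_def by (intro continuous_intros) auto
  \<comment> \<open>A window of radius 1 puts \<open>x\<close> in the interior, so the derivative
    within the interval given by the fundamental theorem is a full derivative.\<close>
  have eq: "Phi y = Phi (x - 1) + integral {x-1..y} \<phi>" if "y \<in> {x-1..x+1}" for y
  proof -
    have "Phi y - Phi (x - 1) = measure std_normal_distribution {x-1<..y}"
      using that cdf_diff_eq[of "x-1" y] by (cases "y = x - 1") (auto simp: cdf_def Phi_def)
    also have "\<dots> = (LINT t|lborel. \<phi> t * indicator {x-1<..y} t)"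
    proof -
      have "emeasure std_normal_distribution {x-1<..y} = (\<integral>\<^sup>+t. ennreal (\<phi> t * indicator {x-1<..y} t) \<partial>lborel)"
        by (subst emeasure_density) (auto simp: indicator_def intro!: nn_integral_cong)
      then show ?thesis by (subst integral_eq_nn_integral) (auto simp: measure_def)
    qed
    also have "\<dots> = (LINT t:{x-1..y}|lborel. \<phi> t)"
      unfolding set_lebesgue_integral_def
      by (rule integral_cong_AE)
         (use AE_lborel_singleton[of "x-1"] in \<open>auto simp: indicator_def elim!: eventually_mono\<close>)
    also have "\<dots> = integral {x-1..y} \<phi>"
      by (rule set_borel_integral_eq_integral(2)[OF borel_integrable_atLeastAtMost'[OF cont]])
    finally show ?thesis by simp
  qed
  have "((\<lambda>y. Phi (x - 1) + integral {x-1..y} \<phi>) has_real_derivative \<phi> x)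
      (at x within {x-1..x+1})"
    using DERIV_add[OF DERIV_const[of "Phi (x - 1)"] integral_has_real_derivative[OF cont, of x "x - 1" "x + 1"]]
    by simp
  then have "(Phi has_real_derivative \<phi> x) (at x within {x-1..x+1})"
    by (rule has_field_derivative_transform_within[OF _ zero_less_one]) (simp, rule eq[symmetric])
  then show ?thesis
    by (subst (asm) at_within_Icc_at) simp_all
qed

lemma sinc_gauss_integrable:
  fixes y v :: real
  assumes "v > 0"
  shows "integrable lborel (\<lambda>x. sin (y * x) / x * exp (- v * x\<^sup>2 / 2))"
proof (rule Bochner_Integration.integrable_bound[where f="\<lambda>x. \<bar>y\<bar> * exp (- (v/2) * x\<^sup>2)"])
  show "(\<lambda>x. sin (y * x) / x * exp (- v * x\<^sup>2 / 2)) \<in> borel_measurable lborel"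
    by measurable
  show "integrable lborel (\<lambda>x. \<bar>y\<bar> * exp (- (v/2) * x\<^sup>2))"
    using integrable_power_exp_square[of "v/2" 0] assms by simp
  show "AE x in lborel. norm (sin (y * x) / x * exp (- v * x\<^sup>2 / 2)) \<le> norm (\<bar>y\<bar> * exp (- (v/2) * x\<^sup>2))"
  proof (rule AE_I2)
    fix x :: real
    have "\<bar>sin (y * x)\<bar> \<le> \<bar>y\<bar> * \<bar>x\<bar>" using abs_sin_x_le_abs_x[of "y * x"] by (simp add: abs_mult)
    \<comment> \<open>At \<open>x = 0\<close> the quotient is 0 by the convention on division, so
      the bound holds there as well.\<close>
    then have "\<bar>sin (y * x) / x\<bar> \<le> \<bar>y\<bar>" by (cases "x = 0") (auto simp: field_simps)
    then show "norm (sin (y * x) / x * exp (- v * x\<^sup>2 / 2)) \<le> norm (\<bar>y\<bar> * exp (- (v/2) * x\<^sup>2))"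
      using mult_right_mono[of "\<bar>sin (y * x) / x\<bar>" "\<bar>y\<bar>" "exp (- v * x\<^sup>2 / 2)"] by (simp add: abs_mult)
  qed
qed

text \<open>Differentiation under the integral sign along an arbitrary null sequence:
  \<open>sin\<close> is 1-Lipschitz, so the difference quotients of \<open>sin (y * x) / x\<close>
  in \<open>y\<close> are at most 1 in absolute value and the Gaussian factor dominates.\<close>

lemma DERIV_sinc_gauss:
  "((\<lambda>y. LBINT x. sin (y * x) / x * exp (- x\<^sup>2 / 2)) has_real_derivative
     (LBINT x. cos (y * x) * exp (- x\<^sup>2 / 2))) (at y)"
  unfolding DERIV_def tendsto_at_iff_sequentially
proof (intro allI impI)
  fix X :: "nat \<Rightarrow> real"
  assume X: "\<forall>i. X i \<in> UNIV - {0}" "X \<longlonglongrightarrow> 0"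
  let ?I = "\<lambda>y. LBINT x. sin (y * x) / x * exp (- x\<^sup>2 / 2)"
  have int: "integrable lborel (\<lambda>x. sin (y * x) / x * exp (- x\<^sup>2 / 2))" for y :: real
    using sinc_gauss_integrable[of 1 y] by simp
  have "(\<lambda>i. LBINT x. (sin ((y + X i) * x) - sin (y * x)) / (x * X i) * exp (- x\<^sup>2 / 2)) \<longlonglongrightarrow>
      (LBINT x. cos (y * x) * exp (- x\<^sup>2 / 2))"
  proof (rule integral_dominated_convergence[where w="\<lambda>x::real. exp (- (1/2) * x\<^sup>2)"])
    show "(\<lambda>x. (sin ((y + X i) * x) - sin (y * x)) / (x * X i) * exp (- x\<^sup>2 / 2)) \<in> borel_measurable lborel" for i
      by measurable
    show "(\<lambda>x. cos (y * x) * exp (- x\<^sup>2 / 2)) \<in> borel_measurable lborel"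
      by measurable
    show "integrable lborel (\<lambda>x::real. exp (- (1/2) * x\<^sup>2))"
      using integrable_power_exp_square[of "1/2" 0] by simp
    show "AE x in lborel. norm ((sin ((y + X i) * x) - sin (y * x)) / (x * X i) * exp (- x\<^sup>2 / 2)) \<le> exp (- (1/2) * x\<^sup>2)" for i
    proof (rule AE_I2)
      fix x :: real
      have "\<bar>sin ((y + X i) * x) - sin (y * x)\<bar> \<le> \<bar>x * X i\<bar>"
      proof -
        have "sin ((y + X i) * x) - sin (y * x) = 2 * sin (X i * x / 2) * cos (y * x + X i * x / 2)"
          by (simp add: sin_diff_sin field_simps)
        also have "\<bar>\<dots>\<bar> \<le> 2 * \<bar>X i * x / 2\<bar> * 1"
          unfolding abs_mult[of _ "cos _"] abs_mult[of 2]
          by (intro mult_mono) (use abs_sin_x_le_abs_x[of "X i * x / 2"] in auto)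
        finally show ?thesis by (simp add: mult.commute)
      qed
      then have "\<bar>(sin ((y + X i) * x) - sin (y * x)) / (x * X i)\<bar> \<le> 1"
        by (cases "x * X i = 0") (auto simp: abs_divide divide_le_eq)
      then show "norm ((sin ((y + X i) * x) - sin (y * x)) / (x * X i) * exp (- x\<^sup>2 / 2)) \<le> exp (- (1/2) * x\<^sup>2)"
        using mult_right_mono[of "\<bar>(sin ((y + X i) * x) - sin (y * x)) / (x * X i)\<bar>" 1 "exp (- x\<^sup>2 / 2)"]
        by (simp add: abs_mult)
    qed
    show "AE x in lborel. (\<lambda>i. (sin ((y + X i) * x) - sin (y * x)) / (x * X i) * exp (- x\<^sup>2 / 2)) \<longlonglongrightarrow> cos (y * x) * exp (- x\<^sup>2 / 2)"
      using AE_lborel_singleton[of 0]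
    proof eventually_elim
      fix x :: real assume x: "x \<noteq> 0"
      have "((\<lambda>y. sin (y * x)) has_real_derivative cos (y * x) * x) (at y)"
        by (auto intro!: derivative_eq_intros)
      then have "((\<lambda>h. (sin ((y + h) * x) - sin (y * x)) / h) \<longlongrightarrow> cos (y * x) * x) (at 0)"
        by (simp add: DERIV_def)
      then have "(\<lambda>i. (sin ((y + X i) * x) - sin (y * x)) / X i) \<longlonglongrightarrow> cos (y * x) * x"
        using X unfolding tendsto_at_iff_sequentially by (auto simp: o_def)
      from tendsto_mult[OF tendsto_divide[OF this tendsto_const[of x] x] tendsto_const[of "exp (- x\<^sup>2 / 2)"]]
      show "(\<lambda>i. (sin ((y + X i) * x) - sin (y * x)) / (x * X i) * exp (- x\<^sup>2 / 2)) \<longlonglongrightarrow> cos (y * x) * exp (- x\<^sup>2 / 2)"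
        using x by (simp add: mult.commute)
    qed
  qed
  moreover have "(?I (y + X i) - ?I y) / X i =
      (LBINT x. (sin ((y + X i) * x) - sin (y * x)) / (x * X i) * exp (- x\<^sup>2 / 2))" for i
  proof -
    have "(?I (y + X i) - ?I y) / X i = (LBINT x. (sin ((y + X i) * x) / x * exp (- x\<^sup>2 / 2) - sin (y * x) / x * exp (- x\<^sup>2 / 2)) / X i)"
      using int by simp
    also have "\<dots> = (LBINT x. (sin ((y + X i) * x) - sin (y * x)) / (x * X i) * exp (- x\<^sup>2 / 2))"
      by (rule Bochner_Integration.integral_cong) (auto simp: diff_divide_distrib left_diff_distrib)
    finally show ?thesis .
  qed
  ultimately show "((\<lambda>h. (?I (y + h) - ?I y) / h) \<circ> X) \<longlonglongrightarrow> (LBINT x. cos (y * x) * exp (- x\<^sup>2 / 2))"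
    unfolding o_def by (simp only:)
qed

text \<open>The left side vanishes at \<open>y = 0\<close>, as does the right side because
  \<open>Phi 0 = 1 / 2\<close>, and by \<open>integral_cos_gauss\<close> both have the same
  derivative.\<close>

lemma integral_sinc_gauss:
  "(LBINT x. sin (y * x) / x * exp (- x\<^sup>2 / 2)) = 2 * pi * (Phi y - 1 / 2)"
proof -
  let ?I = "\<lambda>y. LBINT x. sin (y * x) / x * exp (- x\<^sup>2 / 2)"
  have "((\<lambda>y. ?I y - 2 * pi * Phi y) has_real_derivative 0) (at y)" for y
  proof -
    have "((\<lambda>y. ?I y - 2 * pi * Phi y) has_real_derivative
        sqrt (2 * pi) * exp (- y\<^sup>2 / 2) - 2 * pi * \<phi> y) (at y)"
      by (rule DERIV_diff[OF DERIV_sinc_gauss[of y, unfolded integral_cos_gauss] DERIV_cmult[OF DERIV_Phi]])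
    moreover have "2 * pi * \<phi> y = 2 * pi / sqrt (2 * pi) * exp (- y\<^sup>2 / 2)"
      unfolding std_normal_density_def by (simp only: times_divide_eq_left times_divide_eq_right mult_1_right mult_1_left)
    then have "sqrt (2 * pi) * exp (- y\<^sup>2 / 2) - 2 * pi * \<phi> y = 0"
      using real_div_sqrt[of "2 * pi"] by simp
    ultimately show ?thesis by simp
  qed
  then have "?I y - 2 * pi * Phi y = ?I 0 - 2 * pi * Phi 0"
    using DERIV_isconst_all by blast
  then show ?thesis by (simp add: Phi_0 algebra_simps)
qed

text \<open>Rescale \<open>x\<close> by \<open>1 / sqrt v\<close> and halve by evenness. The
  half-line form is the Gaussian counterpart of the inversion formula for \<open>win\<close>, so
  that the two integrands can be subtracted pointwise.\<close>

lemma Phi_fourier: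
  fixes y v :: real
  assumes v: "v > 0"
  shows "Phi (y / sqrt v) = 1 / 2 + (1 / pi) * (LBINT x. indicator {0<..} x * (sin (y * x) / x * exp (- v * x\<^sup>2 / 2)))"
proof -
  have "(LBINT x. sin (y * x) / x * exp (- v * x\<^sup>2 / 2)) = (LBINT x. sin (y / sqrt v * x) / x * exp (- x\<^sup>2 / 2))"
  proof -
    have "(LBINT x. sin (y * x) / x * exp (- v * x\<^sup>2 / 2)) =
        \<bar>1 / sqrt v\<bar> *\<^sub>R (LBINT x. sin (y * (0 + 1 / sqrt v * x)) / (0 + 1 / sqrt v * x) * exp (- v * (0 + 1 / sqrt v * x)\<^sup>2 / 2))"
      by (rule lborel_integral_real_affine) (use v in simp)
    also have "\<dots> = (LBINT x. \<bar>1 / sqrt v\<bar> *\<^sub>R (sin (y * (0 + 1 / sqrt v * x)) / (0 + 1 / sqrt v * x) * exp (- v * (0 + 1 / sqrt v * x)\<^sup>2 / 2)))"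
      by (rule integral_scaleR_right[symmetric])
    also have "\<dots> = (LBINT x. sin (y / sqrt v * x) / x * exp (- x\<^sup>2 / 2))"
      using v by (intro Bochner_Integration.integral_cong refl) (simp add: power_divide power_mult_distrib)
    finally show ?thesis .
  qed
  also have "\<dots> = 2 * pi * (Phi (y / sqrt v) - 1 / 2)" by (rule integral_sinc_gauss)
  finally show ?thesis
    using integral_even_half[OF sinc_gauss_integrable[OF v, of y]] by simp
qed

section \<open>Fourier inversion for the conditional winning probability\<close>

text \<open>The interval is open at \<open>a\<close> because the kernels below divide by
  \<open>sin \<theta>\<close>, which vanishes at 0; the closed and half-open versions differ by a
  null set.\<close>

lemma has_bochner_integral_FTC_Ioc:
  fixes F :: "real \<Rightarrow> real"
  assumes "a \<le> b" and F: "\<And>x. (F has_real_derivative f x) (at x)" and f: "continuous_on {a..b} f"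
  shows "has_bochner_integral lborel (\<lambda>x. indicator {a<..b} x * f x) (F b - F a)"
proof -
  have "has_bochner_integral lborel (\<lambda>x. indicator {a..b} x *\<^sub>R f x) (F b - F a)"
    using assms has_field_derivative_at_within[OF F]
    by (intro has_bochner_integral_FTC_Icc) (auto simp: has_real_derivative_iff_has_vector_derivative)
  moreover have [measurable]: "(\<lambda>x. indicator {a..b} x *\<^sub>R f x) \<in> borel_measurable borel"
    using calculation by (auto simp: has_bochner_integral_iff dest: borel_measurable_integrable)
  have "(\<lambda>x. indicator {a<..b} x * (indicator {a..b} x *\<^sub>R f x)) \<in> borel_measurable borel"
    by measurable
  then have "(\<lambda>x. indicator {a<..b} x * f x) \<in> borel_measurable borel"
    by (rule measurable_cong[THEN iffD1, rotated]) (auto simp: indicator_def)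
  ultimately show ?thesis
    using AE_lborel_singleton[of a]
    by (subst has_bochner_integral_cong_AE[where g="\<lambda>x. indicator {a..b} x *\<^sub>R f x"])
       (auto simp: indicator_def elim!: eventually_mono)
qed

text \<open>Passing from \<open>j\<close> to \<open>j + 1\<close> adds
  \<open>2 * cos ((2 * j + 2) * \<theta>)\<close> to the Dirichlet kernel, and this cosine
  integrates to 0 over a quarter period \<open>pi / 2\<close>, since its antiderivative vanishes at
  both ends. The value is thus that of the constant kernel 1.\<close>

lemma odd_sgn_integral_nat:
  "has_bochner_integral lborel (\<lambda>\<theta>. indicator {0<..pi/2} \<theta> * (sin ((2 * real j + 1) * \<theta>) / sin \<theta>)) (pi / 2)"
proof (induction j)
  case 0
  have "has_bochner_integral lborel (\<lambda>\<theta>. indicator {0<..pi/2} \<theta> * 1) (pi / 2 - 0)"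
    by (rule has_bochner_integral_FTC_Ioc) (auto intro!: derivative_eq_intros)
  moreover have "(\<lambda>\<theta>. indicator {0<..pi/2} \<theta> * (sin ((2 * real 0 + 1) * \<theta>) / sin \<theta>)) = (\<lambda>\<theta>. indicator {0<..pi/2} \<theta> * 1)"
  proof
    fix \<theta> :: real
    show "indicator {0<..pi/2} \<theta> * (sin ((2 * real 0 + 1) * \<theta>) / sin \<theta>) = indicator {0<..pi/2} \<theta> * 1"
      using sin_gt_zero[of \<theta>] by (auto simp: indicator_def)
  qed
  ultimately show ?case by simp
next
  case (Suc j)
  let ?F = "\<lambda>\<theta>. sin ((2 * real j + 2) * \<theta>) * (2 / (2 * real j + 2))"
  have "has_bochner_integral lborel (\<lambda>\<theta>. indicator {0<..pi/2} \<theta> * (2 * cos ((2 * real j + 2) * \<theta>))) (?F (pi/2) - ?F 0)"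
  proof (rule has_bochner_integral_FTC_Ioc)
    fix x
    define a where "a = 2 * real j + 2"
    have "a > 0" by (simp add: a_def)
    then have "((\<lambda>\<theta>. sin (a * \<theta>) * (2 / a)) has_real_derivative 2 * cos (a * x)) (at x)"
      by (auto intro!: derivative_eq_intros)
    then show "(?F has_real_derivative 2 * cos ((2 * real j + 2) * x)) (at x)" by (simp only: a_def)
  qed (auto intro!: continuous_intros)
  moreover have "sin ((2 * real j + 2) * (pi/2)) = 0"
    using sin_npi[of "Suc j"] by (simp add: algebra_simps)
  ultimately have "has_bochner_integral lborel (\<lambda>\<theta>. indicator {0<..pi/2} \<theta> * (sin ((2 * real j + 1) * \<theta>) / sin \<theta>) +
      indicator {0<..pi/2} \<theta> * (2 * cos ((2 * real j + 2) * \<theta>))) (pi / 2 + 0)"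
    by (intro has_bochner_integral_add Suc.IH) simp
  moreover have "indicator {0<..pi/2} \<theta> * (sin ((2 * real j + 1) * \<theta>) / sin \<theta>) +
      indicator {0<..pi/2} \<theta> * (2 * cos ((2 * real j + 2) * \<theta>)) =
      indicator {0<..pi/2} \<theta> * (sin ((2 * real (Suc j) + 1) * \<theta>) / sin \<theta>)" for \<theta> :: real
  proof (cases "\<theta> \<in> {0<..pi/2}")
    case True
    then have pos: "sin \<theta> > 0" using sin_gt_zero[of \<theta>] by auto
    have e1: "(2 * real (Suc j) + 1) * \<theta> = (2 * real j + 2) * \<theta> + \<theta>"
      and e2: "(2 * real j + 1) * \<theta> = (2 * real j + 2) * \<theta> - \<theta>" by (simp_all add: algebra_simps)
    have "sin ((2 * real (Suc j) + 1) * \<theta>) = sin ((2 * real j + 1) * \<theta>) + 2 * cos ((2 * real j + 2) * \<theta>) * sin \<theta>"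
      unfolding e1 e2 sin_add sin_diff by simp
    then show ?thesis using True pos by (simp add: field_simps)
  qed simp
  ultimately show ?case by simp
qed

text \<open>The kernel is odd in \<open>k\<close>, which supplies the sign. Oddness of the integer
  is essential: for even \<open>k\<close> the value changes with the size of \<open>k\<close> (it is
  2 at \<open>k = 2\<close> and 4/3 at \<open>k = 4\<close>), and this is why the parity of
  \<open>n\<close> enters.\<close>

lemma odd_sgn_integral:
  assumes "odd (k::int)"
  shows "has_bochner_integral lborel (\<lambda>\<theta>. indicator {0<..pi/2} \<theta> * (sin (real_of_int k * \<theta>) / sin \<theta>))
           (pi / 2 * real_of_int (sgn k))"
proof -
  define j where "j = nat ((\<bar>k\<bar> - 1) div 2)"
  have k: "\<bar>k\<bar> = 2 * int j + 1" 
  proof -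
    have "(\<bar>k\<bar> - 1) div 2 \<ge> 0 \<and> \<bar>k\<bar> = 2 * ((\<bar>k\<bar> - 1) div 2) + 1" using assms by presburger
    then show ?thesis unfolding j_def by simp
  qed
  show ?thesis
  proof (cases "k > 0")
    case True
    then have "real_of_int k = 2 * real j + 1" using k by linarith
    then show ?thesis using odd_sgn_integral_nat[of j] True by simp
  next
    case False
    then have neg: "real_of_int k = - (2 * real j + 1)" "sgn k = -1" using k by (linarith, auto)
    from has_bochner_integral_minus[OF odd_sgn_integral_nat[of j]]
    show ?thesis unfolding neg by (simp only: minus_mult_left[symmetric] sin_minus minus_divide_left[symmetric] minus_mult_right[symmetric]) simp
  qed
qed

text \<open>Characteristic function of a sum of independent signs with means \<open>s v\<close>: a
  single sign contributes \<open>cos \<theta> + \<i> s sin \<theta>\<close>.\<close>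

definition cf :: "nat \<Rightarrow> (nat \<Rightarrow> real) \<Rightarrow> real \<Rightarrow> complex" where
  "cf n s \<theta> = (\<Prod>v<n. Complex (cos \<theta>) (s v * sin \<theta>))"

definition parity_shift :: "nat \<Rightarrow> real" where
  "parity_shift n = (if even n then 1 else 0)"

lemma cf_expansion:
  "cf n s \<theta> = (\<Sum>D\<in>Pow {..<n}. of_real (\<Prod>v<n. vweight s D v)
     * cis (\<theta> * (2 * real (card D) - real n)))"
proof -
  have "cf n s \<theta> = (\<Prod>v<n. of_real ((1 + s v) / 2) * cis \<theta> + of_real ((1 - s v) / 2) * cis (- \<theta>))"
    unfolding cf_def by (intro prod.cong refl) (auto simp: complex_eq_iff field_simps)
  also have "\<dots> = (\<Sum>D\<in>Pow {..<n}. (\<Prod>v\<in>D. of_real ((1 + s v) / 2) * cis \<theta>) *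
       (\<Prod>v\<in>{..<n} - D. of_real ((1 - s v) / 2) * cis (- \<theta>)))"
    by (rule prod_add) simp
  also have "\<dots> = (\<Sum>D\<in>Pow {..<n}. of_real (\<Prod>v<n. vweight s D v)
     * cis (\<theta> * (2 * real (card D) - real n)))"
  proof (rule sum.cong[OF refl])
    fix D assume "D \<in> Pow {..<n}"
    then have D: "D \<subseteq> {..<n}" "finite D" by (auto intro: finite_subset)
    have "{..<n} \<inter> {v. v \<in> D} = D" "{..<n} \<inter> - {v. v \<in> D} = {..<n} - D" using D by auto
    then have w: "(\<Prod>v<n. vweight s D v) =
       (\<Prod>v\<in>D. (1 + s v) / 2) * (\<Prod>v\<in>{..<n} - D. (1 - s v) / 2)"
      by (subst prod.If_cases) auto
    have c: "real (card ({..<n} - D)) = real n - real (card D)"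
      using D card_mono[OF _ D(1)] by (simp add: card_Diff_subset of_nat_diff)
    have "(\<Prod>v\<in>D. of_real ((1 + s v) / 2) * cis \<theta>) * (\<Prod>v\<in>{..<n} - D. of_real ((1 - s v) / 2) * cis (- \<theta>)) =
      of_real (\<Prod>v<n. vweight s D v) * (cis \<theta> ^ card D * cis (- \<theta>) ^ card ({..<n} - D))"
      unfolding w by (simp only: prod.distrib prod_constant of_real_mult of_real_prod mult_ac)
    also have "cis \<theta> ^ card D * cis (- \<theta>) ^ card ({..<n} - D) = cis (\<theta> * (2 * real (card D) - real n))"
      unfolding Complex.DeMoivre cis_mult c by (simp add: algebra_simps)
    finally show "(\<Prod>v\<in>D. of_real ((1 + s v) / 2) * cis \<theta>) * (\<Prod>v\<in>{..<n} - D. of_real ((1 - s v) / 2) * cis (- \<theta>)) =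
      of_real (\<Prod>v<n. vweight s D v) * cis (\<theta> * (2 * real (card D) - real n))" .
  qed
  finally show ?thesis .
qed

text \<open>For voter set \<open>D\<close> the integer \<open>k D\<close> is the sum of signs,
  lowered by 1 when \<open>n\<close> is even. It is always odd, and it is positive exactly when
  \<open>D\<close> is a strict majority; so the mean of \<open>sgn (k D)\<close> is
  \<open>2 * win n s - 1\<close>, and \<open>odd_sgn_integral\<close> is averaged over
  \<open>D\<close>.\<close>

lemma win_fourier:
  "win n s = 1 / 2 + 1 / pi * (\<integral>\<theta>. indicator {0<..pi/2} \<theta> *
      (Im (cis (- parity_shift n * \<theta>) * cf n s \<theta>) / sin \<theta>) \<partial>lborel)" (is ?thesis1)
  "integrable lborel (\<lambda>\<theta>. indicator {0<..pi/2} \<theta> *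
      (Im (cis (- parity_shift n * \<theta>) * cf n s \<theta>) / sin \<theta>))" (is ?thesis2)
proof -
  define w where "w D = (\<Prod>v<n. vweight s D v)" for D
  define \<epsilon> :: int where "\<epsilon> = (if even n then 1 else 0)"
  define k where "k D = 2 * int (card D) - int n - \<epsilon>" for D :: "nat set"
  have odd: "odd (k D)" for D unfolding k_def \<epsilon>_def by auto
  have pos: "sgn (k D) = (if n < 2 * card D then 1 else -1)" for D
  proof -
    have "k D > 0 \<longleftrightarrow> n < 2 * card D"
      unfolding k_def \<epsilon>_def by (cases "even n") (auto elim!: evenE)
    moreover have "k D \<noteq> 0" using odd[of D] by auto
    ultimately show ?thesis by (simp add: sgn_if)
  qed
  have tot: "(\<Sum>D\<in>Pow {..<n}. w D) = 1"
  proof -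
    have "cf n s 0 = 1" unfolding cf_def by (intro prod.neutral) (simp add: complex_eq_iff)
    then have "(\<Sum>D\<in>Pow {..<n}. complex_of_real (w D)) = 1" by (simp add: cf_expansion w_def)
    then have "complex_of_real (\<Sum>D\<in>Pow {..<n}. w D) = of_real 1" by simp
    then show ?thesis by (simp only: of_real_eq_iff)
  qed
  have im: "Im (cis (- parity_shift n * \<theta>) * cf n s \<theta>) = (\<Sum>D\<in>Pow {..<n}. w D * sin (real_of_int (k D) * \<theta>))" for \<theta>
  proof -
    have "cis (- parity_shift n * \<theta>) * cf n s \<theta> = (\<Sum>D\<in>Pow {..<n}. of_real (w D) * cis (real_of_int (k D) * \<theta>))"
      unfolding cf_expansion sum_distrib_left w_def
      by (intro sum.cong refl)
         (simp add: k_def \<epsilon>_def parity_shift_def cis_mult algebra_simps mult.left_commute[of "cis _" "of_real _"])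
    then show ?thesis by simp
  qed
  have hbi: "has_bochner_integral lborel (\<lambda>\<theta>. \<Sum>D\<in>Pow {..<n}. w D * (indicator {0<..pi/2} \<theta> * (sin (real_of_int (k D) * \<theta>) / sin \<theta>)))
      (\<Sum>D\<in>Pow {..<n}. w D * (pi / 2 * real_of_int (sgn (k D))))"
    by (intro has_bochner_integral_sum has_bochner_integral_mult_right odd_sgn_integral odd)
  have eq: "(\<lambda>\<theta>. \<Sum>D\<in>Pow {..<n}. w D * (indicator {0<..pi/2} \<theta> * (sin (real_of_int (k D) * \<theta>) / sin \<theta>))) =
     (\<lambda>\<theta>. indicator {0<..pi/2} \<theta> * (Im (cis (- parity_shift n * \<theta>) * cf n s \<theta>) / sin \<theta>))"
    unfolding im by (rule ext) (simp add: sum_divide_distrib sum_distrib_left mult_ac)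
  show ?thesis2 using hbi unfolding eq by (simp add: has_bochner_integral_iff)
  have "(\<Sum>D\<in>Pow {..<n}. w D * (pi / 2 * real_of_int (sgn (k D)))) =
      (\<Sum>D\<in>Pow {..<n}. pi * (if n < 2 * card D then w D else 0) - pi / 2 * w D)"
    by (intro sum.cong refl) (auto simp: pos)
  also have "\<dots> = pi * (\<Sum>D\<in>Pow {..<n}. if n < 2 * card D then w D else 0) - pi / 2 * (\<Sum>D\<in>Pow {..<n}. w D)"
    by (simp only: sum_subtractf sum_distrib_left)
  also have "(\<Sum>D\<in>Pow {..<n}. if n < 2 * card D then w D else 0) = win n s"
    unfolding win_def w_def by (rule sum.inter_filter[symmetric]) simp
  finally show ?thesis1
    using hbi unfolding eq has_bochner_integral_iff tot by (simp add: field_simps)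
qed

lemma win_fourier_scaled:
  fixes s :: "nat \<Rightarrow> real"
  assumes n: "n > 0"
  defines "f \<equiv> \<lambda>x. indicator {0<..sqrt n * pi / 2} x *
      (Im (cis (- parity_shift n * (x / sqrt n)) * cf n s (x / sqrt n)) / (sqrt n * sin (x / sqrt n)))"
  shows "win n s = 1 / 2 + 1 / pi * (LBINT x. f x)" "integrable lborel f"
proof -
  define g where "g = (\<lambda>\<theta>. indicator {0<..pi/2} \<theta> * (Im (cis (- parity_shift n * \<theta>) * cf n s \<theta>) / sin \<theta>))"
  have f: "f x = 1 / sqrt n * g (0 + (1 / sqrt n) * x)" for x
    using n unfolding f_def g_def by (auto simp: indicator_def field_simps)
  have g: "integrable lborel g" "win n s = 1 / 2 + 1 / pi * (LBINT \<theta>. g \<theta>)"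
    using win_fourier[of n s] by (simp_all add: g_def)
  show "integrable lborel f"
    unfolding f using g n by (intro integrable_mult_right lborel_integrable_real_affine) auto
  have "(LBINT \<theta>. g \<theta>) = \<bar>1 / sqrt n\<bar> *\<^sub>R (LBINT x. g (0 + (1 / sqrt n) * x))"
    by (rule lborel_integral_real_affine) (use n in simp)
  also have "\<dots> = (LBINT x. f x)" unfolding f by simp
  finally show "win n s = 1 / 2 + 1 / pi * (LBINT x. f x)" using g by simp
qed

section \<open>Gaussian approximation of the conditional characteristic function\<close>

lemma norm_exp_minus_one_le:
  fixes z :: complex
  shows "norm (exp z - 1) \<le> norm z * exp (norm z)"
proof -
  have "norm (exp z - (\<Sum>i\<le>0. exp 0 * (z - 0) ^ i / fact i)) \<le> exp (norm z) * norm (z - 0) ^ Suc 0 / fact 0"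
  proof (rule complex_Taylor[where S="closed_segment 0 z" and f="\<lambda>_. exp"])
    show "norm (exp x) \<le> exp (norm z)" if "x \<in> closed_segment 0 z" for x
    proof -
      have "norm x \<le> norm z" using segment_bound1[OF that] by simp
      then show ?thesis using norm_exp[of x] order_trans by (metis exp_le_cancel_iff)
    qed
  qed (auto intro!: derivative_eq_intros)
  then show ?thesis by (simp add: mult.commute)
qed

section \<open>Elementary bounds for sine and cosine\<close>

lemma one_minus_cos_le: "1 - cos x \<le> x\<^sup>2 / 2" for x :: real
proof -
  have "1 - cos x = 2 * (sin (x / 2))\<^sup>2" using cos_double_sin[of "x / 2"] by simp
  moreover have "(sin (x / 2))\<^sup>2 \<le> (x / 2)\<^sup>2"
    using abs_sin_x_le_abs_x[of "x / 2"] by (simp only: abs_le_square_iff)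
  ultimately show ?thesis by (simp add: power2_eq_square field_simps)
qed

lemma sin_ge_cubic:
  fixes x :: real
  assumes "0 \<le> x"
  shows "x - x ^ 3 / 6 \<le> sin x"
proof -
  let ?g = "\<lambda>x::real. sin x - x + x ^ 3 / 6"
  have "?g 0 \<le> ?g x"
  proof (rule DERIV_nonneg_imp_nondecreasing[OF assms])
    fix t :: real
    have "DERIV ?g t :> cos t - 1 + t\<^sup>2 / 2" by (auto intro!: derivative_eq_intros)
    moreover have "0 \<le> cos t - 1 + t\<^sup>2 / 2" using one_minus_cos_le[of t] by simp
    ultimately show "\<exists>y. DERIV ?g t :> y \<and> 0 \<le> y" by blast
  qed
  then show ?thesis by simp
qed

text \<open>Both follow from the cubic lower bound. The second one compares the lattice kernel
  \<open>1 / sin\<close> with the continuous kernel \<open>1 / x\<close> of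
  \<open>Phi_fourier\<close>.\<close>

lemma sin_bounds_half_pi:
  fixes x :: real
  assumes "0 < x" "x \<le> pi / 2"
  shows "x / 2 \<le> sin x" "\<bar>1 / sin x - 1 / x\<bar> \<le> x"
proof -
  \<comment> \<open>A rational upper bound for \<open>pi / 2\<close> whose square, 64/25, is still
    below 3.\<close>
  have "x \<le> 8 / 5" using assms pi_approx by simp
  then have "x * x \<le> 8 / 5 * (8 / 5)" using assms by (intro mult_mono) auto
  then have "x * (x * x) \<le> x * 3" using assms by (intro mult_left_mono) auto
  then have x3: "x ^ 3 \<le> 3 * x" by (simp add: power3_eq_cube mult_ac)
  have s: "x - x ^ 3 / 6 \<le> sin x" using assms by (intro sin_ge_cubic) simp
  then show half: "x / 2 \<le> sin x" using x3 by simp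
  have pos: "sin x > 0" using half assms by simp
  have le: "sin x \<le> x" using assms sin_x_le_x by simp
  have "1 / sin x - 1 / x = (x - sin x) / (x * sin x)" using pos assms by (simp add: field_simps)
  moreover have "(x - sin x) / (x * sin x) \<le> (x ^ 3 / 6) / (x * (x / 2))"
    using pos assms half le s by (intro frac_le mult_left_mono) auto
  moreover have "(x ^ 3 / 6) / (x * (x / 2)) = x / 3" using assms by (simp add: power3_eq_cube field_simps)
  moreover have "(x - sin x) / (x * sin x) \<ge> 0" using pos le assms by simp
  ultimately show "\<bar>1 / sin x - 1 / x\<bar> \<le> x" using assms by simp
qed

text \<open>Because \<open>F'' = - F\<close>, the logarithmic derivative \<open>y\<close> of
  \<open>F\<close> satisfies the Riccati equation \<open>y' = - 1 - y^2\<close>. All further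
  derivatives of \<open>Ln F\<close> are therefore polynomials in \<open>y\<close>, and a bound on
  \<open>y\<close> alone controls the Taylor remainder. The value \<open>y 0 = \<i> * s\<close>
  produces the coefficients.\<close>

lemma bernoulli_cf_log_expansion:
  fixes s \<theta> :: real
  assumes s: "\<bar>s\<bar> \<le> 1" and \<theta>: "0 \<le> \<theta>" "\<theta> \<le> 1/8"
  obtains R where "norm R \<le> 4 * \<theta> ^ 4"
    "Complex (cos \<theta>) (s * sin \<theta>) =
      exp (\<i> * of_real (s * \<theta>) - of_real ((1 - s\<^sup>2) * \<theta>\<^sup>2 / 2) + (\<i> * of_real (s * (1 - s\<^sup>2) * \<theta> ^ 3 / 3) + R))"
proof -
  define F where "F z = cos z + \<i> * of_real s * sin z" for z :: complex
  define y where "y z = (- sin z + \<i> * of_real s * cos z) / F z" for z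
  define f :: "nat \<Rightarrow> complex \<Rightarrow> complex" where
    "f i z = (if i = 0 then Ln (F z) else if i = 1 then y z else if i = 2 then - 1 - (y z)\<^sup>2
       else if i = 3 then 2 * y z + 2 * y z ^ 3 else (2 + 6 * (y z)\<^sup>2) * (- 1 - (y z)\<^sup>2))" for i z
  define S where "S = complex_of_real ` {0..1/8}"
  have F_real: "F (of_real t) = Complex (cos t) (s * sin t)" for t
    by (simp add: F_def complex_eq_iff cos_of_real sin_of_real)
  \<comment> \<open>On the segment \<open>cos t\<close> is at least 1 - 1/128, which keeps
    \<open>F\<close> off the branch cut of \<open>Ln\<close> and bounds the denominator of
    \<open>y\<close>.\<close>
  have ReF: "7/8 \<le> Re (F z)" if "z \<in> S" for z
  proof -
    obtain t where t: "z = of_real t" "0 \<le> t" "t \<le> 1/8" using \<open>z \<in> S\<close> by (auto simp: S_def)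
    have "t * t \<le> 1/8 * (1/8)" using t by (intro mult_mono) auto
    then show ?thesis using one_minus_cos_le[of t] by (simp add: t F_real power2_eq_square)
  qed
  have Fnz: "F z \<noteq> 0" "F z \<notin> \<real>\<^sub>\<le>\<^sub>0" if "z \<in> S" for z
    using ReF[OF that] by (auto simp: complex_nonpos_Reals_iff)
  have dF: "(F has_field_derivative (- sin z + \<i> * of_real s * cos z)) (at z within S)" for z
    unfolding F_def by (auto intro!: derivative_eq_intros)
  have dy: "(y has_field_derivative (- 1 - (y z)\<^sup>2)) (at z within S)" if "z \<in> S" for z
  proof -
    have "((\<lambda>z. - sin z + \<i> * of_real s * cos z) has_field_derivative (- F z)) (at z within S)"
      unfolding F_def by (auto intro!: derivative_eq_intros)
    from DERIV_divide[OF this dF Fnz(1)[OF that]]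
    have "((\<lambda>z. (- sin z + \<i> * of_real s * cos z) / F z) has_field_derivative
       (- F z * F z - (- sin z + \<i> * of_real s * cos z) * (- sin z + \<i> * of_real s * cos z)) / (F z * F z)) (at z within S)" .
    moreover have "(- F z * F z - (- sin z + \<i> * of_real s * cos z) * (- sin z + \<i> * of_real s * cos z)) / (F z * F z) = - 1 - (y z)\<^sup>2"
    proof -
      have "(- c * c - A * A) / (c * c) = - 1 - (A / c)\<^sup>2" if "c \<noteq> 0" for A c :: complex
        using that by (simp add: field_simps power2_eq_square)
      then show ?thesis using Fnz(1)[OF that] unfolding y_def by blast
    qed
    ultimately show ?thesis by (simp only: y_def[abs_def])
  qed
  have df: "(f i has_field_derivative f (Suc i) z) (at z within S)" if "z \<in> S" "i \<le> 3" for i z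
  proof -
    consider "i = 0" | "i = 1" | "i = 2" | "i = 3" using \<open>i \<le> 3\<close> by linarith
    then show ?thesis
    proof cases
      case 1
      have "((\<lambda>z. Ln (F z)) has_field_derivative y z) (at z within S)"
        using Fnz[OF that(1)] by (auto intro!: derivative_eq_intros dF simp: y_def divide_inverse)
      then show ?thesis by (simp add: f_def[abs_def] 1)
    next
      case 2
      then show ?thesis using dy[OF that(1)] by (simp add: f_def[abs_def])
    next
      case 3
      have "((\<lambda>z. - 1 - (y z)\<^sup>2) has_field_derivative (2 * y z + 2 * y z ^ 3)) (at z within S)"
        by (rule derivative_eq_intros dy[OF that(1)] refl)+
           (simp add: power2_eq_square power3_eq_cube algebra_simps)
      then show ?thesis by (simp add: f_def[abs_def] 3)
    next
      case 4
      have "((\<lambda>z. 2 * y z + 2 * y z ^ 3) has_field_derivative (2 + 6 * (y z)\<^sup>2) * (- 1 - (y z)\<^sup>2)) (at z within S)"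
        by (rule derivative_eq_intros dy[OF that(1)] refl)+
           (simp add: power2_eq_square power3_eq_cube algebra_simps)
      then show ?thesis by (simp add: f_def[abs_def] 4)
    qed
  qed
  \<comment> \<open>From \<open>norm (y z) \<le> 8/7\<close> the fourth derivative is below 22.7.
    Since the Taylor bound divides by \<open>fact 3\<close>, the rounded value 24 gives the factor 4
    in front of \<open>\<theta> ^ 4\<close>.\<close>
  have bound: "norm (f (Suc 3) z) \<le> 24" if "z \<in> S" for z
  proof -
    obtain t where t: "z = of_real t" using \<open>z \<in> S\<close> by (auto simp: S_def)
    have "norm (- sin z + \<i> * of_real s * cos z) \<le> 1"
    proof -
      have "- sin z + \<i> * of_real s * cos z = Complex (- sin t) (s * cos t)"
        by (simp add: t complex_eq_iff cos_of_real sin_of_real)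
      moreover have "(s * cos t)\<^sup>2 \<le> (cos t)\<^sup>2"
      proof -
        have "s\<^sup>2 \<le> 1" using s by (simp add: abs_square_le_1)
        then have "s\<^sup>2 * (cos t)\<^sup>2 \<le> 1 * (cos t)\<^sup>2" by (rule mult_right_mono) simp
        then show ?thesis by (simp add: power_mult_distrib)
      qed
      then have "(sin t)\<^sup>2 + (s * cos t)\<^sup>2 \<le> 1" using sin_cos_squared_add[of t] by linarith
      ultimately show ?thesis by (simp add: cmod_def)
    qed
    moreover have "7/8 \<le> norm (F z)" using ReF[OF that] complex_Re_le_cmod[of "F z"] by linarith
    ultimately have "norm (y z) \<le> 1 / (7/8)"
      unfolding y_def norm_divide by (intro frac_le) auto
    then have "(norm (y z))\<^sup>2 \<le> (8/7)\<^sup>2" by (intro power_mono) auto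
    then have y2: "norm ((y z)\<^sup>2) \<le> 64/49" unfolding norm_power by (simp add: power2_eq_square)
    have "norm (2 + 6 * (y z)\<^sup>2) \<le> 2 + 6 * (64/49)"
      using norm_triangle_ineq[of 2 "6 * (y z)\<^sup>2"] y2 by (simp add: norm_mult)
    moreover have "norm (- 1 - (y z)\<^sup>2) \<le> 1 + 64/49"
      using norm_triangle_ineq4[of "- 1" "(y z)\<^sup>2"] y2 by simp
    ultimately have "norm ((2 + 6 * (y z)\<^sup>2) * (- 1 - (y z)\<^sup>2)) \<le> (2 + 6 * (64/49)) * (1 + 64/49)"
      unfolding norm_mult by (intro mult_mono) auto
    then show ?thesis by (simp add: f_def)
  qed
  have conv: "convex S"
    unfolding S_def by (intro convex_linear_image convex_real_interval) (simp add: linear_of_real)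
  have mem: "0 \<in> S" "of_real \<theta> \<in> S" using \<theta> by (auto simp: S_def image_iff intro: bexI[of _ 0])
  have T: "norm (f 0 (of_real \<theta>) - (\<Sum>i\<le>3. f i 0 * (of_real \<theta> - 0) ^ i / fact i)) \<le> 24 * norm (complex_of_real \<theta> - 0) ^ Suc 3 / fact 3"
    by (rule complex_Taylor[OF conv df bound mem]) auto
  have y0: "y 0 = \<i> * of_real s" "F 0 = 1" by (simp_all add: y_def F_def)
  have sum: "(\<Sum>i\<le>3. f i 0 * (of_real \<theta> - 0) ^ i / fact i) =
     \<i> * of_real (s * \<theta>) - of_real ((1 - s\<^sup>2) * \<theta>\<^sup>2 / 2) + \<i> * of_real (s * (1 - s\<^sup>2) * \<theta> ^ 3 / 3)"
    by (simp add: f_def y0 numeral_3_eq_3 fact_numeral power2_eq_square power3_eq_cube complex_eq_iff field_simps)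
  define R where "R = Ln (F (of_real \<theta>)) - (\<i> * of_real (s * \<theta>) - of_real ((1 - s\<^sup>2) * \<theta>\<^sup>2 / 2) + \<i> * of_real (s * (1 - s\<^sup>2) * \<theta> ^ 3 / 3))"
  have "norm R \<le> 4 * \<theta> ^ 4"
    using T \<theta> unfolding sum R_def by (simp add: f_def fact_numeral numeral_eq_Suc)
  moreover have "Complex (cos \<theta>) (s * sin \<theta>) =
      exp (\<i> * of_real (s * \<theta>) - of_real ((1 - s\<^sup>2) * \<theta>\<^sup>2 / 2) + (\<i> * of_real (s * (1 - s\<^sup>2) * \<theta> ^ 3 / 3) + R))"
    using exp_Ln[OF Fnz(1)[OF mem(2)]] unfolding R_def F_real[symmetric] by simp
  ultimately show thesis by (rule that)
qed

abbreviation condvar :: "nat \<Rightarrow> (nat \<Rightarrow> real) \<Rightarrow> real" where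
  "condvar n s \<equiv> \<Sum>v<n. 1 - (s v)\<^sup>2"

(* Up to the factor -2 this is the conditional third cumulant. *)
abbreviation condskew :: "nat \<Rightarrow> (nat \<Rightarrow> real) \<Rightarrow> real" where
  "condskew n s \<equiv> \<Sum>v<n. s v * (1 - (s v)\<^sup>2)"

lemma abs_s_one_minus_sq_le:
  fixes s :: real
  assumes "\<bar>s\<bar> \<le> 1"
  shows "\<bar>s * (1 - s\<^sup>2)\<bar> \<le> 1 / 2"
proof -
  have s2: "s\<^sup>2 \<le> 1" using assms by (simp add: abs_square_le_1)
  have "(s * (1 - s\<^sup>2))\<^sup>2 = s\<^sup>2 * (1 - s\<^sup>2) * (1 - s\<^sup>2)" by (simp add: power2_eq_square)
  also have "\<dots> \<le> s\<^sup>2 * (1 - s\<^sup>2) * 1" using s2 by (intro mult_left_mono) auto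
  also have "\<dots> \<le> (1/2)\<^sup>2"
    using zero_le_power2[of "s\<^sup>2 - 1/2"] by (simp add: power2_eq_square algebra_simps)
  finally show ?thesis using power2_le_imp_le[of "\<bar>s * (1 - s\<^sup>2)\<bar>" "1/2"] by simp
qed

text \<open>Multiplying the single expansions gives \<open>cf = G * exp Z\<close> with
  \<open>G\<close> Gaussian and \<open>Z\<close> of third order. The factor
  \<open>exp (norm Z)\<close> could spoil the decay, but \<open>norm Z\<close> is at most
  \<open>n * \<theta>^2 / 12\<close> while \<open>G\<close> decays at least like
  \<open>exp (- n * \<theta>^2 / 6)\<close>, so half of the exponent remains.\<close>

lemma cf_gauss_approx:
  fixes s :: "nat \<Rightarrow> real"
  assumes s: "\<And>v. v < n \<Longrightarrow> \<bar>s v\<bar> \<le> 1" and \<theta>: "0 \<le> \<theta>" "\<theta> \<le> 1/8"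
    and V: "real n / 3 \<le> condvar n s"
  shows "norm (cf n s \<theta> - exp (\<i> * of_real ((\<Sum>v<n. s v) * \<theta>) - of_real (condvar n s * \<theta>\<^sup>2 / 2)))
    \<le> exp (- (real n * \<theta>\<^sup>2 / 12)) * (\<bar>condskew n s\<bar> * \<theta> ^ 3 / 3 + 4 * real n * \<theta> ^ 4)"
proof -
  define K where "K = condskew n s"
  define B where "B = (\<Sum>v<n. s v)"
  define W where "W = condvar n s"
  have "\<exists>R. norm R \<le> 4 * \<theta> ^ 4 \<and> Complex (cos \<theta>) (s v * sin \<theta>) =
      exp (\<i> * of_real (s v * \<theta>) - of_real ((1 - (s v)\<^sup>2) * \<theta>\<^sup>2 / 2) + (\<i> * of_real (s v * (1 - (s v)\<^sup>2) * \<theta> ^ 3 / 3) + R))"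
    if "v < n" for v
    using bernoulli_cf_log_expansion[OF s[OF that] \<theta>] by blast
  then obtain R where R: "\<And>v. v < n \<Longrightarrow> norm (R v) \<le> 4 * \<theta> ^ 4"
    "\<And>v. v < n \<Longrightarrow> Complex (cos \<theta>) (s v * sin \<theta>) =
      exp (\<i> * of_real (s v * \<theta>) - of_real ((1 - (s v)\<^sup>2) * \<theta>\<^sup>2 / 2) + (\<i> * of_real (s v * (1 - (s v)\<^sup>2) * \<theta> ^ 3 / 3) + R v))"
    by metis
  define Z where "Z = \<i> * of_real (K * \<theta> ^ 3 / 3) + (\<Sum>v<n. R v)"
  define G where "G = exp (\<i> * of_real (B * \<theta>) - of_real (W * \<theta>\<^sup>2 / 2))"
  have "cf n s \<theta> = (\<Prod>v<n. exp (\<i> * of_real (s v * \<theta>) - of_real ((1 - (s v)\<^sup>2) * \<theta>\<^sup>2 / 2) + (\<i> * of_real (s v * (1 - (s v)\<^sup>2) * \<theta> ^ 3 / 3) + R v)))"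
    unfolding cf_def using R(2) by (intro prod.cong) auto
  also have "\<dots> = exp (\<Sum>v<n. \<i> * of_real (s v * \<theta>) - of_real ((1 - (s v)\<^sup>2) * \<theta>\<^sup>2 / 2) + (\<i> * of_real (s v * (1 - (s v)\<^sup>2) * \<theta> ^ 3 / 3) + R v))"
    by (rule exp_sum[symmetric]) simp
  also have "(\<Sum>v<n. \<i> * of_real (s v * \<theta>) - of_real ((1 - (s v)\<^sup>2) * \<theta>\<^sup>2 / 2) + (\<i> * of_real (s v * (1 - (s v)\<^sup>2) * \<theta> ^ 3 / 3) + R v)) =
      (\<i> * of_real (B * \<theta>) - of_real (W * \<theta>\<^sup>2 / 2)) + Z"
  proof -
    have "K * \<theta> ^ 3 / 3 = (\<Sum>v<n. s v * (1 - (s v)\<^sup>2) * \<theta> ^ 3 / 3)" "B * \<theta> = (\<Sum>v<n. s v * \<theta>)"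
      "W * \<theta>\<^sup>2 / 2 = (\<Sum>v<n. (1 - (s v)\<^sup>2) * \<theta>\<^sup>2 / 2)"
      unfolding K_def B_def W_def by (simp_all only: sum_distrib_right sum_divide_distrib)
    then show ?thesis
      unfolding Z_def by (simp only: sum.distrib sum_subtractf of_real_sum sum_distrib_left)
  qed
  finally have cf: "cf n s \<theta> = G * exp Z" unfolding G_def exp_add .
  have normG: "norm G = exp (- (W * \<theta>\<^sup>2 / 2))"
    unfolding G_def norm_exp_eq_Re by simp
  have sumR: "norm (\<Sum>v<n. R v) \<le> 4 * real n * \<theta> ^ 4"
    using sum_norm_bound[of "{..<n}" R "4 * \<theta> ^ 4"] R(1) by simp
  have \<theta>3: "0 \<le> \<theta> ^ 3" using \<theta> by simp
  have normZ: "norm Z \<le> \<bar>K\<bar> * \<theta> ^ 3 / 3 + 4 * real n * \<theta> ^ 4"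
  proof -
    have "norm (\<i> * of_real (K * \<theta> ^ 3 / 3) :: complex) = \<bar>K\<bar> * \<theta> ^ 3 / 3"
      using \<theta>3 by (simp only: norm_mult norm_ii norm_of_real) (simp add: abs_mult)
    then show ?thesis unfolding Z_def using norm_triangle_ineq[of "\<i> * of_real (K * \<theta> ^ 3 / 3)" "\<Sum>v<n. R v"] sumR by linarith
  qed
  have "\<bar>K\<bar> \<le> (\<Sum>v<n. \<bar>s v * (1 - (s v)\<^sup>2)\<bar>)" unfolding K_def by (rule sum_abs)
  also have "\<dots> \<le> (\<Sum>v<n. 1 / 2)" using s by (intro sum_mono abs_s_one_minus_sq_le) auto
  finally have K: "\<bar>K\<bar> \<le> real n / 2" by simp
  \<comment> \<open>The range \<open>\<theta> \<le> 1/8\<close> is fixed by this step: with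
    \<open>\<bar>K\<bar> \<le> n / 2\<close> the two terms are at most 1/48 and 1/16 of
    \<open>n * \<theta>^2\<close>, which add up to exactly 1/12.\<close>
  have "\<bar>K\<bar> * \<theta> ^ 3 / 3 + 4 * real n * \<theta> ^ 4 \<le> real n * \<theta>\<^sup>2 / 12"
  proof -
    have "\<bar>K\<bar> * \<theta> ^ 3 \<le> real n / 2 * \<theta> ^ 3" using K \<theta>3 by (rule mult_right_mono)
    moreover have "\<theta> ^ 3 \<le> \<theta>\<^sup>2 * (1/8)"
      using mult_left_mono[OF \<theta>(2), of "\<theta>\<^sup>2"] by (simp add: power3_eq_cube power2_eq_square)
    then have "real n * \<theta> ^ 3 \<le> real n * (\<theta>\<^sup>2 * (1/8))" by (rule mult_left_mono) simp
    moreover have "\<theta> ^ 4 \<le> \<theta>\<^sup>2 * (1/64)"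
    proof -
      have "\<theta>\<^sup>2 \<le> (1/8)\<^sup>2" using \<theta> by (intro power_mono) auto
      then have "\<theta>\<^sup>2 * \<theta>\<^sup>2 \<le> \<theta>\<^sup>2 * (1/8)\<^sup>2" by (rule mult_left_mono) simp
      then show ?thesis by (simp add: power2_eq_square numeral_eq_Suc)
    qed
    then have "real n * \<theta> ^ 4 \<le> real n * (\<theta>\<^sup>2 * (1/64))" by (rule mult_left_mono) simp
    ultimately show ?thesis by (simp add: field_simps)
  qed
  then have Zn: "norm Z \<le> real n * \<theta>\<^sup>2 / 12" using normZ by linarith
  have Wn: "real n * \<theta>\<^sup>2 / 3 \<le> W * \<theta>\<^sup>2"
    using mult_right_mono[OF V, of "\<theta>\<^sup>2"] by (simp add: W_def)
  have "norm (cf n s \<theta> - G) = norm G * norm (exp Z - 1)"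
    unfolding cf norm_mult[symmetric] by (simp add: algebra_simps)
  also have "\<dots> \<le> exp (- (W * \<theta>\<^sup>2 / 2)) * (norm Z * exp (norm Z))"
    unfolding normG by (intro mult_left_mono norm_exp_minus_one_le) simp
  also have "\<dots> = exp (norm Z - W * \<theta>\<^sup>2 / 2) * norm Z"
    by (simp only: exp_diff exp_minus divide_inverse mult_ac)
  also have "\<dots> \<le> exp (- (real n * \<theta>\<^sup>2 / 12)) * (\<bar>K\<bar> * \<theta> ^ 3 / 3 + 4 * real n * \<theta> ^ 4)"
    using Zn Wn normZ by (intro mult_mono) auto
  finally show ?thesis unfolding G_def B_def W_def K_def .
qed

text \<open>Each factor has squared modulus \<open>1 - (1 - s^2) * sin^2 \<theta>\<close>, at most
  the corresponding exponential. Together with \<open>sin \<theta> \<ge> \<theta> / 2\<close> this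
  covers frequencies up to \<open>pi / 2\<close>, beyond the reach of the logarithmic expansion; 24
  is 3 * 4 * 2, from the variance bound, the sine bound and the halved exponent.\<close>

lemma norm_cf_le:
  fixes s :: "nat \<Rightarrow> real"
  assumes s: "\<And>v. v < n \<Longrightarrow> \<bar>s v\<bar> \<le> 1"
    and V: "real n / 3 \<le> condvar n s" and \<theta>: "0 < \<theta>" "\<theta> \<le> pi / 2"
  shows "norm (cf n s \<theta>) \<le> exp (- (real n * \<theta>\<^sup>2 / 24))"
proof -
  have "norm (Complex (cos \<theta>) (s v * sin \<theta>)) \<le> exp (- ((1 - (s v)\<^sup>2) * (sin \<theta>)\<^sup>2 / 2))" for v
  proof -
    have "(norm (Complex (cos \<theta>) (s v * sin \<theta>)))\<^sup>2 = 1 + - ((1 - (s v)\<^sup>2) * (sin \<theta>)\<^sup>2)"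
      unfolding cmod_power2 by (simp add: cos_squared_eq power_mult_distrib algebra_simps)
    also have "\<dots> \<le> exp (- ((1 - (s v)\<^sup>2) * (sin \<theta>)\<^sup>2))" by (rule exp_ge_add_one_self)
    also have "\<dots> = (exp (- ((1 - (s v)\<^sup>2) * (sin \<theta>)\<^sup>2 / 2)))\<^sup>2"
      by (simp add: power2_eq_square exp_add[symmetric])
    finally show ?thesis by (rule power2_le_imp_le) simp
  qed
  then have "norm (cf n s \<theta>) \<le> (\<Prod>v<n. exp (- ((1 - (s v)\<^sup>2) * (sin \<theta>)\<^sup>2 / 2)))"
    unfolding cf_def prod_norm[symmetric] by (intro prod_mono) auto
  also have "\<dots> = exp (- (condvar n s * (sin \<theta>)\<^sup>2 / 2))"
    by (simp only: exp_sum[OF finite_lessThan, symmetric] sum_negf sum_divide_distrib sum_distrib_right)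
  also have "\<dots> \<le> exp (- (real n * \<theta>\<^sup>2 / 24))"
  proof -
    have "(\<theta> / 2)\<^sup>2 \<le> (sin \<theta>)\<^sup>2" using sin_bounds_half_pi(1)[OF \<theta>] \<theta> by (intro power_mono) auto
    then have "real n / 3 * (\<theta> / 2)\<^sup>2 \<le> condvar n s * (sin \<theta>)\<^sup>2"
      using V by (intro mult_mono) (auto intro: order_trans[of 0 "real n / 3"])
    then show ?thesis by (simp add: power2_eq_square mult_ac)
  qed
  finally show ?thesis .
qed

text \<open>With \<open>x = sqrt n * \<theta>\<close>, three regions occur. For
  \<open>\<theta> \<le> 1/8\<close> the errors are the cumulant terms and the replacement of
  \<open>sqrt n * sin \<theta>\<close> by \<open>x\<close>. Up to \<open>pi / 2\<close> both
  integrands are merely small, and beyond it only the Gaussian one is left. The exponent 1/24 is the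
  slowest of the decay rates, and 192 is 3 * 64 from the region of large \<open>\<theta>\<close>.
  The factor \<open>x\<close> cancels the singularity of the kernels at 0.\<close>

lemma win_Phi_pointwise:
  fixes s :: "nat \<Rightarrow> real" and x :: real
  assumes n: "n > 0" and s: "\<And>v. v < n \<Longrightarrow> \<bar>s v\<bar> \<le> 1"
    and V: "real n / 3 \<le> condvar n s"
  defines "\<kappa> \<equiv> \<bar>condskew n s\<bar> / sqrt n"
    and "y \<equiv> ((\<Sum>v<n. s v) - parity_shift n) / sqrt n"
    and "V' \<equiv> condvar n s / n"
  shows "\<bar>indicator {0<..sqrt n * pi / 2} x *
      (Im (cis (- parity_shift n * (x / sqrt n)) * cf n s (x / sqrt n)) / (sqrt n * sin (x / sqrt n)))
     - indicator {0<..} x * (sin (y * x) / x * exp (- V' * x\<^sup>2 / 2))\<bar>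
    \<le> (1 + \<kappa>) / n * (192 * (\<bar>x\<bar> ^ 1 + \<bar>x\<bar> ^ 2 + \<bar>x\<bar> ^ 3) * exp (- (1/24) * x\<^sup>2))"
proof (cases "x > 0")
  case False
  have "0 \<le> \<kappa>" by (simp add: \<kappa>_def)
  then have "0 \<le> (1 + \<kappa>) / n * (192 * (\<bar>x\<bar> ^ 1 + \<bar>x\<bar> ^ 2 + \<bar>x\<bar> ^ 3) * exp (- (1/24) * x\<^sup>2))"
    by (intro mult_nonneg_nonneg divide_nonneg_nonneg add_nonneg_nonneg) auto
  then show ?thesis using False by (simp add: indicator_def)
next
  case x: True
  define N where "N = real n"
  define \<theta> where "\<theta> = x / sqrt n"
  define c where "c = cis (- parity_shift n * \<theta>)"
  define G where "G = exp (\<i> * of_real ((\<Sum>v<n. s v) * \<theta>) - of_real (condvar n s * \<theta>\<^sup>2 / 2))"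
  define e where "e = exp (- (1/24) * x\<^sup>2)"
  have N: "N > 0" "sqrt N > 0" "N = sqrt N * sqrt N" using n by (simp_all add: N_def)
  have \<theta>: "\<theta> > 0" "x = sqrt N * \<theta>" using x N by (simp_all add: \<theta>_def N_def)
  have N\<theta>2: "N * \<theta>\<^sup>2 = x\<^sup>2" using N by (simp add: \<theta>(2) power_mult_distrib)
  have \<kappa>: "0 \<le> \<kappa>" by (simp add: \<kappa>_def)
  have e0: "e > 0" by (simp add: e_def)
  have nc: "norm c = 1" by (simp add: c_def)
  have V'x: "condvar n s * \<theta>\<^sup>2 = V' * x\<^sup>2"
    using N by (simp add: V'_def \<theta>_def power_divide N_def)
  have V': "V' \<ge> 1/3" using V n by (simp add: V'_def field_simps)
  have cG: "c * G = exp (of_real (- (V' * x\<^sup>2 / 2)) + \<i> * of_real (y * x))"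
  proof -
    have yx: "y * x = (\<Sum>v<n. s v) * \<theta> - parity_shift n * \<theta>"
      unfolding y_def \<theta>_def by (simp add: algebra_simps diff_divide_distrib)
    show ?thesis unfolding c_def G_def cis_conv_exp exp_add[symmetric] V'x yx
      by (rule arg_cong[where f=exp]) (simp add: algebra_simps)
  qed
  have imG: "Im (c * G) = sin (y * x) * exp (- V' * x\<^sup>2 / 2)"
    unfolding cG by (simp add: Im_exp)
  have normG: "norm (c * G) \<le> exp (- x\<^sup>2 / 6)"
    unfolding cG norm_exp_eq_Re using mult_right_mono[OF V', of "x\<^sup>2"] by simp
  have eG: "exp (- x\<^sup>2 / 6) \<le> e" unfolding e_def by simp
  have imGe: "\<bar>Im (c * G)\<bar> \<le> e" using normG eG abs_Im_le_cmod[of "c * G"] by linarith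
  define L where "L = (if x \<le> sqrt n * pi / 2 then Im (c * cf n s \<theta>) / (sqrt N * sin \<theta>) else 0)"
  have lhs: "indicator {0<..sqrt n * pi / 2} x *
      (Im (cis (- parity_shift n * (x / sqrt n)) * cf n s (x / sqrt n)) / (sqrt n * sin (x / sqrt n)))
     - indicator {0<..} x * (sin (y * x) / x * exp (- V' * x\<^sup>2 / 2)) = L - Im (c * G) / x"
    unfolding \<theta>_def[symmetric] c_def[symmetric] imG L_def N_def using x by (simp add: indicator_def)
  have small: "x \<le> sqrt n * pi / 2 \<longleftrightarrow> \<theta> \<le> pi / 2"
    using N \<theta> by (simp add: N_def field_simps)
  have sb: "x / 2 \<le> sqrt N * sin \<theta>" "\<bar>1 / (sqrt N * sin \<theta>) - 1 / x\<bar> \<le> x / N" if "\<theta> \<le> pi / 2"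
  proof -
    note b = sin_bounds_half_pi[OF \<theta>(1) that]
    show "x / 2 \<le> sqrt N * sin \<theta>" using mult_left_mono[OF b(1), of "sqrt N"] N by (simp add: \<theta>(2))
    have "\<bar>1 / (sqrt N * sin \<theta>) - 1 / x\<bar> = \<bar>1 / sin \<theta> - 1 / \<theta>\<bar> / sqrt N"
    proof -
      have "1 / (sqrt N * sin \<theta>) - 1 / x = (1 / sin \<theta> - 1 / \<theta>) / sqrt N"
        unfolding \<theta>(2) using N by (simp add: diff_divide_distrib mult.commute)
      then show ?thesis using N by (simp add: abs_divide)
    qed
    also have "\<dots> \<le> \<theta> / sqrt N" using b(2) N by (intro divide_right_mono) auto
    also have "\<dots> = x / N"
      using N by (simp add: \<theta>_def N_def)
    finally show "\<bar>1 / (sqrt N * sin \<theta>) - 1 / x\<bar> \<le> x / N" .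
  qed
  have main: "\<bar>L - Im (c * G) / x\<bar> \<le> (1 + \<kappa>) / N * (192 * (x + x ^ 2 + x ^ 3) * e)"
  proof (cases "\<theta> \<le> 1/8")
    case True
    have tp: "\<theta> \<le> pi / 2" using True pi_approx by simp
    note sb = sb[OF tp]
    have den: "sqrt N * sin \<theta> > 0" using sb(1) x by linarith
    have "norm (c * cf n s \<theta> - c * G) = norm (cf n s \<theta> - G)"
      by (simp add: nc norm_mult right_diff_distrib[symmetric])
    also have "\<dots> \<le> exp (- (N * \<theta>\<^sup>2 / 12)) * (\<bar>condskew n s\<bar> * \<theta> ^ 3 / 3 + 4 * N * \<theta> ^ 4)"
      unfolding G_def N_def by (rule cf_gauss_approx[OF s less_imp_le[OF \<theta>(1)] True V])
    \<comment> \<open>In the scaled variable the skewness term has order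
      \<open>\<kappa> / n\<close>; \<open>\<kappa>\<close> is of order \<open>sqrt n\<close> in the
      worst case, and only its average is of order 1.\<close>
    also have "\<bar>condskew n s\<bar> * \<theta> ^ 3 = \<kappa> * x ^ 3 / N"
    proof -
      have "\<bar>condskew n s\<bar> = \<kappa> * sqrt N" using N by (simp add: \<kappa>_def N_def)
      moreover have "x ^ 3 = sqrt N * N * \<theta> ^ 3"
        unfolding \<theta>(2) power_mult_distrib using N by (simp add: power3_eq_cube)
      ultimately show ?thesis using N by simp
    qed
    also have "4 * N * \<theta> ^ 4 = 4 * x ^ 4 / N"
    proof -
      have "x ^ 4 = N * N * \<theta> ^ 4"
        unfolding \<theta>(2) power_mult_distrib using N by (simp add: numeral_eq_Suc)
      then show ?thesis using N by simp
    qed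
    also have "exp (- (N * \<theta>\<^sup>2 / 12)) * (\<kappa> * x ^ 3 / N / 3 + 4 * x ^ 4 / N) \<le> e * (\<kappa> * x ^ 3 / N / 3 + 4 * x ^ 4 / N)"
      unfolding e_def N\<theta>2 using x \<kappa> N by (intro mult_right_mono) auto
    finally have d1: "norm (c * cf n s \<theta> - c * G) \<le> e * (\<kappa> * x ^ 3 / N / 3 + 4 * x ^ 4 / N)" .
    have "L - Im (c * G) / x = Im (c * cf n s \<theta> - c * G) * (1 / (sqrt N * sin \<theta>)) + Im (c * G) * (1 / (sqrt N * sin \<theta>) - 1 / x)"
      using tp small by (simp add: L_def diff_divide_distrib right_diff_distrib)
    also have "\<bar>\<dots>\<bar> \<le> \<bar>Im (c * cf n s \<theta> - c * G)\<bar> * \<bar>1 / (sqrt N * sin \<theta>)\<bar> + \<bar>Im (c * G)\<bar> * \<bar>1 / (sqrt N * sin \<theta>) - 1 / x\<bar>"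
      unfolding abs_mult[symmetric] by (rule abs_triangle_ineq)
    also have "\<dots> \<le> (e * (\<kappa> * x ^ 3 / N / 3 + 4 * x ^ 4 / N)) * (2 / x) + e * (x / N)"
    proof (intro add_mono mult_mono)
      show "\<bar>Im (c * cf n s \<theta> - c * G)\<bar> \<le> e * (\<kappa> * x ^ 3 / N / 3 + 4 * x ^ 4 / N)"
        using d1 abs_Im_le_cmod order_trans by blast
      have "1 / (sqrt N * sin \<theta>) \<le> 1 / (x / 2)" using sb(1) x by (intro divide_left_mono) auto
      then show "\<bar>1 / (sqrt N * sin \<theta>)\<bar> \<le> 2 / x" using den by simp
      show "\<bar>Im (c * G)\<bar> \<le> e" by (rule imGe)
      show "\<bar>1 / (sqrt N * sin \<theta>) - 1 / x\<bar> \<le> x / N" by (rule sb)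
    qed (use x \<kappa> N e0 in auto)
    also have "\<dots> = 1 / N * e * (2/3 * \<kappa> * x ^ 2 + 8 * x ^ 3 + x)"
      using x N by (simp add: field_simps numeral_eq_Suc)
    also have "\<dots> \<le> 1 / N * e * ((1 + \<kappa>) * (192 * (x + x ^ 2 + x ^ 3)))"
    proof (rule mult_left_mono)
      have "0 \<le> \<kappa> * x" "0 \<le> \<kappa> * x ^ 2" "0 \<le> \<kappa> * x ^ 3" "0 \<le> x ^ 2" "0 \<le> x ^ 3" using x \<kappa> by simp_all
      then show "2/3 * \<kappa> * x ^ 2 + 8 * x ^ 3 + x \<le> (1 + \<kappa>) * (192 * (x + x ^ 2 + x ^ 3))"
        using x unfolding distrib_left distrib_right by linarith
    qed (use N e0 in auto)
    finally show ?thesis by (simp add: mult_ac)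
  next
    case False
    \<comment> \<open>In this region \<open>x^2 \<ge> N / 64\<close>, so a factor
      \<open>1 / N\<close> is gained at the price of one power of \<open>x\<close>, absorbed by the
      Gaussian.\<close>
    have xN: "1 / x \<le> 64 * x / N"
    proof -
      have "(1/8)\<^sup>2 \<le> \<theta>\<^sup>2" using False by (intro power_mono) auto
      then have "N * (1/8)\<^sup>2 \<le> x\<^sup>2" unfolding N\<theta>2[symmetric] using N by (intro mult_left_mono) auto
      then have "N \<le> 64 * x * x" by (simp add: power2_eq_square)
      then show ?thesis using x N by (simp add: field_simps)
    qed
    have "\<bar>L\<bar> \<le> e * (2 / x)"
    proof (cases "\<theta> \<le> pi / 2")
      case True
      note sb = sb[OF True]
      have den: "sqrt N * sin \<theta> > 0" using sb(1) x by linarith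
      have "\<bar>Im (c * cf n s \<theta>)\<bar> \<le> norm (cf n s \<theta>)" using abs_Im_le_cmod[of "c * cf n s \<theta>"] by (simp add: norm_mult nc)
      also have "\<dots> \<le> exp (- (real n * \<theta>\<^sup>2 / 24))" by (rule norm_cf_le[OF s V \<theta>(1) True])
      also have "\<dots> = e" using N\<theta>2 by (simp add: e_def N_def)
      finally have "\<bar>Im (c * cf n s \<theta>)\<bar> \<le> e" .
      moreover have "1 / (sqrt N * sin \<theta>) \<le> 1 / (x / 2)" using sb(1) x by (intro divide_left_mono) auto
      then have "\<bar>1 / (sqrt N * sin \<theta>)\<bar> \<le> 2 / x" using den by simp
      ultimately have "\<bar>Im (c * cf n s \<theta>)\<bar> * \<bar>1 / (sqrt N * sin \<theta>)\<bar> \<le> e * (2 / x)"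
        using e0 by (intro mult_mono) auto
      then show ?thesis using True small by (simp add: L_def abs_mult)
    next
      case False
      \<comment> \<open>Here the range of the inversion integral for \<open>win\<close> has ended,
        so \<open>L = 0\<close>.\<close>
      then show ?thesis using small e0 x by (simp add: L_def)
    qed
    moreover have "\<bar>Im (c * G) / x\<bar> \<le> e * (1 / x)"
      using divide_right_mono[OF imGe, of x] x by (simp add: abs_divide)
    ultimately have "\<bar>L - Im (c * G) / x\<bar> \<le> e * (2 / x) + e * (1 / x)"
      by (rule order_trans[OF abs_triangle_ineq4 add_mono])
    also have "\<dots> = e * 3 * (1 / x)" by simp
    also have "\<dots> \<le> e * 3 * (64 * x / N)" using xN e0 by (intro mult_left_mono) auto
    also have "\<dots> = 1 / N * e * (192 * x)" by simp
    also have "\<dots> \<le> 1 / N * e * ((1 + \<kappa>) * (192 * (x + x ^ 2 + x ^ 3)))"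
    proof (rule mult_left_mono)
      have "0 \<le> \<kappa> * x" "0 \<le> \<kappa> * x ^ 2" "0 \<le> \<kappa> * x ^ 3" "0 \<le> x ^ 2" "0 \<le> x ^ 3" using x \<kappa> by simp_all
      then show "192 * x \<le> (1 + \<kappa>) * (192 * (x + x ^ 2 + x ^ 3))"
        using x unfolding distrib_left distrib_right by linarith
    qed (use N e0 in auto)
    finally show ?thesis by (simp add: mult_ac)
  qed
  show ?thesis unfolding lhs using main x by (simp add: e_def N_def)
qed

text \<open>The pointwise majorant has an integrable profile independent of \<open>n\<close> and
  \<open>s\<close>, whose integral divided by \<open>pi\<close> is \<open>C\<close>. The skewness
  stays explicit because it has to be averaged over \<open>s\<close> later.\<close>

lemma win_Phi_approx:
  obtains C where "C \<ge> 0"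
    "\<And>n s. n > 0 \<Longrightarrow> (\<And>v. v < n \<Longrightarrow> \<bar>s v\<bar> \<le> 1) \<Longrightarrow> real n / 3 \<le> condvar n s \<Longrightarrow>
      \<bar>win n s - Phi (((\<Sum>v<n. s v) - parity_shift n) / sqrt n / sqrt (condvar n s / n))\<bar>
       \<le> C * (1 + \<bar>condskew n s\<bar> / sqrt n) / n"
proof
  define q where "q = (\<lambda>x::real. 192 * (\<bar>x\<bar> ^ 1 + \<bar>x\<bar> ^ 2 + \<bar>x\<bar> ^ 3) * exp (- (1/24) * x\<^sup>2))"
  have q: "integrable lborel q"
  proof -
    have "integrable lborel (\<lambda>x::real. 192 * (\<bar>x\<bar> ^ 1 * exp (- (1/24) * x\<^sup>2) + \<bar>x\<bar> ^ 2 * exp (- (1/24) * x\<^sup>2) + \<bar>x\<bar> ^ 3 * exp (- (1/24) * x\<^sup>2)))"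
      by (intro Bochner_Integration.integrable_add integrable_mult_right integrable_power_exp_square) simp_all
    then show ?thesis by (simp only: q_def distrib_right mult.assoc)
  qed
  define C where "C = 1 / pi * (LBINT x. q x)"
  have q0: "0 \<le> q x" for x by (simp add: q_def)
  show "C \<ge> 0" unfolding C_def using q0 by simp
  fix n :: nat and s :: "nat \<Rightarrow> real"
  assume n: "n > 0" and s: "\<And>v. v < n \<Longrightarrow> \<bar>s v\<bar> \<le> 1" and V: "real n / 3 \<le> condvar n s"
  define \<kappa> where "\<kappa> = \<bar>condskew n s\<bar> / sqrt n"
  define y where "y = ((\<Sum>v<n. s v) - parity_shift n) / sqrt n"
  define V' where "V' = condvar n s / n"
  have V'pos: "V' > 0" using V n unfolding V'_def by (intro divide_pos_pos) (auto intro: less_le_trans[of 0 "real n / 3"])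
  define f where "f = (\<lambda>x. indicator {0<..sqrt n * pi / 2} x *
      (Im (cis (- parity_shift n * (x / sqrt n)) * cf n s (x / sqrt n)) / (sqrt n * sin (x / sqrt n))))"
  define g where "g = (\<lambda>x. indicator {0<..} x * (sin (y * x) / x * exp (- V' * x\<^sup>2 / 2)))"
  have f: "win n s = 1 / 2 + 1 / pi * (LBINT x. f x)" "integrable lborel f"
    unfolding f_def by (rule win_fourier_scaled[OF n])+
  have g: "Phi (y / sqrt V') = 1 / 2 + 1 / pi * (LBINT x. g x)"
    unfolding g_def by (rule Phi_fourier[OF V'pos])
  have g': "integrable lborel g"
    unfolding g_def using integrable_mult_indicator[OF _ sinc_gauss_integrable[OF V'pos, of y], of "{0<..}"] by simp
  have "win n s - Phi (y / sqrt V') = 1 / pi * (LBINT x. f x - g x)"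
    unfolding f(1) g using f(2) g' by (simp add: right_diff_distrib)
  moreover have "\<bar>LBINT x. f x - g x\<bar> \<le> (LBINT x. (1 + \<kappa>) / n * q x)"
  proof -
    have "norm (LBINT x. f x - g x) \<le> (LBINT x. (1 + \<kappa>) / n * q x)"
    proof (rule Bochner_Integration.integral_norm_bound_integral)
      show "norm (f x - g x) \<le> (1 + \<kappa>) / n * q x" for x
        using win_Phi_pointwise[where n=n and s=s and x=x, OF n s V]
        unfolding f_def g_def q_def y_def V'_def \<kappa>_def real_norm_def .
    qed (use f g' q in auto)
    then show ?thesis by simp
  qed
  ultimately have "\<bar>win n s - Phi (y / sqrt V')\<bar> \<le> 1 / pi * (LBINT x. (1 + \<kappa>) / n * q x)"
    using mult_left_mono[of "\<bar>LBINT x. f x - g x\<bar>" "LBINT x. (1 + \<kappa>) / n * q x" "1 / pi"]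
    by (simp only: abs_mult) simp
  also have "\<dots> = 1 / pi * ((1 + \<kappa>) / n * (LBINT x. q x))" by simp
  also have "\<dots> = C * (1 + \<kappa>) / n" by (simp add: C_def)
  finally show "\<bar>win n s - Phi (((\<Sum>v<n. s v) - parity_shift n) / sqrt n / sqrt (condvar n s / n))\<bar>
       \<le> C * (1 + \<bar>condskew n s\<bar> / sqrt n) / n"
    unfolding y_def V'_def \<kappa>_def .
qed

section \<open>Functions with bounded derivatives\<close>

text \<open>Recursion through the existence of a derivative makes the closure under sums, products
  and scaling an induction on the order. Measurability is part of every level, so that such
  functions can be integrated against any of the laws involved.\<close>

primrec bddC :: "nat \<Rightarrow> (real \<Rightarrow> real) \<Rightarrow> bool" where
  "bddC 0 f \<longleftrightarrow> f \<in> borel_measurable borel \<and> (\<exists>M. \<forall>x. \<bar>f x\<bar> \<le> M)"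
| "bddC (Suc k) f \<longleftrightarrow> (f \<in> borel_measurable borel \<and> (\<exists>M. \<forall>x. \<bar>f x\<bar> \<le> M)) \<and> (\<exists>f'. (\<forall>x. (f has_real_derivative f' x) (at x)) \<and> bddC k f')"

lemma bddC_SucI:
  assumes "bddC 0 f" "\<And>x. (f has_real_derivative f' x) (at x)" "bddC k f'"
  shows "bddC (Suc k) f"
  using assms by auto

lemma bddC_SucE:
  assumes "bddC (Suc k) f"
  obtains f' where "bddC 0 f" "\<And>x. (f has_real_derivative f' x) (at x)" "bddC k f'"
  using assms by auto

lemma bddC_0: "bddC k f \<Longrightarrow> bddC 0 f"
  by (cases k) auto

lemma bddC_Suc_imp: "bddC (Suc k) f \<Longrightarrow> bddC k f"
proof (induction k arbitrary: f)
  case (Suc k)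
  obtain f' where "bddC 0 f" "\<And>x. (f has_real_derivative f' x) (at x)" "bddC (Suc k) f'"
    by (rule bddC_SucE[OF Suc.prems]) (rule that)
  then show ?case by (intro bddC_SucI[of f f'] Suc.IH)
qed (rule bddC_0)

lemma bddC_const: "bddC k (\<lambda>_. c)"
proof (induction k arbitrary: c)
  case (Suc k)
  have "\<forall>x. ((\<lambda>_. c) has_real_derivative 0) (at x)" for c :: real by simp
  then show ?case using Suc[of 0] by (auto intro!: exI[of _ "\<bar>c\<bar>"] exI[of _ "\<lambda>_. 0"])
qed auto

lemma bddC_add:
  assumes "bddC k f" "bddC k g"
  shows "bddC k (\<lambda>x. f x + g x)"
  using assms
proof (induction k arbitrary: f g)
  case 0
  then obtain A B where "\<And>x. \<bar>f x\<bar> \<le> A" "\<And>x. \<bar>g x\<bar> \<le> B" by auto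
  then have "\<bar>f x + g x\<bar> \<le> A + B" for x using abs_triangle_ineq[of "f x" "g x"] by (meson add_mono order_trans)
  then show ?case using 0 by auto
next
  case (Suc k)
  note Suc0 = Suc.prems[THEN bddC_0]
  obtain f' g' where "\<And>x. (f has_real_derivative f' x) (at x)" "bddC k f'"
    "\<And>x. (g has_real_derivative g' x) (at x)" "bddC k g'" using Suc.prems by auto
  then have "((\<lambda>x. f x + g x) has_real_derivative f' x + g' x) (at x)" "bddC k (\<lambda>x. f' x + g' x)" for x
    using Suc.IH by (auto intro: DERIV_add)
  moreover have "bddC 0 (\<lambda>x. f x + g x)"
  proof -
    obtain A B where "\<And>x. \<bar>f x\<bar> \<le> A" "\<And>x. \<bar>g x\<bar> \<le> B" using Suc0 by auto
    then have "\<bar>f x + g x\<bar> \<le> A + B" for x using abs_triangle_ineq[of "f x" "g x"] by (meson add_mono order_trans)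
    then show ?thesis using Suc0 by auto
  qed
  ultimately show ?case by (intro bddC_SucI)
qed

lemma bddC_0_mult:
  assumes "bddC 0 f" "bddC 0 g"
  shows "bddC 0 (\<lambda>x. f x * g x)"
proof -
  obtain A B where AB: "\<And>x. \<bar>f x\<bar> \<le> A" "\<And>x. \<bar>g x\<bar> \<le> B" using assms by auto
  have "A \<ge> 0" using AB(1)[of 0] by linarith
  then have "\<bar>f x * g x\<bar> \<le> A * B" for x unfolding abs_mult using AB by (intro mult_mono) auto
  then show ?thesis using assms by auto
qed

lemma bddC_mult:
  assumes "bddC k f" "bddC k g"
  shows "bddC k (\<lambda>x. f x * g x)"
  using assms
proof (induction k arbitrary: f g)
  case 0 then show ?case by (rule bddC_0_mult)
next
  case (Suc k)
  obtain f' g' where *: "\<And>x. (f has_real_derivative f' x) (at x)" "bddC k f'"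
    "\<And>x. (g has_real_derivative g' x) (at x)" "bddC k g'" using Suc.prems by auto
  have "bddC k (\<lambda>x. f' x * g x + g' x * f x)"
    using * Suc.IH bddC_Suc_imp[OF Suc.prems(1)] bddC_Suc_imp[OF Suc.prems(2)] by (intro bddC_add) auto
  moreover have "((\<lambda>x. f x * g x) has_real_derivative f' x * g x + g' x * f x) (at x)" for x
    using * by (auto intro: DERIV_mult)
  moreover have "bddC 0 (\<lambda>x. f x * g x)"
    using Suc.prems by (intro bddC_0_mult) (auto intro: bddC_0)
  ultimately show ?case by (intro bddC_SucI)
qed

lemma bddC_power: "bddC k f \<Longrightarrow> bddC k (\<lambda>x. f x ^ d)"
  by (induction d) (auto intro: bddC_const bddC_mult)

lemma bddC_scale:
  assumes "bddC k f"
  shows "bddC k (\<lambda>x. f (a * x))"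
  using assms
proof (induction k arbitrary: f)
  case 0 then show ?case by auto
next
  case (Suc k)
  obtain f' where *: "\<And>x. (f has_real_derivative f' x) (at x)" "bddC k f'" using Suc.prems by auto
  have "((\<lambda>x. f (a * x)) has_real_derivative f' (a * x) * a) (at x)" for x
    by (rule DERIV_chain2[OF *(1)]) (auto intro!: derivative_eq_intros)
  moreover have "bddC k (\<lambda>x. f' (a * x) * a)"
    using Suc.IH[OF *(2)] by (intro bddC_mult bddC_const)
  moreover have "bddC 0 (\<lambda>x. f (a * x))" using bddC_0[OF Suc.prems] by auto
  ultimately show ?case by (intro bddC_SucI)
qed

lemma power_le_fact_exp:
  fixes x :: real
  assumes "x \<ge> 0"
  shows "x ^ j \<le> fact j * exp x"
proof -
  have "(\<Sum>n\<in>{j}. inverse (fact n) *\<^sub>R x ^ n) \<le> (\<Sum>n. inverse (fact n) *\<^sub>R x ^ n)"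
    using assms by (intro sum_le_suminf summable_exp_generic) auto
  then show ?thesis unfolding exp_def by (simp add: field_simps)
qed

text \<open>Arbitrary powers \<open>j\<close> are needed in the induction, since differentiating
  \<open>x ^ j * \<phi> x\<close> leads to the powers \<open>j - 1\<close> and
  \<open>j + 1\<close>.\<close>

lemma bddC_power_gauss: "bddC k (\<lambda>x. x ^ j * \<phi> x)"
proof (induction k arbitrary: j)
  case 0
  have "\<bar>x ^ j * \<phi> x\<bar> \<le> fact j * exp (1/2)" for x :: real
  proof -
    \<comment> \<open>A power is dominated by \<open>fact j * exp \<bar>x\<bar>\<close>, and
      completing the square bounds the exponent \<open>\<bar>x\<bar> - x^2 / 2\<close> by
      1/2.\<close>
    have "\<bar>x\<bar> ^ j * exp (- x\<^sup>2 / 2) \<le> (fact j * exp \<bar>x\<bar>) * exp (- x\<^sup>2 / 2)"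
      by (intro mult_right_mono power_le_fact_exp) auto
    also have "\<dots> = fact j * exp (\<bar>x\<bar> - x\<^sup>2 / 2)" by (simp only: mult.assoc mult_exp_exp) simp
    also have "\<bar>x\<bar> - x\<^sup>2 / 2 \<le> 1/2"
      using zero_le_power2[of "\<bar>x\<bar> - 1"] by (simp add: power2_eq_square algebra_simps)
    finally have le: "\<bar>x\<bar> ^ j * exp (- x\<^sup>2 / 2) \<le> fact j * exp (1/2)" by simp
    have "1 \<le> sqrt (2 * pi)" using pi_ge_two by simp
    then have "1 / sqrt (2 * pi) * (\<bar>x\<bar> ^ j * exp (- x\<^sup>2 / 2)) \<le> 1 * (\<bar>x\<bar> ^ j * exp (- x\<^sup>2 / 2))"
      by (intro mult_right_mono) (auto simp: divide_le_eq)
    then have "1 / sqrt (2 * pi) * (\<bar>x\<bar> ^ j * exp (- x\<^sup>2 / 2)) \<le> fact j * exp (1/2)"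
      using le by linarith
    then show ?thesis by (simp add: std_normal_density_def abs_mult power_abs)
  qed
  then show ?case by auto
next
  case (Suc k)
  have "((\<lambda>x. x ^ j * \<phi> x) has_real_derivative
      real j * (x ^ (j - 1) * \<phi> x) + (- 1) * (x ^ Suc j * \<phi> x)) (at x)" for x
  proof -
    have "(\<phi> has_real_derivative - x * \<phi> x) (at x)"
    proof -
      have "((\<lambda>x. exp (- x\<^sup>2 / 2)) has_real_derivative - x * exp (- x\<^sup>2 / 2)) (at x)"
        by (auto intro!: derivative_eq_intros)
      from DERIV_cmult[OF this, of "1 / sqrt (2 * pi)"] show ?thesis
        unfolding std_normal_density_def[abs_def] by (simp add: mult_ac)
    qed
    from DERIV_mult[OF DERIV_pow[of j x] this] show ?thesis by (simp add: algebra_simps)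
  qed
  moreover have "bddC k (\<lambda>x. real j * (x ^ (j - 1) * \<phi> x) + (- 1) * (x ^ Suc j * \<phi> x))"
    by (intro bddC_add bddC_mult bddC_const Suc.IH)
  moreover have "bddC 0 (\<lambda>x. x ^ j * \<phi> x)" by (rule bddC_0[OF Suc.IH])
  ultimately show ?case by (intro bddC_SucI)
qed

lemma bddC_Phi: "bddC k Phi"
proof -
  have "continuous_on UNIV Phi"
    by (intro continuous_at_imp_continuous_on ballI DERIV_isCont[OF DERIV_Phi])
  then have "Phi \<in> borel_measurable borel" by (rule borel_measurable_continuous_onI)
  moreover have "\<bar>Phi x\<bar> \<le> 1" for x using Phi_bounds[of x] by simp
  ultimately have 0: "bddC 0 Phi" by auto
  have "bddC l \<phi>" for l using bddC_power_gauss[of l 0] by simp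
  then show ?thesis by (cases k) (use 0 in \<open>auto intro: bddC_SucI[OF 0 DERIV_Phi] simp del: bddC.simps\<close>)
qed

text \<open>Unlike a bound on the fourth derivative, this inequality can be integrated directly:
  averaging \<open>h\<close> against a normal law preserves it with the same \<open>M\<close>,
  without differentiating under the integral. The replacement argument iterates such averages, so
  \<open>M\<close> must not grow.\<close>

definition taylor4 :: "real \<Rightarrow> (real \<Rightarrow> real) \<Rightarrow> bool" where
  "taylor4 M h \<longleftrightarrow> bddC 0 h \<and> (\<exists>h1 h2 h3. bddC 0 h1 \<and> bddC 0 h2 \<and> bddC 0 h3 \<and>
     (\<forall>x y. \<bar>h (x + y) - (h x + h1 x * y + h2 x * y\<^sup>2 / 2 + h3 x * y ^ 3 / 6)\<bar> \<le> M * y ^ 4))"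

lemma bddC_4_imp_taylor4:
  assumes "bddC 4 h"
  obtains M where "M \<ge> 0" "taylor4 M h"
proof -
  from assms obtain h1 h2 h3 h4 where d: "\<And>x. (h has_real_derivative h1 x) (at x)" "\<And>x. (h1 has_real_derivative h2 x) (at x)"
    "\<And>x. (h2 has_real_derivative h3 x) (at x)" "\<And>x. (h3 has_real_derivative h4 x) (at x)"
    and b: "bddC 0 h" "bddC 0 h1" "bddC 0 h2" "bddC 0 h3" "bddC 0 h4"
  proof -
    have "bddC (Suc (Suc (Suc (Suc 0)))) h" using assms by (simp add: numeral_eq_Suc del: bddC.simps)
    then show ?thesis by (elim bddC_SucE) (rule that)
  qed
  then obtain M where M: "\<And>x. \<bar>h4 x\<bar> \<le> M" by auto
  define f where "f i = (if i = 0 then h else if i = 1 then h1 else if i = 2 then h2 else if i = 3 then h3 else h4)" for i :: nat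
  have df: "(f i has_field_derivative f (Suc i) x) (at x within UNIV)" if "i \<le> 3" for i x
  proof -
    have "i = 0 \<or> i = 1 \<or> i = 2 \<or> i = 3" using that by auto
    then show ?thesis using d by (auto simp: f_def)
  qed
  have "\<bar>h (x + y) - (h x + h1 x * y + h2 x * y\<^sup>2 / 2 + h3 x * y ^ 3 / 6)\<bar> \<le> M * y ^ 4" for x y
  proof -
    have "norm (f 0 (x + y) - (\<Sum>i\<le>3. f i x * (x + y - x) ^ i / fact i)) \<le> M * norm (x + y - x) ^ Suc 3 / fact 3"
      by (rule field_Taylor[where S=UNIV]) (use df M in \<open>auto simp: f_def\<close>)
    moreover have "(\<Sum>i\<le>3. f i x * (x + y - x) ^ i / fact i) = h x + h1 x * y + h2 x * y\<^sup>2 / 2 + h3 x * y ^ 3 / 6"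
      by (simp add: f_def numeral_3_eq_3 fact_numeral eval_nat_numeral)
    moreover have "M * norm (x + y - x) ^ Suc 3 / fact 3 \<le> M * y ^ 4"
    proof -
      have "M \<ge> 0" using M[of 0] by linarith
      then have "M * y ^ 4 / 6 \<le> M * y ^ 4" by simp
      then show ?thesis by (simp add: fact_numeral power_even_abs)
    qed
    ultimately show ?thesis by (simp add: f_def)
  qed
  moreover have "M \<ge> 0" using M[of 0] by linarith
  ultimately have "taylor4 M h"
    unfolding taylor4_def using b by (intro conjI exI[of _ h1] exI[of _ h2] exI[of _ h3] allI) 
  then show thesis using \<open>M \<ge> 0\<close> by (rule that[rotated])
qed

lemma bddC_2_taylor:
  assumes "bddC 2 h"
  obtains h1 M where "M \<ge> 0" "bddC 0 h1" "\<And>x. (h has_real_derivative h1 x) (at x)"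
    "\<And>x y. \<bar>h (x + y) - (h x + h1 x * y)\<bar> \<le> M * y\<^sup>2"
proof -
  from assms obtain h1 h2 where d: "\<And>x. (h has_real_derivative h1 x) (at x)" "\<And>x. (h1 has_real_derivative h2 x) (at x)"
    and b: "bddC 0 h" "bddC 0 h1" "bddC 0 h2"
  proof -
    have "bddC (Suc (Suc 0)) h" using assms by (simp add: numeral_eq_Suc del: bddC.simps)
    then show ?thesis by (elim bddC_SucE) (rule that)
  qed
  then obtain M where M: "\<And>x. \<bar>h2 x\<bar> \<le> M" by auto
  define f where "f i = (if i = 0 then h else if i = 1 then h1 else h2)" for i :: nat
  have df: "(f i has_field_derivative f (Suc i) x) (at x within UNIV)" if "i \<le> 1" for i x
  proof -
    have "i = 0 \<or> i = 1" using that by auto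
    then show ?thesis using d by (auto simp: f_def)
  qed
  have "\<bar>h (x + y) - (h x + h1 x * y)\<bar> \<le> M * y\<^sup>2" for x y
  proof -
    have "norm (f 0 (x + y) - (\<Sum>i\<le>1. f i x * (x + y - x) ^ i / fact i)) \<le> M * norm (x + y - x) ^ Suc 1 / fact 1"
      by (rule field_Taylor[where S=UNIV]) (use df M in \<open>auto simp: f_def\<close>)
    then show ?thesis by (simp add: f_def power2_eq_square)
  qed
  moreover have "M \<ge> 0" using M[of 0] by linarith
  ultimately show thesis using b d(1) by (intro that[of M h1])
qed

section \<open>The Lindeberg replacement argument\<close>

abbreviation "N01 \<equiv> std_normal_distribution"

lemma prob_space_N01: "prob_space N01"
  using real_dist_normal_dist by (simp add: real_distribution_def)

lemma measure_N01_UNIV [simp]: "measure N01 UNIV = 1"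
  using prob_space.prob_space[OF prob_space_N01] by simp

lemma bddC_0_integrable:
  assumes "bddC 0 f" "prob_space P" "g \<in> borel_measurable P"
  shows "integrable P (\<lambda>z. f (g z))"
proof -
  interpret prob_space P by fact
  obtain M where "\<And>x. \<bar>f x\<bar> \<le> M" using assms(1) by auto
  moreover have "(\<lambda>z. f (g z)) \<in> borel_measurable P"
    using assms by (auto intro: measurable_compose)
  ultimately show ?thesis by (intro integrable_const_bound[of _ M]) auto
qed

lemma abs_integral_le:
  fixes f g :: "'a \<Rightarrow> real"
  assumes "integrable P f" "integrable P g" "\<And>x. \<bar>f x\<bar> \<le> g x"
  shows "\<bar>\<integral>x. f x \<partial>P\<bar> \<le> (\<integral>x. g x \<partial>P)"
  by (rule order_trans[OF integral_abs_bound integral_mono[OF integrable_abs]]) (use assms in auto)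

lemma abs_expectation_le:
  fixes f :: "'a \<Rightarrow> real"
  assumes P: "prob_space P" and f: "integrable P f" and le: "\<And>x. \<bar>f x\<bar> \<le> c"
  shows "\<bar>\<integral>x. f x \<partial>P\<bar> \<le> c"
proof -
  interpret prob_space P by fact
  have "\<bar>\<integral>x. f x \<partial>P\<bar> \<le> (\<integral>x. \<bar>f x\<bar> \<partial>P)" by (rule integral_abs_bound)
  also have "\<dots> \<le> (\<integral>x. c \<partial>P)" by (rule integral_mono[OF integrable_abs[OF f]]) (auto simp: le)
  finally show ?thesis by (simp add: prob_space)
qed

lemma bddC_0_average:
  assumes "bddC 0 h"
  shows "bddC 0 (\<lambda>x. \<integral>z. h (x + a * z) \<partial>N01)"
proof -
  interpret prob_space N01 by (rule prob_space_N01)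
  obtain M where M: "\<And>x. \<bar>h x\<bar> \<le> M" and [measurable]: "h \<in> borel_measurable borel" using assms by auto
  have "(\<lambda>x. \<integral>z. h (x + a * z) \<partial>N01) \<in> borel_measurable borel"
    by measurable
  moreover have "\<bar>\<integral>z. h (x + a * z) \<partial>N01\<bar> \<le> M" for x
  proof -
    have i: "integrable N01 (\<lambda>z. h (x + a * z))"
      by (rule bddC_0_integrable[OF assms prob_space_N01]) measurable
    have "\<bar>\<integral>z. h (x + a * z) \<partial>N01\<bar> \<le> (\<integral>z. \<bar>h (x + a * z)\<bar> \<partial>N01)" by (rule integral_abs_bound)
    also have "\<dots> \<le> (\<integral>z. M \<partial>N01)" using i M by (intro integral_mono) auto
    finally show ?thesis by (simp add: prob_space)
  qed
  ultimately show ?thesis by auto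
qed

text \<open>The coefficients of the averaged function are the averages of the coefficients, and the
  pointwise remainder bound passes through the expectation unchanged.\<close>

lemma taylor4_average:
  assumes "taylor4 M h"
  shows "taylor4 M (\<lambda>x. \<integral>z. h (x + a * z) \<partial>N01)"
proof -
  interpret prob_space N01 by (rule prob_space_N01)
  obtain h1 h2 h3 where b: "bddC 0 h" "bddC 0 h1" "bddC 0 h2" "bddC 0 h3"
    and T: "\<And>x y. \<bar>h (x + y) - (h x + h1 x * y + h2 x * y\<^sup>2 / 2 + h3 x * y ^ 3 / 6)\<bar> \<le> M * y ^ 4"
    using assms unfolding taylor4_def by blast
  have i: "integrable N01 (\<lambda>z. f (x + a * z))" if "bddC 0 f" for f x
    by (rule bddC_0_integrable[OF that prob_space_N01]) measurable
  let ?A = "\<lambda>f x. \<integral>z. f (x + a * z) \<partial>N01"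
  have "\<bar>?A h (x + y) - (?A h x + ?A h1 x * y + ?A h2 x * y\<^sup>2 / 2 + ?A h3 x * y ^ 3 / 6)\<bar> \<le> M * y ^ 4" for x y
  proof -
    let ?R = "\<lambda>z. h (x + y + a * z) - (h (x + a * z) + h1 (x + a * z) * y + h2 (x + a * z) * y\<^sup>2 / 2 + h3 (x + a * z) * y ^ 3 / 6)"
    have R: "integrable N01 ?R" 
      by (intro Bochner_Integration.integrable_diff Bochner_Integration.integrable_add integrable_mult_left integrable_divide i b)
    have "?A h (x + y) - (?A h x + ?A h1 x * y + ?A h2 x * y\<^sup>2 / 2 + ?A h3 x * y ^ 3 / 6) = (\<integral>z. ?R z \<partial>N01)"
      using b by (simp add: i del: bddC.simps)
    also have "\<bar>\<dots>\<bar> \<le> M * y ^ 4"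
    proof (rule abs_expectation_le[OF prob_space_N01 R])
      fix z show "\<bar>?R z\<bar> \<le> M * y ^ 4" using T[of "x + a * z" y] by (simp add: add_ac)
    qed
    finally show ?thesis .
  qed
  then show ?thesis unfolding taylor4_def
    using bddC_0_average[OF b(1)] bddC_0_average[OF b(2)] bddC_0_average[OF b(3)] bddC_0_average[OF b(4)]
    by (intro conjI exI[of _ "?A h1"] exI[of _ "?A h2"] exI[of _ "?A h3"] allI)
qed

text \<open>With vanishing first and third moments only the second-order term of the Taylor
  polynomial survives, so two such laws with equal variance differ by fourth-order errors
  alone.\<close>

lemma taylor4_expectation:
  assumes P: "prob_space P" "sets P = sets borel"
    and int: "\<And>k. integrable P (\<lambda>z. z ^ k)"
    and mom: "(\<integral>z. z \<partial>P) = 0" "(\<integral>z. z ^ 3 \<partial>P) = 0"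
    and b: "bddC 0 h"
    and T: "\<And>x y. \<bar>h (x + y) - (h x + h1 x * y + h2 x * y\<^sup>2 / 2 + h3 x * y ^ 3 / 6)\<bar> \<le> M * y ^ 4"
  shows "\<bar>(\<integral>z. h (x + \<tau> * z) \<partial>P) - (h x + h2 x * (\<tau>\<^sup>2 * (\<integral>z. z\<^sup>2 \<partial>P)) / 2)\<bar> \<le> M * \<tau> ^ 4 * (\<integral>z. z ^ 4 \<partial>P)"
proof -
  interpret prob_space P by fact
  have [measurable_cong]: "sets P = sets borel" by fact
  have i: "integrable P (\<lambda>z. h (x + \<tau> * z))"
    by (rule bddC_0_integrable[OF b P(1)]) measurable
  have int1: "integrable P (\<lambda>z. z)" using int[of 1] by simp
  let ?p = "\<lambda>z. h x + (h1 x * \<tau>) * z + (h2 x * \<tau>\<^sup>2 / 2) * z\<^sup>2 + (h3 x * \<tau> ^ 3 / 6) * z ^ 3"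
  have p: "integrable P ?p" using int int1 by auto
  have pv: "(\<integral>z. ?p z \<partial>P) = h x + h2 x * (\<tau>\<^sup>2 * (\<integral>z. z\<^sup>2 \<partial>P)) / 2"
    using int int1 mom by (simp add: prob_space)
  have D: "(\<integral>z. h (x + \<tau> * z) \<partial>P) - (h x + h2 x * (\<tau>\<^sup>2 * (\<integral>z. z\<^sup>2 \<partial>P)) / 2) = (\<integral>z. h (x + \<tau> * z) - ?p z \<partial>P)"
    unfolding pv[symmetric] by (rule Bochner_Integration.integral_diff[OF i p, symmetric])
  have "\<bar>\<integral>z. h (x + \<tau> * z) - ?p z \<partial>P\<bar> \<le> (\<integral>z. (M * \<tau> ^ 4) * z ^ 4 \<partial>P)"
  proof (rule abs_integral_le)
    show "integrable P (\<lambda>z. h (x + \<tau> * z) - ?p z)" by (rule Bochner_Integration.integrable_diff[OF i p])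
    show "integrable P (\<lambda>z. (M * \<tau> ^ 4) * z ^ 4)" by (rule integrable_mult_right[OF int])
    fix z show "\<bar>h (x + \<tau> * z) - ?p z\<bar> \<le> (M * \<tau> ^ 4) * z ^ 4"
    proof -
      have "h x + h1 x * (\<tau> * z) + h2 x * (\<tau> * z)\<^sup>2 / 2 + h3 x * (\<tau> * z) ^ 3 / 6 = ?p z"
        by (simp add: power_mult_distrib)
      moreover have "M * (\<tau> * z) ^ 4 = (M * \<tau> ^ 4) * z ^ 4" by (simp add: power_mult_distrib)
      ultimately show ?thesis using T[of x "\<tau> * z"] by (simp only:)
    qed
  qed
  then show ?thesis unfolding D integral_mult_right_zero .
qed

lemma unif_moments:
  "integrable unif (\<lambda>z. z ^ k)" "(\<integral>z. z \<partial>unif) = 0" "(\<integral>z. z\<^sup>2 \<partial>unif) = 1 / 3"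
  "(\<integral>z. z ^ 3 \<partial>unif) = 0" "(\<integral>z. z ^ 4 \<partial>unif) = 1 / 5"
proof -
  have hi: "((\<lambda>z. z ^ k) has_integral (1 ^ Suc k / Suc k - (-1) ^ Suc k / Suc k)) {-1..1::real}" for k
  proof (rule fundamental_theorem_of_calculus)
    fix z :: real
    have "((\<lambda>z. z ^ Suc k / real (Suc k)) has_real_derivative real (Suc k) * z ^ k / real (Suc k)) (at z within {-1..1})"
      using DERIV_cdivide[OF DERIV_pow[of "Suc k" z "{-1..1}"], of "real (Suc k)"] by (simp del: power_Suc of_nat_Suc)
    then show "((\<lambda>z. z ^ Suc k / real (Suc k)) has_vector_derivative z ^ k) (at z within {-1..1})"
      by (simp add: has_real_derivative_iff_has_vector_derivative[symmetric] del: power_Suc of_nat_Suc)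
  qed simp
  have m: "integral\<^sup>L unif (\<lambda>z. z ^ k) = (1 ^ Suc k / Suc k - (-1) ^ Suc k / Suc k) / 2"
    "integrable unif (\<lambda>z. z ^ k)" for k
  proof -
    have "continuous_on {-1..1} (\<lambda>z::real. z ^ k)" by (intro continuous_intros)
    moreover have "(\<lambda>z::real. z ^ k) \<in> borel_measurable borel" by measurable
    ultimately show "integral\<^sup>L unif (\<lambda>z. z ^ k) = (1 ^ Suc k / Suc k - (-1) ^ Suc k / Suc k) / 2"
      "integrable unif (\<lambda>z. z ^ k)" by (rule unif_has_integral[OF _ hi])+
  qed
  show "integrable unif (\<lambda>z. z ^ k)" by (rule m)
  show "(\<integral>z. z \<partial>unif) = 0" using m(1)[of 1] by simp
  show "(\<integral>z. z\<^sup>2 \<partial>unif) = 1 / 3" using m(1)[of 2] by simp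
  show "(\<integral>z. z ^ 3 \<partial>unif) = 0" using m(1)[of 3] by simp
  show "(\<integral>z. z ^ 4 \<partial>unif) = 1 / 5" using m(1)[of 4] by simp
qed

lemma N01_moments:
  "(\<integral>z. z \<partial>N01) = 0" "(\<integral>z. z\<^sup>2 \<partial>N01) = 1"
  "(\<integral>z. z ^ 3 \<partial>N01) = 0" "(\<integral>z. z ^ 4 \<partial>N01) = 3"
  using integral_std_normal_distribution_moment_odd[of 1] integral_std_normal_distribution_moment_odd[of 3]
    std_normal_distribution_even_moments(1)[of 1] std_normal_distribution_even_moments(1)[of 2]
  by (simp_all add: fact_numeral)

text \<open>The uniform law and the normal law of variance 1/3 agree in their first three moments.
  The fourth moments contribute 1/5 and 3/9, together less than 1.\<close>

lemma lindeberg_step: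
  assumes h: "taylor4 M h"
  shows "\<bar>(\<integral>s. h (x + \<tau> * s) \<partial>unif) - (\<integral>z. h (x + \<tau> / sqrt 3 * z) \<partial>N01)\<bar> \<le> M * \<tau> ^ 4"
proof -
  obtain h1 h2 h3 where b: "bddC 0 h"
    and T: "\<And>x y. \<bar>h (x + y) - (h x + h1 x * y + h2 x * y\<^sup>2 / 2 + h3 x * y ^ 3 / 6)\<bar> \<le> M * y ^ 4"
    using h unfolding taylor4_def by blast
  have "\<bar>(\<integral>s. h (x + \<tau> * s) \<partial>unif) - (h x + h2 x * (\<tau>\<^sup>2 * (1/3)) / 2)\<bar> \<le> M * \<tau> ^ 4 * (1/5)"
    using taylor4_expectation[OF prob_space_unif sets_unif unif_moments(1,2,4) b T, of x \<tau>]
    by (simp only: unif_moments)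
  moreover have "\<bar>(\<integral>z. h (x + \<tau> / sqrt 3 * z) \<partial>N01) - (h x + h2 x * ((\<tau> / sqrt 3)\<^sup>2 * 1) / 2)\<bar> \<le> M * (\<tau> / sqrt 3) ^ 4 * 3"
    using taylor4_expectation[OF prob_space_N01 _ integrable_std_normal_distribution_moment N01_moments(1,3) b T, of x "\<tau> / sqrt 3"]
    by (simp add: N01_moments)
  moreover have e1: "(\<tau> / sqrt 3)\<^sup>2 * 1 = \<tau>\<^sup>2 * (1/3)" by (simp add: power_divide)
  moreover have e2: "M * (\<tau> / sqrt 3) ^ 4 * 3 = M * \<tau> ^ 4 * (1/3)"
  proof -
    have "sqrt 3 ^ 4 = (9::real)" using power_mult[of "sqrt 3" 2 2] by simp
    then show ?thesis by (simp add: power_divide)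
  qed
  moreover have "0 \<le> M * \<tau> ^ 4" using T[of 0 \<tau>] by linarith
  ultimately show ?thesis unfolding e1 e2 by linarith
qed

section \<open>Sums of independent normal variables\<close>

lemma N01_scale:
  assumes a: "a > 0"
  shows "distr N01 borel (\<lambda>z. a * z) = density lborel (normal_density 0 a)"
proof (rule measure_eqI)
  fix A assume "A \<in> sets (distr N01 borel (\<lambda>z. a * z))"
  then have [measurable]: "A \<in> sets borel" by simp
  have "emeasure (density lborel (normal_density 0 a)) A = (\<integral>\<^sup>+w. ennreal (normal_density 0 a w) * indicator A w \<partial>lborel)"
    by (rule emeasure_density) measurable
  also have "\<dots> = ennreal \<bar>a\<bar> * (\<integral>\<^sup>+z. ennreal (normal_density 0 a (0 + a * z)) * indicator A (0 + a * z) \<partial>lborel)"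
    by (rule nn_integral_real_affine) (use a in auto)
  also have "\<dots> = (\<integral>\<^sup>+z. ennreal \<bar>a\<bar> * (ennreal (normal_density 0 a (0 + a * z)) * indicator A (0 + a * z)) \<partial>lborel)"
    by (rule nn_integral_cmult[symmetric]) measurable
  also have "\<dots> = (\<integral>\<^sup>+z. ennreal (\<phi> z) * indicator A (a * z) \<partial>lborel)"
  proof (rule nn_integral_cong)
    fix z
    have "\<bar>a\<bar> * normal_density 0 a (a * z) = \<phi> z"
      using a by (simp add: normal_density_def std_normal_density_def real_sqrt_mult power_mult_distrib)
    then have "ennreal \<bar>a\<bar> * ennreal (normal_density 0 a (a * z)) = ennreal (\<phi> z)"
      by (simp only: ennreal_mult[symmetric] abs_ge_zero normal_density_nonneg)
    then show "ennreal \<bar>a\<bar> * (ennreal (normal_density 0 a (0 + a * z)) * indicator A (0 + a * z)) =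
        ennreal (\<phi> z) * indicator A (a * z)"
      by (simp only: mult.assoc[symmetric] add_0_left)
  qed
  also have "\<dots> = (\<integral>\<^sup>+z. ennreal (\<phi> z) * indicator ((\<lambda>z. a * z) -` A) z \<partial>lborel)"
    by (simp add: indicator_def)
  also have "\<dots> = emeasure N01 ((\<lambda>z. a * z) -` A)"
    by (rule emeasure_density[symmetric])
       (use measurable_sets[of "\<lambda>z. a * z" borel borel A] in simp_all)
  also have "\<dots> = emeasure (distr N01 borel (\<lambda>z. a * z)) A"
    using emeasure_distr[of "\<lambda>z. a * z" N01 borel A] by simp
  finally show "emeasure (distr N01 borel (\<lambda>z. a * z)) A = emeasure (density lborel (normal_density 0 a)) A" by simp
qed simp

text \<open>The law of a sum of independent normals is the convolution of their densities, again
  normal with added variances. The case \<open>a = 0\<close> is separate because it has no density;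
  it occurs when the set of variables already replaced is empty.\<close>

lemma average_average:
  assumes h: "bddC 0 h" and ab: "a \<ge> 0" "b > 0"
  shows "(\<integral>z. (\<integral>w. h (x + a * z + b * w) \<partial>N01) \<partial>N01) = (\<integral>z. h (x + sqrt (a\<^sup>2 + b\<^sup>2) * z) \<partial>N01)"
proof (cases "a = 0")
  case True
  have "sqrt (a\<^sup>2 + b\<^sup>2) = b" using True ab by simp
  then show ?thesis using True by simp
next
  case False
  then have a: "a > 0" using ab by simp
  have [measurable]: "h \<in> borel_measurable borel" using h by simp
  define Na where "Na = density lborel (normal_density 0 a)"
  define Nb where "Nb = density lborel (normal_density 0 b)"
  define c where "c = sqrt (a\<^sup>2 + b\<^sup>2)"
  have c: "c > 0" using a by (simp add: c_def add_pos_nonneg)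
  have [measurable_cong]: "sets Na = sets borel" "sets Nb = sets borel" by (simp_all add: Na_def Nb_def)
  have ps: "prob_space Na" "prob_space Nb" unfolding Na_def Nb_def
    using a ab by (auto intro: prob_space_normal_density)
  interpret Na: prob_space Na by fact
  interpret Nb: prob_space Nb by fact
  interpret P: pair_prob_space Na Nb ..
  have "(\<integral>z. (\<integral>w. h (x + a * z + b * w) \<partial>N01) \<partial>N01) = (\<integral>z. (\<integral>w. h (x + a * z + w) \<partial>Nb) \<partial>N01)"
    unfolding Nb_def N01_scale[OF ab(2), symmetric] by (simp add: integral_distr)
  also have "\<dots> = (\<integral>z. (\<integral>w. h (x + z + w) \<partial>Nb) \<partial>Na)"
    unfolding Na_def N01_scale[OF a, symmetric] by (subst integral_distr) auto
  also have "\<dots> = (\<integral>p. h (x + fst p + snd p) \<partial>(Na \<Otimes>\<^sub>M Nb))"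
  proof -
    have "integrable (Na \<Otimes>\<^sub>M Nb) (\<lambda>p. h (x + fst p + snd p))"
      by (rule bddC_0_integrable[OF h P.prob_space_axioms]) measurable
    from P.integral_fst'[OF this] show ?thesis by simp
  qed
  also have "\<dots> = (\<integral>t. h (x + t) \<partial>(Na \<star> Nb))"
    unfolding convolution_def by (subst integral_distr) (measurable, simp add: split_beta' add.assoc)
  also have "Na \<star> Nb = density lborel (\<lambda>x. \<integral>\<^sup>+y. ennreal (normal_density 0 a (x - y)) * ennreal (normal_density 0 b y) \<partial>lborel)"
    unfolding Na_def Nb_def
    by (rule convolution_density) (use ps in \<open>auto simp: Na_def Nb_def intro: prob_space.finite_measure\<close>)
  also have "\<dots> = density lborel (normal_density 0 c)"
    using conv_normal_density_zero_mean[OF a ab(2)] by (simp add: c_def ennreal_mult[symmetric] fun_eq_iff)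
  also have "(\<integral>t. h (x + t) \<partial>density lborel (normal_density 0 c)) = (\<integral>z. h (x + c * z) \<partial>N01)"
    unfolding N01_scale[OF c, symmetric] by (subst integral_distr) auto
  finally show ?thesis by (simp add: c_def)
qed

section \<open>Replacement on the product space of latent variables\<close>

abbreviation "PU I \<equiv> PiM I (\<lambda>_::nat. unif)"

lemma prob_space_PU: "prob_space (PU I)"
proof -
  interpret product_prob_space "\<lambda>_::nat. unif" by (rule product_prob_space_unif)
  show ?thesis by (rule prob_space_axioms)
qed

lemma sum_measurable_PU:
  fixes f :: "real \<Rightarrow> real"
  assumes "f \<in> borel_measurable borel"
  shows "(\<lambda>s. \<Sum>v\<in>I. f (s v)) \<in> borel_measurable (PU I)"
  using assms by (intro borel_measurable_sum) (auto intro: measurable_compose[OF measurable_component_singleton])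

lemma PU_insert:
  fixes f :: "(nat \<Rightarrow> real) \<Rightarrow> real"
  assumes "finite I" "i \<notin> I" "integrable (PU (insert i I)) f"
  shows "(\<integral>s. f s \<partial>PU (insert i I)) = (\<integral>s. (\<integral>y. f (s(i := y)) \<partial>unif) \<partial>PU I)"
proof -
  interpret product_prob_space "\<lambda>_::nat. unif" by (rule product_prob_space_unif)
  show ?thesis by (rule product_integral_insert[OF assms])
qed

text \<open>Induction with \<open>h\<close> general: one coordinate is exchanged for a normal
  variable, and the Gaussian average of \<open>h\<close> becomes the test function for the remaining
  ones; \<open>average_average\<close> then merges the two normals. With
  \<open>\<tau> = 1 / sqrt n\<close> the \<open>n\<close> errors of order \<open>\<tau> ^ 4\<close>
  total \<open>M / n\<close>.\<close>

lemma lindeberg: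
  fixes \<tau> x M :: real
  assumes "finite I" "taylor4 M h" "\<tau> > 0"
  shows "\<bar>(\<integral>s. h (x + \<tau> * (\<Sum>v\<in>I. s v)) \<partial>PU I) - (\<integral>z. h (x + \<tau> * sqrt (card I / 3) * z) \<partial>N01)\<bar> \<le> card I * (M * \<tau> ^ 4)"
  using assms(1,2)
proof (induction I arbitrary: h rule: finite_induct)
  case empty
  interpret N: prob_space N01 by (rule prob_space_N01)
  interpret U: prob_space "PU {}" by (rule prob_space_PU)
  show ?case by (simp add: N.prob_space U.prob_space)
next
  case (insert i I)
  interpret U: prob_space "PU I" by (rule prob_space_PU)
  have b: "bddC 0 h" using insert.prems by (simp add: taylor4_def)
  let ?h' = "\<lambda>x. \<integral>z. h (x + \<tau> / sqrt 3 * z) \<partial>N01"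
  let ?g = "\<lambda>x. \<integral>y. h (x + \<tau> * y) \<partial>unif"
  have h': "taylor4 M ?h'" by (rule taylor4_average[OF insert.prems])
  have b': "bddC 0 ?h'" using h' by (simp add: taylor4_def)
  have [measurable]: "h \<in> borel_measurable borel" using b by simp
  interpret unif: prob_space unif by (rule prob_space_unif)
  have le: "\<bar>?g x - ?h' x\<bar> \<le> M * \<tau> ^ 4" for x by (rule lindeberg_step[OF insert.prems])
  have bg: "bddC 0 ?g"
  proof -
    obtain B where B: "\<And>x. \<bar>?h' x\<bar> \<le> B" using b' by auto
    have "\<bar>?g x\<bar> \<le> B + M * \<tau> ^ 4" for x using B[of x] le[of x] by linarith
    moreover have "?g \<in> borel_measurable borel" by measurable
    ultimately show ?thesis by auto
  qed
  have sm: "(\<lambda>s. x + \<tau> * (\<Sum>v\<in>J. s v)) \<in> borel_measurable (PU J)" for J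
    using sum_measurable_PU[of "\<lambda>x. x" J] by auto
  have "(\<integral>s. h (x + \<tau> * (\<Sum>v\<in>insert i I. s v)) \<partial>PU (insert i I)) =
      (\<integral>s. (\<integral>y. h (x + \<tau> * (\<Sum>v\<in>insert i I. (s(i := y)) v)) \<partial>unif) \<partial>PU I)"
    using insert.hyps by (intro PU_insert bddC_0_integrable[OF b prob_space_PU] sm)
  also have "\<dots> = (\<integral>s. ?g (x + \<tau> * (\<Sum>v\<in>I. s v)) \<partial>PU I)"
  proof -
    have "(\<Sum>v\<in>I. (s(i := y)) v) = (\<Sum>v\<in>I. s v)" for s and y :: real
      using insert.hyps by (intro sum.cong) auto
    then have "x + \<tau> * (\<Sum>v\<in>insert i I. (s(i := y)) v) = x + \<tau> * (\<Sum>v\<in>I. s v) + \<tau> * y" for s and y :: real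
      using insert.hyps by (simp add: distrib_left)
    then show ?thesis by (simp only:)
  qed
  finally have eq: "(\<integral>s. h (x + \<tau> * (\<Sum>v\<in>insert i I. s v)) \<partial>PU (insert i I)) = (\<integral>s. ?g (x + \<tau> * (\<Sum>v\<in>I. s v)) \<partial>PU I)" .
  have ig: "integrable (PU I) (\<lambda>s. ?g (x + \<tau> * (\<Sum>v\<in>I. s v)))"
    by (rule bddC_0_integrable[OF bg prob_space_PU sm])
  have ih: "integrable (PU I) (\<lambda>s. ?h' (x + \<tau> * (\<Sum>v\<in>I. s v)))"
    by (rule bddC_0_integrable[OF b' prob_space_PU sm])
  have "\<bar>(\<integral>s. ?g (x + \<tau> * (\<Sum>v\<in>I. s v)) \<partial>PU I) - (\<integral>s. ?h' (x + \<tau> * (\<Sum>v\<in>I. s v)) \<partial>PU I)\<bar> \<le> M * \<tau> ^ 4"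
  proof -
    have "(\<integral>s. ?g (x + \<tau> * (\<Sum>v\<in>I. s v)) \<partial>PU I) - (\<integral>s. ?h' (x + \<tau> * (\<Sum>v\<in>I. s v)) \<partial>PU I) =
      (\<integral>s. ?g (x + \<tau> * (\<Sum>v\<in>I. s v)) - ?h' (x + \<tau> * (\<Sum>v\<in>I. s v)) \<partial>PU I)"
      by (rule Bochner_Integration.integral_diff[OF ig ih, symmetric])
    also have "\<bar>\<dots>\<bar> \<le> M * \<tau> ^ 4"
      by (rule abs_expectation_le[OF prob_space_PU Bochner_Integration.integrable_diff[OF ig ih] le])
    finally show ?thesis .
  qed
  note B = this
  have C: "\<bar>(\<integral>s. ?h' (x + \<tau> * (\<Sum>v\<in>I. s v)) \<partial>PU I) - (\<integral>z. ?h' (x + \<tau> * sqrt (card I / 3) * z) \<partial>N01)\<bar> \<le> card I * (M * \<tau> ^ 4)"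
    by (rule insert.IH[OF h'])
  have D: "(\<integral>z. ?h' (x + \<tau> * sqrt (card I / 3) * z) \<partial>N01) = (\<integral>z. h (x + \<tau> * sqrt (card (insert i I) / 3) * z) \<partial>N01)"
  proof -
    have "(\<integral>z. ?h' (x + \<tau> * sqrt (card I / 3) * z) \<partial>N01) = (\<integral>z. h (x + sqrt ((\<tau> * sqrt (card I / 3))\<^sup>2 + (\<tau> / sqrt 3)\<^sup>2) * z) \<partial>N01)"
      using assms(3) by (intro average_average[OF b]) auto
    also have "sqrt ((\<tau> * sqrt (card I / 3))\<^sup>2 + (\<tau> / sqrt 3)\<^sup>2) = \<tau> * sqrt (card (insert i I) / 3)"
    proof -
      have E: "(\<tau> * sqrt (card I / 3))\<^sup>2 + (\<tau> / sqrt 3)\<^sup>2 = \<tau>\<^sup>2 * (card (insert i I) / 3)"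
        using insert.hyps by (simp add: power_mult_distrib power_divide field_simps)
      show ?thesis unfolding E using assms(3) by (simp only: real_sqrt_mult real_sqrt_abs abs_of_pos)
    qed
    finally show ?thesis .
  qed
  have F: "real (card (insert i I)) * (M * \<tau> ^ 4) = card I * (M * \<tau> ^ 4) + M * \<tau> ^ 4"
    using insert.hyps by (simp add: distrib_right)
  have tri: "\<bar>p - r\<bar> \<le> d + c" if "\<bar>p - q\<bar> \<le> c" "\<bar>q - r\<bar> \<le> d" for p q r c d :: real
    using that by linarith
  show ?case unfolding eq F by (rule tri[OF B C[unfolded D]])
qed

section \<open>Expansion of the conditional winning probability\<close>

text \<open>The error for \<open>Suc d\<close> is \<open>p\<close> times the error for
  \<open>d\<close> plus \<open>d * q ^ (d - 1) * (p - q)^2\<close>, and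
  \<open>d^2 + d \<le> (d + 1)^2\<close> closes the induction.\<close>

lemma power_linearization:
  fixes p q :: real
  assumes pq: "0 \<le> p" "p \<le> 1" "0 \<le> q" "q \<le> 1"
  shows "\<bar>p ^ d - q ^ d - real d * q ^ (d - 1) * (p - q)\<bar> \<le> (real d)\<^sup>2 * (p - q)\<^sup>2"
proof (induction d)
  case (Suc d)
  let ?e = "p ^ d - q ^ d - real d * q ^ (d - 1) * (p - q)"
  have qd: "real d * q ^ (d - 1) * q = real d * q ^ d" by (cases d) auto
  have "p ^ Suc d - q ^ Suc d - real (Suc d) * q ^ (Suc d - 1) * (p - q) = p * ?e + real d * q ^ (d - 1) * (p - q)\<^sup>2"
  proof -
    have "p * ?e + real d * q ^ (d - 1) * (p - q)\<^sup>2 = p * p ^ d - p * q ^ d - (real d * q ^ (d - 1) * q) * (p - q)"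
      by (simp add: power2_eq_square algebra_simps)
    then show ?thesis unfolding qd by (simp add: algebra_simps)
  qed
  moreover have "\<bar>p * ?e\<bar> \<le> (real d)\<^sup>2 * (p - q)\<^sup>2"
    unfolding abs_mult using mult_mono[OF _ Suc.IH, of "\<bar>p\<bar>" 1] pq by simp
  moreover have "\<bar>real d * q ^ (d - 1) * (p - q)\<^sup>2\<bar> \<le> real d * (p - q)\<^sup>2"
  proof -
    have "real d * q ^ (d - 1) \<le> real d * 1" using pq by (intro mult_left_mono power_le_one) auto
    then have "real d * q ^ (d - 1) * (p - q)\<^sup>2 \<le> real d * (p - q)\<^sup>2" by (intro mult_right_mono) auto
    then show ?thesis using pq by (simp add: abs_mult)
  qed
  moreover have "(real d)\<^sup>2 * (p - q)\<^sup>2 + real d * (p - q)\<^sup>2 \<le> (real (Suc d))\<^sup>2 * (p - q)\<^sup>2"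
    unfolding distrib_right[symmetric] by (rule mult_right_mono) (simp add: power2_eq_square algebra_simps, simp)
  ultimately show ?case by linarith
qed simp

lemma win_bounds:
  assumes "\<And>v. v < n \<Longrightarrow> \<bar>s v\<bar> \<le> 1"
  shows "0 \<le> win n s" "win n s \<le> 1"
proof -
  define w where "w D = (\<Prod>v<n. vweight s D v)" for D
  have "\<bar>s v\<bar> \<le> 1" if "v < n" for v using assms that by blast
  then have "0 \<le> (vweight s D v)" if "v < n" for v and D :: "nat set"
    using that by (auto simp: abs_le_iff) (smt (verit))+
  then have w0: "0 \<le> w D" for D unfolding w_def by (intro prod_nonneg) auto
  have "cf n s 0 = 1" unfolding cf_def by (intro prod.neutral) (simp add: complex_eq_iff)
  then have "(\<Sum>D\<in>Pow {..<n}. complex_of_real (w D)) = 1" by (simp add: cf_expansion w_def)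
  then have "complex_of_real (\<Sum>D\<in>Pow {..<n}. w D) = of_real 1" by simp
  then have tot: "(\<Sum>D\<in>Pow {..<n}. w D) = 1" by (simp only: of_real_eq_iff)
  have win: "win n s = (\<Sum>D\<in>{D \<in> Pow {..<n}. n < 2 * card D}. w D)" by (simp add: win_def w_def)
  show "0 \<le> win n s" unfolding win using w0 by (intro sum_nonneg) auto
  have "win n s \<le> (\<Sum>D\<in>Pow {..<n}. w D)" unfolding win using w0 by (intro sum_mono2) auto
  then show "win n s \<le> 1" using tot by simp
qed

text \<open>The inverse of the conditional standard deviation per voter, with the variance replaced
  by its mean 2/3.\<close>

definition c0 :: real where "c0 = 1 / sqrt (2/3)"

text \<open>The derivative of \<open>Phi (y / sqrt v)\<close> with respect to \<open>v\<close> at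
  \<open>v = 2/3\<close>; the factor 3/4 is \<open>1 / (2 * v)\<close>.\<close>

definition gcorr :: "real \<Rightarrow> real" where
  "gcorr y = - (3/4) * ((c0 * y) * \<phi> (c0 * y))"

lemma bddC_gcorr: "bddC k gcorr"
proof -
  have "bddC k (\<lambda>y. (c0 * y) ^ 1 * \<phi> (c0 * y))"
    using bddC_scale[OF bddC_power_gauss[of k 1], of c0] .
  then have "bddC k (\<lambda>y. - (3/4) * ((c0 * y) ^ 1 * \<phi> (c0 * y)))"
    by (rule bddC_mult[OF bddC_const])
  then show ?thesis by (simp only: gcorr_def[abs_def] power_one_right)
qed

lemma DERIV_std_normal_density:
  "(\<phi> has_real_derivative - x * \<phi> x) (at x within S)"
proof -
  have "((\<lambda>x. exp (- x\<^sup>2 / 2)) has_real_derivative - x * exp (- x\<^sup>2 / 2)) (at x within S)"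
    by (auto intro!: derivative_eq_intros)
  from DERIV_cmult[OF this, of "1 / sqrt (2 * pi)"] show ?thesis
    unfolding std_normal_density_def[abs_def] by (simp add: mult_ac)
qed

text \<open>In terms of \<open>z = y / sqrt t\<close> the second derivative in \<open>t\<close> is a
  combination of \<open>z * \<phi> z\<close> and \<open>z ^ 3 * \<phi> z\<close> over
  \<open>4 * t^2\<close>. The numerators are bounded on the whole line, which gives uniformity in
  \<open>y\<close>, and \<open>t \<ge> 1/3\<close> bounds the denominator from below.\<close>

lemma Phi_variance_taylor:
  obtains C where "C \<ge> 0"
    "\<And>y v. v \<ge> 1/3 \<Longrightarrow> \<bar>Phi (y / sqrt v) - Phi (c0 * y) - gcorr y * (v - 2/3)\<bar> \<le> C * (v - 2/3)\<^sup>2"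
proof -
  obtain B1 B3 where B1: "\<And>z. \<bar>z ^ 1 * \<phi> z\<bar> \<le> B1" and B3: "\<And>z. \<bar>z ^ 3 * \<phi> z\<bar> \<le> B3"
    using bddC_power_gauss[of 0 1] bddC_power_gauss[of 0 3] by auto
  \<comment> \<open>9/4 is the value of \<open>1 / (4 * t^2)\<close> at the left end
    \<open>t = 1/3\<close>.\<close>
  define C where "C = (3 * B1 + B3) * (9/4)"
  have B0: "B1 \<ge> 0" "B3 \<ge> 0" using B1[of 0] B3[of 0] by linarith+
  have "\<bar>Phi (y / sqrt v) - Phi (c0 * y) - gcorr y * (v - 2/3)\<bar> \<le> C * (v - 2/3)\<^sup>2" if v: "v \<ge> 1/3" for y v
  proof -
    define z where "z t = y / sqrt t" for t
    define f where "f i t = (if i = 0 then Phi (z t) else if i = 1 then - (z t * \<phi> (z t)) / (2 * t)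
        else (3 * (z t * \<phi> (z t)) - z t ^ 3 * \<phi> (z t)) / (4 * t\<^sup>2))" for i :: nat and t
    have dz: "(z has_real_derivative - z t / (2 * t)) (at t within {1/3..})" if "t \<in> {1/3..}" for t
    proof -
      have t: "t > 0" using that by auto
      have "((\<lambda>t. y / sqrt t) has_real_derivative - (y * (inverse (sqrt t) / 2)) / (sqrt t * sqrt t)) (at t within {1/3..})"
        using t by (auto intro!: derivative_eq_intros)
      moreover have "- (y * (inverse (sqrt t) / 2)) / (sqrt t * sqrt t) = - z t / (2 * t)"
        using t by (simp add: z_def field_simps)
      ultimately show ?thesis by (simp only: z_def[abs_def])
    qed
    have df: "(f i has_field_derivative f (Suc i) t) (at t within {1/3..})" if t: "t \<in> {1/3..}" and i: "i \<le> 1" for i t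
    proof -
      have tp: "t > 0" using t by auto
      consider "i = 0" | "i = 1" using i by linarith
      then show ?thesis
      proof cases
        case 1
        have "((\<lambda>t. Phi (z t)) has_real_derivative \<phi> (z t) * (- z t / (2 * t))) (at t within {1/3..})"
          by (rule DERIV_chain2[OF DERIV_Phi dz[OF t]])
        then show ?thesis by (simp add: 1 f_def[abs_def] mult.commute)
      next
        case 2
        have d1: "((\<lambda>t. \<phi> (z t)) has_real_derivative - z t * \<phi> (z t) * (- z t / (2 * t))) (at t within {1/3..})"
          by (rule DERIV_chain2[OF DERIV_std_normal_density dz[OF t]])
        have d2: "((\<lambda>t. z t * \<phi> (z t)) has_real_derivative
            (- z t / (2 * t)) * \<phi> (z t) + - z t * \<phi> (z t) * (- z t / (2 * t)) * z t) (at t within {1/3..})"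
          by (rule DERIV_mult[OF dz[OF t] d1])
        have d3: "((\<lambda>t. 2 * t) has_real_derivative 2) (at t within {1/3..})" by (auto intro!: derivative_eq_intros)
        have "((\<lambda>t. - (z t * \<phi> (z t)) / (2 * t)) has_real_derivative
           (- ((- z t / (2 * t)) * \<phi> (z t) + - z t * \<phi> (z t) * (- z t / (2 * t)) * z t) * (2 * t)
             - - (z t * \<phi> (z t)) * 2) / (2 * t * (2 * t))) (at t within {1/3..})"
          using DERIV_divide[OF DERIV_minus[OF d2] d3] tp by simp
        moreover have "(- ((- z t / (2 * t)) * \<phi> (z t) + - z t * \<phi> (z t) * (- z t / (2 * t)) * z t) * (2 * t)
             - - (z t * \<phi> (z t)) * 2) / (2 * t * (2 * t)) =
           (3 * (z t * \<phi> (z t)) - z t ^ 3 * \<phi> (z t)) / (4 * t\<^sup>2)"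
          using tp by (simp add: field_simps power2_eq_square power3_eq_cube)
        ultimately show ?thesis by (simp add: 2 f_def[abs_def])
      qed
    qed
    have bound: "norm (f (Suc 1) t) \<le> C" if "t \<in> {1/3..}" for t
    proof -
      have "(1/3)\<^sup>2 \<le> t\<^sup>2" using that by (intro power_mono) auto
      then have t2: "4/9 \<le> 4 * t\<^sup>2" by (simp add: power2_eq_square)
      have "\<bar>3 * (z t * \<phi> (z t)) - z t ^ 3 * \<phi> (z t)\<bar> \<le> 3 * B1 + B3"
        using B1[of "z t"] B3[of "z t"] by (simp add: abs_le_iff)
      then have "\<bar>3 * (z t * \<phi> (z t)) - z t ^ 3 * \<phi> (z t)\<bar> / (4 * t\<^sup>2) \<le> (3 * B1 + B3) / (4/9)"
        using t2 by (intro frac_le) auto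
      then show ?thesis by (simp add: f_def C_def abs_divide)
    qed
    have "norm (f 0 v - (\<Sum>i\<le>1. f i (2/3) * (v - 2/3) ^ i / fact i)) \<le> C * norm (v - 2/3) ^ Suc 1 / fact 1"
      by (rule field_Taylor[OF convex_real_interval(1) df bound]) (use v in auto)
    moreover have "f 0 v = Phi (y / sqrt v)" "f 0 (2/3) = Phi (c0 * y)" "f 1 (2/3) = gcorr y"
      by (simp_all add: f_def z_def gcorr_def c0_def)
    ultimately show ?thesis by (simp add: power2_eq_square algebra_simps)
  qed
  moreover have "C \<ge> 0" using B0 by (simp add: C_def)
  ultimately show thesis by (rule that[rotated])
qed

text \<open>The linear term in the variance fluctuation \<open>\<delta>\<close> must be kept: its
  typical size is \<open>1 / sqrt n\<close>, and it becomes negligible only through cancellation in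
  the mean. The remaining terms are quadratic in \<open>\<delta>\<close> or already of order
  \<open>1 / n\<close> up to skewness.\<close>

lemma win_power_expansion:
  obtains C where "C \<ge> 0"
    "\<And>n s. n > 0 \<Longrightarrow> (\<And>v. v < n \<Longrightarrow> \<bar>s v\<bar> \<le> 1) \<Longrightarrow>
      \<bar>win n s ^ d - Phi (c0 * (((\<Sum>v<n. s v) - parity_shift n) / sqrt n)) ^ d
        - real d * Phi (c0 * (((\<Sum>v<n. s v) - parity_shift n) / sqrt n)) ^ (d - 1)
           * gcorr (((\<Sum>v<n. s v) - parity_shift n) / sqrt n) * ((\<Sum>v<n. 1 / 3 - (s v)\<^sup>2) / n)\<bar>
       \<le> C * ((1 + \<bar>condskew n s\<bar> / sqrt n) / n + ((\<Sum>v<n. 1 / 3 - (s v)\<^sup>2) / n)\<^sup>2)"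
proof -
  obtain C1 where C1: "C1 \<ge> 0"
    "\<And>n s. n > 0 \<Longrightarrow> (\<And>v. v < n \<Longrightarrow> \<bar>s v\<bar> \<le> 1) \<Longrightarrow> real n / 3 \<le> condvar n s \<Longrightarrow>
      \<bar>win n s - Phi (((\<Sum>v<n. s v) - parity_shift n) / sqrt n / sqrt (condvar n s / n))\<bar>
       \<le> C1 * (1 + \<bar>condskew n s\<bar> / sqrt n) / n"
    using win_Phi_approx by blast
  obtain C2 where C2: "C2 \<ge> 0"
    "\<And>y v. v \<ge> 1/3 \<Longrightarrow> \<bar>Phi (y / sqrt v) - Phi (c0 * y) - gcorr y * (v - 2/3)\<bar> \<le> C2 * (v - 2/3)\<^sup>2"
    using Phi_variance_taylor by blast
  obtain B where B: "\<And>y. \<bar>gcorr y\<bar> \<le> B" using bddC_gcorr[of 0] by auto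
  have B0: "B \<ge> 0" using B[of 0] by linarith
  define D where "D = real d"
  have D0: "D \<ge> 0" by (simp add: D_def)
  define C3 where "C3 = D\<^sup>2 * (2 * B\<^sup>2 + 2 * (1 + B) * (C1 + C2)) + D * (C1 + C2)"
  define C4 where "C4 = 9 * (2 + D * B)"
  have C34: "C3 \<ge> 0" "C4 \<ge> 0" using C1(1) C2(1) B0 D0 by (simp_all add: C3_def C4_def)
  show thesis
  proof (rule that[of "C3 + C4"])
    show "C3 + C4 \<ge> 0" using C34 by simp
    fix n :: nat and s :: "nat \<Rightarrow> real"
    assume n: "n > 0" and s: "\<And>v. v < n \<Longrightarrow> \<bar>s v\<bar> \<le> 1"
    define \<kappa> where "\<kappa> = \<bar>condskew n s\<bar> / sqrt n"
    define y where "y = ((\<Sum>v<n. s v) - parity_shift n) / sqrt n"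
    define \<delta> where "\<delta> = (\<Sum>v<n. 1 / 3 - (s v)\<^sup>2) / n"
    define p where "p = win n s"
    define q where "q = Phi (c0 * y)"
    define a where "a = gcorr y * \<delta>"
    define E where "E = (1 + \<kappa>) / n"
    have p: "0 \<le> p" "p \<le> 1" unfolding p_def using win_bounds[of n s, OF s] by auto
    have q: "0 \<le> q" "q \<le> 1" unfolding q_def by (rule Phi_bounds)+
    have \<kappa>0: "\<kappa> \<ge> 0" by (simp add: \<kappa>_def)
    have E0: "E \<ge> 0" using \<kappa>0 by (simp add: E_def)
    have V\<delta>: "condvar n s / n - 2/3 = \<delta>"
    proof -
      have "(\<Sum>v<n. 1 / 3 - (s v)\<^sup>2) = (\<Sum>v<n. (1 - (s v)\<^sup>2) - 2/3)" by (intro sum.cong) auto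
      also have "\<dots> = condvar n s - 2/3 * n" by (simp add: sum_subtractf)
      finally show ?thesis using n by (simp add: \<delta>_def diff_divide_distrib)
    qed
    have V0: "0 \<le> condvar n s" "condvar n s \<le> n"
    proof -
      have "0 \<le> 1 - (s v)\<^sup>2" if "v < n" for v using s[OF that] by (simp add: abs_square_le_1)
      then show "0 \<le> condvar n s" by (intro sum_nonneg) auto
      have "condvar n s \<le> (\<Sum>v<n. 1)" by (intro sum_mono) auto
      then show "condvar n s \<le> n" by simp
    qed
    have "0 \<le> condvar n s / n" "condvar n s / n \<le> 1" using V0 n by (simp_all add: divide_le_eq)
    then have \<delta>1: "\<bar>\<delta>\<bar> \<le> 1" using V\<delta> by linarith
    have a1: "\<bar>a\<bar> \<le> B * \<bar>\<delta>\<bar>" unfolding a_def abs_mult using B by (intro mult_right_mono) auto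
    also have "\<dots> \<le> B" using \<delta>1 B0 by (simp add: mult_left_le)
    finally have aB: "\<bar>a\<bar> \<le> B" .
    have qd: "0 \<le> D * q ^ (d - 1)" "D * q ^ (d - 1) \<le> D" using q D0 by (auto intro!: mult_left_le power_le_one)
    have goal: "\<bar>p ^ d - q ^ d - D * q ^ (d - 1) * a\<bar> \<le> (C3 + C4) * (E + \<delta>\<^sup>2)"
    proof (cases "real n / 3 \<le> condvar n s")
      case True
      define R where "R = (C1 + C2) * (E + \<delta>\<^sup>2)"
      have "condvar n s / n \<ge> 1/3" using True n by (simp add: field_simps)
      from C2(2)[OF this, of y] have "\<bar>Phi (y / sqrt (condvar n s / n)) - q - a\<bar> \<le> C2 * \<delta>\<^sup>2"
        unfolding V\<delta> q_def a_def .
      moreover have "\<bar>p - Phi (y / sqrt (condvar n s / n))\<bar> \<le> C1 * E"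
        using C1(2)[OF n s True] by (simp add: p_def y_def E_def \<kappa>_def)
      moreover have "C1 * E + C2 * \<delta>\<^sup>2 \<le> R"
        using C1(1) C2(1) E0 by (simp add: R_def algebra_simps)
      ultimately have r: "\<bar>p - q - a\<bar> \<le> R" by linarith
      have R0: "R \<ge> 0" using r by linarith
      \<comment> \<open>The residual is both bounded by \<open>1 + B\<close> and small by
        \<open>R\<close>; multiplying the two bounds estimates its square linearly in
        \<open>R\<close>, so no squared skewness terms arise.\<close>
      have "\<bar>p - q - a\<bar> \<le> 1 + B" using p q aB by (simp add: abs_le_iff)
      then have "\<bar>p - q - a\<bar> * \<bar>p - q - a\<bar> \<le> (1 + B) * R" using r B0 by (intro mult_mono) auto
      then have r2: "(p - q - a)\<^sup>2 \<le> (1 + B) * R" by (simp add: power2_eq_square)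
      have "\<bar>a\<bar>\<^sup>2 \<le> (B * \<bar>\<delta>\<bar>)\<^sup>2" using a1 by (rule power_mono) simp
      then have a2: "a\<^sup>2 \<le> B\<^sup>2 * \<delta>\<^sup>2" by (simp add: power_mult_distrib)
      have "(p - q)\<^sup>2 \<le> 2 * a\<^sup>2 + 2 * (p - q - a)\<^sup>2"
        using zero_le_power2[of "2 * a - (p - q)"] by (simp add: power2_eq_square algebra_simps)
      then have pq2: "(p - q)\<^sup>2 \<le> 2 * (B\<^sup>2 * \<delta>\<^sup>2) + 2 * ((1 + B) * R)" using a2 r2 by linarith
      have "\<bar>p ^ d - q ^ d - D * q ^ (d - 1) * (p - q)\<bar> \<le> D\<^sup>2 * (p - q)\<^sup>2"
        unfolding D_def by (rule power_linearization[OF p q])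
      moreover have "D\<^sup>2 * (p - q)\<^sup>2 \<le> D\<^sup>2 * (2 * (B\<^sup>2 * \<delta>\<^sup>2) + 2 * ((1 + B) * R))"
        using pq2 by (rule mult_left_mono) simp
      moreover have "\<bar>D * q ^ (d - 1) * (p - q) - D * q ^ (d - 1) * a\<bar> \<le> D * R"
      proof -
        have e: "D * q ^ (d - 1) * (p - q) - D * q ^ (d - 1) * a = (D * q ^ (d - 1)) * (p - q - a)"
          by (simp only: right_diff_distrib)
        show ?thesis unfolding e abs_mult[of "D * q ^ (d - 1)"] abs_of_nonneg[OF qd(1)]
          by (rule mult_mono[OF qd(2) r D0 abs_ge_zero])
      qed
      ultimately have "\<bar>p ^ d - q ^ d - D * q ^ (d - 1) * a\<bar> \<le> D\<^sup>2 * (2 * (B\<^sup>2 * \<delta>\<^sup>2) + 2 * ((1 + B) * R)) + D * R"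
        by linarith
      also have "\<dots> \<le> D\<^sup>2 * (2 * (B\<^sup>2 * (E + \<delta>\<^sup>2)) + 2 * ((1 + B) * R)) + D * R"
        using E0 by (intro add_right_mono mult_left_mono) auto
      also have "\<dots> = C3 * (E + \<delta>\<^sup>2)" unfolding C3_def R_def by algebra
      also have "\<dots> \<le> (C3 + C4) * (E + \<delta>\<^sup>2)" using C34 E0 by (intro mult_right_mono) auto
      finally show ?thesis .
    next
      case False
      then have "condvar n s / n < 1/3" using n by (simp add: field_simps)
      \<comment> \<open>With too little variance no approximation is available, but then
        \<open>1 \<le> 9 * \<delta>^2\<close>, so the trivial bound \<open>2 + D * B\<close> is
        itself a multiple of \<open>\<delta>^2\<close>. This plays the part of Chebyshev's
        inequality.\<close>
      then have "\<delta> < - (1/3)" using V\<delta> by linarith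
      then have "(1/3)\<^sup>2 \<le> (- \<delta>)\<^sup>2" by (intro power_mono) auto
      then have \<delta>2: "1 \<le> 9 * \<delta>\<^sup>2" by (simp add: power2_eq_square)
      have "0 \<le> p ^ d" "p ^ d \<le> 1" "0 \<le> q ^ d" "q ^ d \<le> 1" using p q by (auto intro: power_le_one)
      moreover have "\<bar>D * q ^ (d - 1) * a\<bar> \<le> D * B"
        unfolding abs_mult[of "D * q ^ (d - 1)"] abs_of_nonneg[OF qd(1)]
        by (rule mult_mono[OF qd(2) aB D0 abs_ge_zero])
      ultimately have "\<bar>p ^ d - q ^ d - D * q ^ (d - 1) * a\<bar> \<le> 2 + D * B" by linarith
      also have "\<dots> \<le> (2 + D * B) * (9 * \<delta>\<^sup>2)" using \<delta>2 mult_left_mono[OF \<delta>2, of "2 + D * B"] D0 B0 by simp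
      also have "\<dots> = C4 * \<delta>\<^sup>2" by (simp add: C4_def)
      also have "\<dots> \<le> (C3 + C4) * (E + \<delta>\<^sup>2)" using C34 E0 by (intro mult_mono) auto
      finally show ?thesis .
    qed
    have "D * q ^ (d - 1) * a = real d * Phi (c0 * y) ^ (d - 1) * gcorr y * \<delta>"
      unfolding D_def q_def a_def by (simp only: mult.assoc)
    from goal[unfolded this] show "\<bar>win n s ^ d - Phi (c0 * (((\<Sum>v<n. s v) - parity_shift n) / sqrt n)) ^ d
        - real d * Phi (c0 * (((\<Sum>v<n. s v) - parity_shift n) / sqrt n)) ^ (d - 1)
           * gcorr (((\<Sum>v<n. s v) - parity_shift n) / sqrt n) * ((\<Sum>v<n. 1 / 3 - (s v)\<^sup>2) / n)\<bar>
       \<le> (C3 + C4) * ((1 + \<bar>condskew n s\<bar> / sqrt n) / n + ((\<Sum>v<n. 1 / 3 - (s v)\<^sup>2) / n)\<^sup>2)"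
      unfolding p_def q_def y_def \<delta>_def E_def \<kappa>_def .
  qed
qed

section \<open>Moments of functions of the latent variables\<close>

text \<open>Latent values lie in \<open>[-1, 1]\<close> only almost surely, and polynomials in them
  are unbounded on the line. Clipping makes them bounded everywhere, so that \<open>bddC 0\<close>
  applies, without changing any integral against \<open>unif\<close>.\<close>

definition clip :: "real \<Rightarrow> real" where
  "clip x = max (-1) (min 1 x)"

lemma clip_measurable [measurable]: "clip \<in> borel_measurable borel"
  unfolding clip_def[abs_def] by measurable

lemma clip_id: "\<bar>x\<bar> \<le> 1 \<Longrightarrow> clip x = x"
  by (auto simp: clip_def)

lemma clip_bound: "\<bar>clip x\<bar> \<le> 1"
  by (auto simp: clip_def)

lemma integral_unif_clip:
  fixes f :: "real \<Rightarrow> real"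
  assumes "f \<in> borel_measurable borel"
  shows "(\<integral>x. f (clip x) \<partial>unif) = (\<integral>x. f x \<partial>unif)"
proof (rule integral_cong_AE)
  show "AE x in unif. f (clip x) = f x"
    using AE_unif by eventually_elim (simp add: clip_id)
qed (use assms in \<open>auto intro: measurable_compose[OF clip_measurable]\<close>)

lemma AE_PU:
  assumes "finite I"
  shows "AE s in PU I. \<forall>v\<in>I. \<bar>s v\<bar> \<le> 1"
proof -
  have "countable I" using assms by (rule countable_finite)
  then show ?thesis
    by (intro AE_ball_countable[THEN iffD2] ballI AE_PiM_component[OF prob_space_unif _ AE_unif])
qed

lemma bddC_sum_integrable:
  assumes "bddC 0 f" "finite I"
  shows "integrable (PU I) (\<lambda>s. (\<Sum>v\<in>I. f (s v))\<^sup>2)" "integrable (PU I) (\<lambda>s. \<Sum>v\<in>I. f (s v))"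
proof -
  interpret prob_space "PU I" by (rule prob_space_PU)
  obtain B where B: "\<And>x. \<bar>f x\<bar> \<le> B" and f: "f \<in> borel_measurable borel" using assms by auto
  have b: "\<bar>\<Sum>v\<in>I. f (s v)\<bar> \<le> card I * B" for s
  proof -
    have "\<bar>\<Sum>v\<in>I. f (s v)\<bar> \<le> (\<Sum>v\<in>I. \<bar>f (s v)\<bar>)" by (rule sum_abs)
    also have "\<dots> \<le> (\<Sum>v\<in>I. B)" by (intro sum_mono B)
    finally show ?thesis by simp
  qed
  have b2: "(\<Sum>v\<in>I. f (s v))\<^sup>2 \<le> (card I * B)\<^sup>2" for s
    using power_mono[OF b[of s] abs_ge_zero, of 2] by simp
  have m: "(\<lambda>s. \<Sum>v\<in>I. f (s v)) \<in> borel_measurable (PU I)" by (rule sum_measurable_PU[OF f])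
  show "integrable (PU I) (\<lambda>s. \<Sum>v\<in>I. f (s v))"
    by (rule integrable_const_bound[of _ "card I * B"]) (use b m in auto)
  show "integrable (PU I) (\<lambda>s. (\<Sum>v\<in>I. f (s v))\<^sup>2)"
    by (rule integrable_const_bound[of _ "(card I * B)\<^sup>2"]) (use b2 m in auto)
qed

lemma sum_fun_upd_notin:
  fixes f :: "real \<Rightarrow> real"
  assumes "finite I" "i \<notin> I"
  shows "(\<Sum>v\<in>insert i I. f ((s(i := y)) v)) = f y + (\<Sum>v\<in>I. f (s v))"
proof -
  have "(\<Sum>v\<in>I. f ((s(i := y)) v)) = (\<Sum>v\<in>I. f (s v))"
    using assms by (intro sum.cong) auto
  then show ?thesis using assms by simp
qed

text \<open>Independent centred summands are orthogonal: integrating out the inserted coordinate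
  removes the cross term.\<close>

lemma second_moment_sum:
  assumes f: "bddC 0 f" "(\<integral>x. f x \<partial>unif) = 0" and "finite I"
  shows "(\<integral>s. (\<Sum>v\<in>I. f (s v))\<^sup>2 \<partial>PU I) = card I * (\<integral>x. (f x)\<^sup>2 \<partial>unif)"
  using assms(3)
proof (induction I rule: finite_induct)
  case (insert i I)
  interpret U: prob_space unif by (rule prob_space_unif)
  interpret P: prob_space "PU I" by (rule prob_space_PU)
  have if1: "integrable unif f"
    using bddC_0_integrable[OF f(1) prob_space_unif, of "\<lambda>x. x"] by simp
  have "bddC 0 (\<lambda>x. f x * f x)" by (rule bddC_0_mult[OF f(1) f(1)])
  from bddC_0_integrable[OF this prob_space_unif, of "\<lambda>x. x"]
  have if2: "integrable unif (\<lambda>x. (f x)\<^sup>2)" by (simp add: power2_eq_square)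
  define c where "c = (\<integral>x. (f x)\<^sup>2 \<partial>unif)"
  have inner: "(\<integral>y. (f y + S)\<^sup>2 \<partial>unif) = c + S\<^sup>2" for S
  proof -
    have "(\<integral>y. (f y + S)\<^sup>2 \<partial>unif) = (\<integral>y. (f y)\<^sup>2 + (2 * S) * f y + S\<^sup>2 \<partial>unif)"
      by (intro Bochner_Integration.integral_cong) (auto simp: power2_eq_square algebra_simps)
    also have "\<dots> = c + (2 * S) * (\<integral>y. f y \<partial>unif) + S\<^sup>2"
      using if1 if2 U.prob_space by (simp add: c_def)
    finally show ?thesis using f(2) by simp
  qed
  have "(\<integral>s. (\<Sum>v\<in>insert i I. f (s v))\<^sup>2 \<partial>PU (insert i I)) =
      (\<integral>s. (\<integral>y. (\<Sum>v\<in>insert i I. f ((s(i := y)) v))\<^sup>2 \<partial>unif) \<partial>PU I)"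
    by (rule PU_insert[OF insert.hyps bddC_sum_integrable(1)[OF f(1)]]) (use insert.hyps in simp)
  also have "\<dots> = (\<integral>s. c + (\<Sum>v\<in>I. f (s v))\<^sup>2 \<partial>PU I)"
    unfolding sum_fun_upd_notin[OF insert.hyps] inner ..
  also have "\<dots> = c + (\<integral>s. (\<Sum>v\<in>I. f (s v))\<^sup>2 \<partial>PU I)"
    using bddC_sum_integrable(1)[OF f(1) insert.hyps(1)] P.prob_space by simp
  finally show ?case using insert by (simp add: c_def algebra_simps)
qed simp

text \<open>Freeze the other coordinates and expand \<open>G\<close> in the step
  \<open>\<tau> * y\<close>. The constant term vanishes because \<open>w\<close> is centred, the
  linear one because \<open>w\<close> is uncorrelated with \<open>y\<close>, and a remainder of
  order \<open>\<tau>^2\<close> is left. With \<open>w\<close> the variance fluctuation of one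
  voter, this is the cancellation of the term linear in \<open>\<delta>\<close>.\<close>

lemma leave_one_out:
  fixes \<tau> x M :: real
  assumes G: "bddC 0 G" and T: "\<And>x y. \<bar>G (x + y) - (G x + G1 x * y)\<bar> \<le> M * y\<^sup>2"
    and w: "bddC 0 w" "\<And>x. \<bar>w x\<bar> \<le> 1" "(\<integral>x. w x \<partial>unif) = 0" "(\<integral>x. x * w x \<partial>unif) = 0"
    and I: "finite I" "i \<notin> I" and M: "M \<ge> 0"
  shows "\<bar>\<integral>s. G (x + \<tau> * (\<Sum>v\<in>insert i I. s v)) * w (s i) \<partial>PU (insert i I)\<bar> \<le> M * \<tau>\<^sup>2"
proof -
  interpret U: prob_space unif by (rule prob_space_unif)
  have [measurable]: "G \<in> borel_measurable borel" "w \<in> borel_measurable borel" using G w(1) by simp_all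
  have iw: "integrable unif w"
    using bddC_0_integrable[OF w(1) prob_space_unif, of "\<lambda>x. x"] by simp
  have ixw: "integrable unif (\<lambda>x. x * w x)"
  proof (rule Bochner_Integration.integrable_bound[OF unif_moments(1)[of 1]])
    show "AE x in unif. norm (x * w x) \<le> norm (x ^ 1)"
      using w(2) by (intro AE_I2) (simp add: abs_mult mult_left_le)
  qed measurable
  have inner: "\<bar>\<integral>y. G (X + \<tau> * y) * w y \<partial>unif\<bar> \<le> M * \<tau>\<^sup>2" for X
  proof -
    let ?r = "\<lambda>y. (G (X + \<tau> * y) - (G X + G1 X * (\<tau> * y))) * w y"
    have iG: "integrable unif (\<lambda>y. G (X + \<tau> * y) * w y)"
    proof -
      obtain B where B: "\<And>x. \<bar>G x\<bar> \<le> B" using G by auto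
      have B0: "B \<ge> 0" using B[of 0] by linarith
      have "\<bar>G (X + \<tau> * y)\<bar> * \<bar>w y\<bar> \<le> B * 1" for y by (rule mult_mono[OF B w(2) B0 abs_ge_zero])
      then show ?thesis by (intro U.integrable_const_bound[of _ B] AE_I2) (auto simp: abs_mult)
    qed
    have l: "integrable unif (\<lambda>y. G X * w y + (G1 X * \<tau>) * (y * w y))"
      using iw ixw by auto
    have r: "?r y = G (X + \<tau> * y) * w y - (G X * w y + (G1 X * \<tau>) * (y * w y))" for y
      by (simp add: algebra_simps)
    have ir: "integrable unif ?r" unfolding r by (rule Bochner_Integration.integrable_diff[OF iG l])
    have "(\<integral>y. G X * w y + (G1 X * \<tau>) * (y * w y) \<partial>unif) = 0"
      using iw ixw w(3,4) by simp
    then have eq: "(\<integral>y. G (X + \<tau> * y) * w y \<partial>unif) = (\<integral>y. ?r y \<partial>unif)"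
      unfolding r Bochner_Integration.integral_diff[OF iG l] by simp
    have "\<bar>\<integral>y. ?r y \<partial>unif\<bar> \<le> (\<integral>y. (M * \<tau>\<^sup>2) * y\<^sup>2 \<partial>unif)"
    proof (rule abs_integral_le[OF ir])
      show "integrable unif (\<lambda>y. (M * \<tau>\<^sup>2) * y\<^sup>2)" by (intro integrable_mult_right unif_moments(1))
      fix y
      have "\<bar>?r y\<bar> \<le> (M * (\<tau> * y)\<^sup>2) * 1"
        unfolding abs_mult by (rule mult_mono[OF T w(2)]) (use M in auto)
      then show "\<bar>?r y\<bar> \<le> (M * \<tau>\<^sup>2) * y\<^sup>2" by (simp add: power_mult_distrib)
    qed
    also have "(\<integral>y. (M * \<tau>\<^sup>2) * y\<^sup>2 \<partial>unif) = (M * \<tau>\<^sup>2) * (1/3)"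
      unfolding integral_mult_right_zero unif_moments(3) ..
    also have "\<dots> \<le> M * \<tau>\<^sup>2" using M by simp
    finally show ?thesis unfolding eq .
  qed
  have sm: "(\<lambda>s. x + \<tau> * (\<Sum>v\<in>J. s v)) \<in> borel_measurable (PU J)" for J
    using sum_measurable_PU[of "\<lambda>x. x" J] by auto
  have icomp: "(\<lambda>s. s i) \<in> borel_measurable (PU (insert i I))"
    using measurable_component_singleton[of i "insert i I" "\<lambda>_. unif"] by (simp cong: measurable_cong_sets)
  have iall: "integrable (PU (insert i I)) (\<lambda>s. G (x + \<tau> * (\<Sum>v\<in>insert i I. s v)) * w (s i))"
  proof -
    interpret PI: prob_space "PU (insert i I)" by (rule prob_space_PU)
    obtain B where B: "\<And>x. \<bar>G x\<bar> \<le> B" using G by auto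
    have B0: "B \<ge> 0" using B[of 0] by linarith
    have b: "norm (G (x + \<tau> * (\<Sum>v\<in>insert i I. s v)) * w (s i)) \<le> B * 1" for s
      unfolding real_norm_def abs_mult by (rule mult_mono[OF B w(2) B0 abs_ge_zero])
    have m: "(\<lambda>s. G (x + \<tau> * (\<Sum>v\<in>insert i I. s v)) * w (s i)) \<in> borel_measurable (PU (insert i I))"
      by (intro borel_measurable_times measurable_compose[OF sm] measurable_compose[OF icomp]) measurable
    show ?thesis by (rule PI.integrable_const_bound[OF AE_I2 m]) (rule b)
  qed
  have "(\<integral>s. G (x + \<tau> * (\<Sum>v\<in>insert i I. s v)) * w (s i) \<partial>PU (insert i I)) =
     (\<integral>s. (\<integral>y. G (x + \<tau> * (\<Sum>v\<in>insert i I. (s(i := y)) v)) * w ((s(i := y)) i) \<partial>unif) \<partial>PU I)"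
    by (rule PU_insert[OF I iall])
  also have "\<dots> = (\<integral>s. (\<integral>y. G ((x + \<tau> * (\<Sum>v\<in>I. s v)) + \<tau> * y) * w y \<partial>unif) \<partial>PU I)"
  proof -
    have "x + \<tau> * (\<Sum>v\<in>insert i I. (s(i := y)) v) = (x + \<tau> * (\<Sum>v\<in>I. s v)) + \<tau> * y" for s y
      unfolding sum_fun_upd_notin[OF I, of "\<lambda>x. x"] by (simp add: algebra_simps)
    then show ?thesis by (simp only: fun_upd_same)
  qed
  finally have eq: "(\<integral>s. G (x + \<tau> * (\<Sum>v\<in>insert i I. s v)) * w (s i) \<partial>PU (insert i I)) =
    (\<integral>s. (\<integral>y. G ((x + \<tau> * (\<Sum>v\<in>I. s v)) + \<tau> * y) * w y \<partial>unif) \<partial>PU I)" .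
  define K where "K X = (\<integral>y. G (X + \<tau> * y) * w y \<partial>unif)" for X
  have "K \<in> borel_measurable borel" unfolding K_def by measurable
  then have "bddC 0 K" using inner by (auto simp: K_def)
  from bddC_0_integrable[OF this prob_space_PU sm]
  have "\<bar>\<integral>s. K (x + \<tau> * (\<Sum>v\<in>I. s v)) \<partial>PU I\<bar> \<le> M * \<tau>\<^sup>2"
    by (rule abs_expectation_le[OF prob_space_PU]) (unfold K_def, rule inner)
  then show ?thesis unfolding eq K_def .
qed

lemma component_measurable_PU: "v \<in> I \<Longrightarrow> (\<lambda>s. s v) \<in> borel_measurable (PU I)"
  using measurable_component_singleton[of v I "\<lambda>_. unif"] by (simp cong: measurable_cong_sets)

lemma win_measurable: "(\<lambda>s. win n s) \<in> borel_measurable (PU {..<n})"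
proof -
  have "(\<lambda>s. vweight s D v) \<in> borel_measurable (PU {..<n})"
    if "v < n" for v and D :: "nat set"
    using component_measurable_PU[of v "{..<n}"] that by (cases "v \<in> D") auto
  then show ?thesis unfolding win_def by (intro borel_measurable_sum borel_measurable_prod) auto
qed

lemma moment_clip:
  "bddC 0 (\<lambda>x. 1 / 3 - (clip x)\<^sup>2)" "bddC 0 (\<lambda>x. clip x * (1 - (clip x)\<^sup>2))"
  "\<bar>1 / 3 - (clip x)\<^sup>2\<bar> \<le> 1" "\<bar>clip x * (1 - (clip x)\<^sup>2)\<bar> \<le> 1"
proof -
  have c2: "(clip x)\<^sup>2 \<le> 1" for x using clip_bound[of x] by (simp add: abs_square_le_1)
  show 1: "\<bar>1 / 3 - (clip x)\<^sup>2\<bar> \<le> 1" for x using c2[of x] zero_le_power2[of "clip x"] by (simp only: abs_le_iff) linarith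
  show 2: "\<bar>clip x * (1 - (clip x)\<^sup>2)\<bar> \<le> 1" for x using abs_s_one_minus_sq_le[OF clip_bound[of x]] by linarith
  show "bddC 0 (\<lambda>x. 1 / 3 - (clip x)\<^sup>2)" using 1 by auto
  show "bddC 0 (\<lambda>x. clip x * (1 - (clip x)\<^sup>2))" using 2 by auto
qed

lemma moment_clip_integrals:
  "(\<integral>x. 1 / 3 - (clip x)\<^sup>2 \<partial>unif) = 0" "(\<integral>x. clip x * (1 - (clip x)\<^sup>2) \<partial>unif) = 0"
  "(\<integral>x. x * (1 / 3 - (clip x)\<^sup>2) \<partial>unif) = 0"
proof -
  interpret U: prob_space unif by (rule prob_space_unif)
  have i: "integrable unif (\<lambda>x. x)" using unif_moments(1)[of 1] by simp
  have p: "measure unif UNIV = 1" using U.prob_space by simp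
  have "(\<integral>x. 1 / 3 - (clip x)\<^sup>2 \<partial>unif) = (\<integral>x. 1 / 3 - x\<^sup>2 \<partial>unif)"
    by (rule integral_unif_clip[of "\<lambda>x. 1/3 - x\<^sup>2"]) measurable
  also have "\<dots> = 0" using unif_moments(1)[of 2] by (simp add: unif_moments p)
  finally show "(\<integral>x. 1 / 3 - (clip x)\<^sup>2 \<partial>unif) = 0" .
  have "(\<integral>x. clip x * (1 - (clip x)\<^sup>2) \<partial>unif) = (\<integral>x. x * (1 - x\<^sup>2) \<partial>unif)"
    by (rule integral_unif_clip[of "\<lambda>x. x * (1 - x\<^sup>2)"]) measurable
  also have "\<dots> = (\<integral>x. x - x ^ 3 \<partial>unif)"
    by (intro Bochner_Integration.integral_cong) (auto simp: power2_eq_square power3_eq_cube algebra_simps)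
  also have "\<dots> = 0" using i unif_moments(1)[of 3] by (simp add: unif_moments)
  finally show "(\<integral>x. clip x * (1 - (clip x)\<^sup>2) \<partial>unif) = 0" .
  have "(\<integral>x. x * (1 / 3 - (clip x)\<^sup>2) \<partial>unif) = (\<integral>x. (1/3) * x - x ^ 3 \<partial>unif)"
  proof (rule integral_cong_AE)
    show "AE x in unif. x * (1 / 3 - (clip x)\<^sup>2) = (1/3) * x - x ^ 3"
      using AE_unif
    proof eventually_elim
      fix x :: real assume "\<bar>x\<bar> \<le> 1"
      then show "x * (1 / 3 - (clip x)\<^sup>2) = (1/3) * x - x ^ 3"
        unfolding clip_id[OF \<open>\<bar>x\<bar> \<le> 1\<close>] by (simp add: power2_eq_square power3_eq_cube algebra_simps)
    qed
  qed measurable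
  also have "\<dots> = 0" using i unif_moments(1)[of 3] by (simp add: unif_moments)
  finally show "(\<integral>x. x * (1 / 3 - (clip x)\<^sup>2) \<partial>unif) = 0" .
qed

text \<open>Three errors of order \<open>1 / n\<close> are added: \<open>4 * C\<close> from the
  pointwise expansion, \<open>M2\<close> from the variance term treated voter by voter, and
  \<open>M4\<close> from replacing the sum of latent values by a normal variable. The shift by
  parity rides along as the starting point \<open>x0\<close> and is expanded only
  afterwards.\<close>

lemma win_power_expectation:
  obtains C where
    "\<And>n. n > 0 \<Longrightarrow> \<bar>(\<integral>s. win n s ^ d \<partial>PU {..<n}) -
        (\<integral>z. Phi (c0 * (- (parity_shift n / sqrt n) + 1 / sqrt 3 * z)) ^ d \<partial>N01)\<bar> \<le> C / n"
proof -
  obtain C where C: "C \<ge> 0"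
    "\<And>n s. n > 0 \<Longrightarrow> (\<And>v. v < n \<Longrightarrow> \<bar>s v\<bar> \<le> 1) \<Longrightarrow>
      \<bar>win n s ^ d - Phi (c0 * (((\<Sum>v<n. s v) - parity_shift n) / sqrt n)) ^ d
        - real d * Phi (c0 * (((\<Sum>v<n. s v) - parity_shift n) / sqrt n)) ^ (d - 1)
           * gcorr (((\<Sum>v<n. s v) - parity_shift n) / sqrt n) * ((\<Sum>v<n. 1 / 3 - (s v)\<^sup>2) / n)\<bar>
       \<le> C * ((1 + \<bar>condskew n s\<bar> / sqrt n) / n + ((\<Sum>v<n. 1 / 3 - (s v)\<^sup>2) / n)\<^sup>2)"
    using win_power_expansion[of d] by blast
  define h where "h = (\<lambda>x. Phi (c0 * x) ^ d)"
  define G where "G = (\<lambda>x. real d * Phi (c0 * x) ^ (d - 1) * gcorr x)"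
  define w where "w = (\<lambda>x. 1 / 3 - (clip x)\<^sup>2)"
  define k where "k = (\<lambda>x. clip x * (1 - (clip x)\<^sup>2))"
  have w: "bddC 0 w" "\<And>x. \<bar>w x\<bar> \<le> 1" "(\<integral>x. w x \<partial>unif) = 0" "(\<integral>x. x * w x \<partial>unif) = 0"
    unfolding w_def by (rule moment_clip moment_clip_integrals)+
  have k: "bddC 0 k" "\<And>x. \<bar>k x\<bar> \<le> 1" "(\<integral>x. k x \<partial>unif) = 0"
    unfolding k_def by (rule moment_clip moment_clip_integrals)+
  have h: "bddC j h" for j unfolding h_def by (intro bddC_power bddC_scale bddC_Phi)
  have G: "bddC j G" for j unfolding G_def
    by (rule bddC_mult[OF bddC_mult[OF bddC_const bddC_power[OF bddC_scale[OF bddC_Phi]]] bddC_gcorr])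
  obtain M4 where M4: "M4 \<ge> 0" "taylor4 M4 h" by (rule bddC_4_imp_taylor4[OF h[of 4]])
  obtain G1 M2 where M2: "M2 \<ge> 0" "\<And>x y. \<bar>G (x + y) - (G x + G1 x * y)\<bar> \<le> M2 * y\<^sup>2"
    by (rule bddC_2_taylor[OF G[of 2]]) (rule that)
  have sq1: "(\<integral>x. (f x)\<^sup>2 \<partial>unif) \<le> 1" if f: "bddC 0 f" "\<And>x. \<bar>f x\<bar> \<le> 1" for f
  proof -
    have i: "integrable unif (\<lambda>x. (f x)\<^sup>2)"
      using bddC_0_integrable[OF bddC_0_mult[OF f(1) f(1)] prob_space_unif, of "\<lambda>x. x"] by (simp add: power2_eq_square)
    have "\<bar>(f x)\<^sup>2\<bar> \<le> 1" for x using f(2)[of x] by (simp add: abs_square_le_1)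
    from abs_expectation_le[OF prob_space_unif i this] show ?thesis by linarith
  qed
  have "\<bar>(\<integral>s. win n s ^ d \<partial>PU {..<n}) - (\<integral>z. h (- (parity_shift n / sqrt n) + 1 / sqrt 3 * z) \<partial>N01)\<bar> \<le> (4 * C + M2 + M4) / n"
    if n: "n > 0" for n
  proof -
    interpret P: prob_space "PU {..<n}" by (rule prob_space_PU)
    define \<tau> where "\<tau> = 1 / sqrt n"
    define x0 where "x0 = - (parity_shift n / sqrt n)"
    define y where "y s = x0 + \<tau> * (\<Sum>v<n. s v)" for s
    define Sw where "Sw s = (\<Sum>v<n. w (s v))" for s
    define Sk where "Sk s = (\<Sum>v<n. k (s v))" for s
    have \<tau>: "\<tau> > 0" "\<tau>\<^sup>2 = 1 / n" using n by (simp_all add: \<tau>_def power_divide)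
    have yeq: "((\<Sum>v<n. s v) - parity_shift n) / sqrt n = y s" for s
      by (simp add: y_def x0_def \<tau>_def diff_divide_distrib)
    have ym: "y \<in> borel_measurable (PU {..<n})"
      unfolding y_def using sum_measurable_PU[of "\<lambda>x. x" "{..<n}"] by auto
    have ih: "integrable (PU {..<n}) (\<lambda>s. h (y s))" by (rule bddC_0_integrable[OF h prob_space_PU ym])
    have iwin: "integrable (PU {..<n}) (\<lambda>s. win n s ^ d)"
    proof (rule P.integrable_const_bound[of _ 1])
      show "AE s in PU {..<n}. norm (win n s ^ d) \<le> 1"
        using AE_PU[OF finite_lessThan]
      proof eventually_elim
        fix s :: "nat \<Rightarrow> real" assume "\<forall>v\<in>{..<n}. \<bar>s v\<bar> \<le> 1"
        then have "0 \<le> win n s" "win n s \<le> 1" using win_bounds[of n s] by auto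
        then show "norm (win n s ^ d) \<le> 1" by (simp add: power_le_one)
      qed
      show "(\<lambda>s. win n s ^ d) \<in> borel_measurable (PU {..<n})"
        by (intro borel_measurable_power win_measurable)
    qed
    have iGw: "integrable (PU {..<n}) (\<lambda>s. G (y s) * w (s v))" if v: "v < n" for v
    proof -
      obtain B where B: "\<And>x. \<bar>G x\<bar> \<le> B" using G[of 0] by auto
      have B0: "B \<ge> 0" using B[of 0] by linarith
      have b: "norm (G (y s) * w (s v)) \<le> B * 1" for s
        unfolding real_norm_def abs_mult by (rule mult_mono[OF B w(2) B0 abs_ge_zero])
      have m: "(\<lambda>s. G (y s) * w (s v)) \<in> borel_measurable (PU {..<n})"
        using G[of 0] w(1) component_measurable_PU[of v "{..<n}"] v
        by (intro borel_measurable_times measurable_compose[OF ym] measurable_compose[OF component_measurable_PU]) auto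
      show ?thesis by (rule P.integrable_const_bound[OF AE_I2 m]) (rule b)
    qed
    have Geq: "G (y s) * (Sw s / n) = (\<Sum>v<n. (1 / n) * (G (y s) * w (s v)))" for s
      unfolding Sw_def by (simp add: sum_distrib_left sum_divide_distrib)
    have iG: "integrable (PU {..<n}) (\<lambda>s. G (y s) * (Sw s / n))"
      unfolding Geq by (intro Bochner_Integration.integrable_sum integrable_mult_right iGw) simp
    have boundG: "\<bar>\<integral>s. G (y s) * (Sw s / n) \<partial>PU {..<n}\<bar> \<le> M2 / n"
    proof -
      have each: "\<bar>\<integral>s. G (y s) * w (s v) \<partial>PU {..<n}\<bar> \<le> M2 / n" if v: "v < n" for v
      proof -
        \<comment> \<open>Singles out voter \<open>v\<close> so that \<open>leave_one_out\<close>
          applies to the coordinate carried by the weight.\<close>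
        have ins: "insert v ({..<n} - {v}) = {..<n}" using v by auto
        have "\<bar>\<integral>s. G (x0 + \<tau> * (\<Sum>u\<in>insert v ({..<n} - {v}). s u)) * w (s v) \<partial>PU (insert v ({..<n} - {v}))\<bar> \<le> M2 * \<tau>\<^sup>2"
          by (rule leave_one_out[OF G M2(2) w _ _ M2(1)]) auto
        then show ?thesis unfolding ins y_def \<tau>(2) by simp
      qed
      have "(\<integral>s. G (y s) * (Sw s / n) \<partial>PU {..<n}) = (\<Sum>v<n. (1 / n) * (\<integral>s. G (y s) * w (s v) \<partial>PU {..<n}))"
        unfolding Geq by (subst Bochner_Integration.integral_sum) (auto intro!: integrable_mult_right iGw simp: integral_mult_right_zero)
      then have "\<bar>\<integral>s. G (y s) * (Sw s / n) \<partial>PU {..<n}\<bar> \<le> (\<Sum>v<n. \<bar>(1 / n) * (\<integral>s. G (y s) * w (s v) \<partial>PU {..<n})\<bar>)"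
        by (simp only: sum_abs)
      also have "\<dots> \<le> (\<Sum>v<n. (1 / n) * (M2 / n))"
      proof (rule sum_mono)
        fix v assume "v \<in> {..<n}"
        then have "\<bar>\<integral>s. G (y s) * w (s v) \<partial>PU {..<n}\<bar> \<le> M2 / n" by (intro each) simp
        then show "\<bar>(1 / n) * (\<integral>s. G (y s) * w (s v) \<partial>PU {..<n})\<bar> \<le> (1 / n) * (M2 / n)"
          unfolding abs_mult by (intro mult_mono) auto
      qed
      also have "\<dots> = M2 / n" using n by simp
      finally show ?thesis .
    qed
    define X where "X s = win n s ^ d - h (y s) - G (y s) * (Sw s / n)" for s
    \<comment> \<open>The absolute skewness is traded for its square by
      \<open>t \<le> 1 + t^2\<close>, because second moments of centred sums are exact; the 2
      collects the two constants. Of the final \<open>4 * C\<close>, \<open>2 * C\<close> is this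
      constant and each of the two squared sums contributes at most \<open>C\<close>.\<close>
    define Dm where "Dm s = C * ((2 + (Sk s)\<^sup>2 / n) / n + (Sw s / n)\<^sup>2)" for s
    have iX: "integrable (PU {..<n}) X" unfolding X_def
      by (rule Bochner_Integration.integrable_diff[OF Bochner_Integration.integrable_diff[OF iwin ih] iG])
    have iSw: "integrable (PU {..<n}) (\<lambda>s. (Sw s)\<^sup>2)" and iSk: "integrable (PU {..<n}) (\<lambda>s. (Sk s)\<^sup>2)"
      unfolding Sw_def Sk_def by (rule bddC_sum_integrable[OF w(1)] bddC_sum_integrable[OF k(1)], simp)+
    have Dm: "Dm s = C * 2 / n + C / n\<^sup>2 * (Sk s)\<^sup>2 + C / n\<^sup>2 * (Sw s)\<^sup>2" for s
      unfolding Dm_def by (simp add: distrib_left add_divide_distrib power2_eq_square)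
    have iDm: "integrable (PU {..<n}) Dm" unfolding Dm
      by (intro Bochner_Integration.integrable_add integrable_mult_right iSw iSk P.integrable_const)
    have Eint: "(\<integral>s. Dm s \<partial>PU {..<n}) \<le> 4 * C / n"
    proof -
      have "(\<integral>s. Dm s \<partial>PU {..<n}) = C * 2 / n + C / n\<^sup>2 * (\<integral>s. (Sk s)\<^sup>2 \<partial>PU {..<n}) + C / n\<^sup>2 * (\<integral>s. (Sw s)\<^sup>2 \<partial>PU {..<n})"
        unfolding Dm using iSw iSk P.prob_space by (simp add: integral_mult_right_zero)
      moreover have "(\<integral>s. (Sk s)\<^sup>2 \<partial>PU {..<n}) \<le> n"
        unfolding Sk_def second_moment_sum[OF k(1,3) finite_lessThan] using sq1[OF k(1,2)] by (simp add: mult_left_le)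
      moreover have "(\<integral>s. (Sw s)\<^sup>2 \<partial>PU {..<n}) \<le> n"
        unfolding Sw_def second_moment_sum[OF w(1,3) finite_lessThan] using sq1[OF w(1,2)] by (simp add: mult_left_le)
      ultimately have "(\<integral>s. Dm s \<partial>PU {..<n}) \<le> C * 2 / n + C / n\<^sup>2 * n + C / n\<^sup>2 * n"
        using C(1) by (simp only:) (intro add_mono mult_left_mono order_refl, auto)
      also have "\<dots> = 4 * C / n" using n by (simp add: power2_eq_square field_simps)
      finally show ?thesis .
    qed
    have AEle: "AE s in PU {..<n}. \<bar>X s\<bar> \<le> Dm s"
      using AE_PU[OF finite_lessThan]
    proof eventually_elim
      fix s :: "nat \<Rightarrow> real" assume s: "\<forall>v\<in>{..<n}. \<bar>s v\<bar> \<le> 1"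
      have sw: "(\<Sum>v<n. 1 / 3 - (s v)\<^sup>2) = Sw s"
        unfolding Sw_def w_def by (rule sum.cong) (use s clip_id in auto)
      have sk: "condskew n s = Sk s"
        unfolding Sk_def k_def by (rule sum.cong) (use s clip_id in auto)
      have "\<bar>X s\<bar> \<le> C * ((1 + \<bar>Sk s\<bar> / sqrt n) / n + (Sw s / n)\<^sup>2)"
        using C(2)[of n s] n s unfolding sw sk yeq X_def h_def G_def by simp
      also have "\<dots> \<le> Dm s" unfolding Dm_def
      proof (intro mult_left_mono add_right_mono divide_right_mono C(1))
        have "t \<le> 1 + t\<^sup>2" for t :: real
          using zero_le_power2[of "t - 1/2"] by (simp add: power2_eq_square algebra_simps)
        then have "\<bar>Sk s\<bar> / sqrt n \<le> 1 + (\<bar>Sk s\<bar> / sqrt n)\<^sup>2" .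
        also have "(\<bar>Sk s\<bar> / sqrt n)\<^sup>2 = (Sk s)\<^sup>2 / n" by (simp add: power_divide)
        finally show "1 + \<bar>Sk s\<bar> / sqrt n \<le> 2 + (Sk s)\<^sup>2 / n" by simp
      qed simp
      finally show "\<bar>X s\<bar> \<le> Dm s" .
    qed
    have boundX: "\<bar>\<integral>s. X s \<partial>PU {..<n}\<bar> \<le> 4 * C / n"
    proof -
      have "\<bar>\<integral>s. X s \<partial>PU {..<n}\<bar> \<le> (\<integral>s. \<bar>X s\<bar> \<partial>PU {..<n})" by (rule integral_abs_bound)
      moreover have "(\<integral>s. \<bar>X s\<bar> \<partial>PU {..<n}) \<le> (\<integral>s. Dm s \<partial>PU {..<n})"
        by (rule integral_mono_AE[OF integrable_abs[OF iX] iDm AEle])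
      ultimately show ?thesis using Eint by linarith
    qed
    have EX: "(\<integral>s. X s \<partial>PU {..<n}) = (\<integral>s. win n s ^ d \<partial>PU {..<n}) - (\<integral>s. h (y s) \<partial>PU {..<n}) - (\<integral>s. G (y s) * (Sw s / n) \<partial>PU {..<n})"
      unfolding X_def Bochner_Integration.integral_diff[OF Bochner_Integration.integrable_diff[OF iwin ih] iG]
        Bochner_Integration.integral_diff[OF iwin ih] ..
    have L: "\<bar>(\<integral>s. h (y s) \<partial>PU {..<n}) - (\<integral>z. h (x0 + 1 / sqrt 3 * z) \<partial>N01)\<bar> \<le> M4 / n"
    proof -
      have "\<tau> * sqrt (card {..<n} / 3) = 1 / sqrt 3" using n by (simp add: \<tau>_def real_sqrt_divide)
      moreover have "card {..<n} * (M4 * \<tau> ^ 4) = M4 / n"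
      proof -
        have t4: "\<tau> ^ 4 = \<tau>\<^sup>2 * \<tau>\<^sup>2" by (simp add: power_add[symmetric])
        show ?thesis unfolding t4 \<tau>(2) using n by simp
      qed
      ultimately show ?thesis
        using lindeberg[where I="{..<n}" and x=x0, OF finite_lessThan M4(2) \<tau>(1)] unfolding y_def by simp
    qed
    have fin: "\<bar>a - e\<bar> \<le> p + q + r" if "\<bar>x\<bar> \<le> p" "x = a - b - c" "\<bar>c\<bar> \<le> q" "\<bar>b - e\<bar> \<le> r" for a b c e p q r x :: real
      using that by linarith
    show ?thesis using fin[OF boundX EX boundG L] unfolding x0_def add_divide_distrib .
  qed
  then show thesis unfolding h_def by (rule that)
qed

text \<open>The shift \<open>x0 = - parity_shift n / sqrt n\<close> has square at most
  \<open>1 / n\<close>, so a first-order expansion of \<open>Phi (c0 * x) ^ d\<close> in it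
  suffices. The trailing factor \<open>c0\<close> comes from the chain rule.\<close>

lemma win_power_asymptotics:
  obtains C where
    "\<And>n. n > 0 \<Longrightarrow> \<bar>(\<integral>s. win n s ^ d \<partial>PU {..<n}) - (\<integral>z. Phi (z / sqrt 2) ^ d \<partial>N01)
      + parity_shift n / sqrt n * (\<integral>z. real d * Phi (z / sqrt 2) ^ (d - 1) * \<phi> (z / sqrt 2) * c0 \<partial>N01)\<bar> \<le> C / n"
proof -
  obtain C where C: "\<And>n. n > 0 \<Longrightarrow> \<bar>(\<integral>s. win n s ^ d \<partial>PU {..<n}) -
        (\<integral>z. Phi (c0 * (- (parity_shift n / sqrt n) + 1 / sqrt 3 * z)) ^ d \<partial>N01)\<bar> \<le> C / n"
    using win_power_expectation[of d] by blast
  define h where "h = (\<lambda>x. Phi (c0 * x) ^ d)"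
  have h: "bddC j h" for j unfolding h_def by (intro bddC_power bddC_scale bddC_Phi)
  obtain h1 M where M: "M \<ge> 0" and h1: "bddC 0 h1" "\<And>x. (h has_real_derivative h1 x) (at x)"
    and T: "\<And>x y. \<bar>h (x + y) - (h x + h1 x * y)\<bar> \<le> M * y\<^sup>2"
    by (rule bddC_2_taylor[OF h[of 2]]) (rule that)
  have h1eq: "h1 x = real d * Phi (c0 * x) ^ (d - 1) * \<phi> (c0 * x) * c0" for x
  proof (rule DERIV_unique[OF h1(2)])
    have "((\<lambda>x. c0 * x) has_real_derivative c0) (at x)" by (auto intro!: derivative_eq_intros)
    from DERIV_power[OF DERIV_chain2[OF DERIV_Phi this], of d]
    show "(h has_real_derivative real d * Phi (c0 * x) ^ (d - 1) * \<phi> (c0 * x) * c0) (at x)"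
      unfolding h_def by (simp add: mult_ac)
  qed
  \<comment> \<open>Ratio of the deviation of the conditional mean to the conditional deviation:
    \<open>sqrt (1/3) / sqrt (2/3)\<close>.\<close>
  have c3: "c0 * (1 / sqrt 3 * z) = z / sqrt 2" for z
  proof -
    have "c0 * (1 / sqrt 3) = 1 / sqrt 2" by (simp add: c0_def real_sqrt_divide)
    then show ?thesis by (metis mult.assoc mult.commute mult.right_neutral times_divide_eq_right)
  qed
  have "\<bar>(\<integral>s. win n s ^ d \<partial>PU {..<n}) - (\<integral>z. h (1 / sqrt 3 * z) \<partial>N01)
      + parity_shift n / sqrt n * (\<integral>z. h1 (1 / sqrt 3 * z) \<partial>N01)\<bar> \<le> (C + M) / n" if n: "n > 0" for n
  proof -
    define x0 where "x0 = - (parity_shift n / sqrt n)"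
    have x02: "x0\<^sup>2 \<le> 1 / n" by (simp add: x0_def parity_shift_def power_divide)
    have i: "integrable N01 (\<lambda>z. f (1 / sqrt 3 * z))" "integrable N01 (\<lambda>z. f (1 / sqrt 3 * z + x0))" if "bddC 0 f" for f
      by (rule bddC_0_integrable[OF that prob_space_N01], measurable)+
    have l: "integrable N01 (\<lambda>z. h (1 / sqrt 3 * z) + h1 (1 / sqrt 3 * z) * x0)"
      by (rule Bochner_Integration.integrable_add[OF i(1)[OF h] integrable_mult_left[OF i(1)[OF h1(1)]]])
    have "\<bar>\<integral>z. h (1 / sqrt 3 * z + x0) - (h (1 / sqrt 3 * z) + h1 (1 / sqrt 3 * z) * x0) \<partial>N01\<bar> \<le> M * x0\<^sup>2"
      by (rule abs_expectation_le[OF prob_space_N01 Bochner_Integration.integrable_diff[OF i(2)[OF h] l] T])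
    moreover have "(\<integral>z. h (1 / sqrt 3 * z + x0) - (h (1 / sqrt 3 * z) + h1 (1 / sqrt 3 * z) * x0) \<partial>N01) =
        (\<integral>z. h (1 / sqrt 3 * z + x0) \<partial>N01) - ((\<integral>z. h (1 / sqrt 3 * z) \<partial>N01) + (\<integral>z. h1 (1 / sqrt 3 * z) \<partial>N01) * x0)"
      unfolding Bochner_Integration.integral_diff[OF i(2)[OF h] l]
        Bochner_Integration.integral_add[OF i(1)[OF h] integrable_mult_left[OF i(1)[OF h1(1)]]] integral_mult_left_zero ..
    moreover have "M * x0\<^sup>2 \<le> M / n" using mult_left_mono[OF x02 M] by simp
    ultimately have A: "\<bar>(\<integral>z. h (1 / sqrt 3 * z + x0) \<partial>N01) - ((\<integral>z. h (1 / sqrt 3 * z) \<partial>N01) + (\<integral>z. h1 (1 / sqrt 3 * z) \<partial>N01) * x0)\<bar> \<le> M / n"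
      by (simp only:)
    have B: "\<bar>(\<integral>s. win n s ^ d \<partial>PU {..<n}) - (\<integral>z. h (1 / sqrt 3 * z + x0) \<partial>N01)\<bar> \<le> C / n"
      using C[OF n] by (simp only: h_def x0_def add.commute)
    have fin: "\<bar>a - b + e * f\<bar> \<le> p + q" if "\<bar>a - c\<bar> \<le> p" "\<bar>c - (b + f * (- e))\<bar> \<le> q" for a b c e f p q :: real
      using that by (simp add: abs_le_iff algebra_simps)
    show ?thesis using fin[OF B[unfolded x0_def] A[unfolded x0_def]] unfolding add_divide_distrib x0_def .
  qed
  then show thesis unfolding h1eq h_def c3 by (rule that)
qed

section \<open>The Gaussian orthant integrals\<close>

lemma quadH_eq:
  fixes d :: nat
  defines "m \<equiv> Suc d"
  shows "quadH m u = 6 * (\<Sum>i<d. (u i)\<^sup>2) - 6 / (real m + 1) * (\<Sum>i<d. u i)\<^sup>2"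
proof -
  have "quadH m u = (\<Sum>i<d. \<Sum>j<d. 6 * (if i = j then u i * u j else 0) - 6 / (real m + 1) * (u i * u j))"
    unfolding quadH_def Hinv_def m_def by (intro sum.cong) (auto simp: field_simps)
  also have "\<dots> = 6 * (\<Sum>i<d. \<Sum>j<d. if i = j then u i * u j else 0) - 6 / (real m + 1) * (\<Sum>i<d. \<Sum>j<d. u i * u j)"
    by (simp only: sum_subtractf sum_distrib_left)
  also have "(\<Sum>i<d. \<Sum>j<d. if i = j then u i * u j else 0) = (\<Sum>i<d. (u i)\<^sup>2)"
    by (intro sum.cong refl) (simp add: power2_eq_square)
  also have "(\<Sum>i<d. \<Sum>j<d. u i * u j) = (\<Sum>i<d. u i)\<^sup>2"
    by (simp add: power2_eq_square sum_product)
  finally show ?thesis .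
qed

definition normconst :: "nat \<Rightarrow> real" where
  "normconst m = 1 / sqrt ((2 * pi) ^ (m - 1) * detH m)"

abbreviation gdens :: "nat \<Rightarrow> (nat \<Rightarrow> real) \<Rightarrow> real" where
  "gdens d u \<equiv> normconst (Suc d) * exp (- quadH (Suc d) u / 2)"

(* Given the latent z the coordinates u i are independent N(z / sqrt 12, 1/6). *)
definition cdens :: "real \<Rightarrow> real \<Rightarrow> real" where
  "cdens z t = sqrt 6 * \<phi> (sqrt 6 * (t - z / sqrt 12))"

lemma cdens_nonneg: "0 \<le> cdens z t"
  by (simp add: cdens_def)

lemma cdens_measurable [measurable]: "(\<lambda>p. cdens (fst p) (snd p)) \<in> borel_measurable (borel \<Otimes>\<^sub>M borel)"
  unfolding cdens_def by measurable

text \<open>Completing the square in \<open>z\<close> splits the joint density into the Gaussian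
  density of \<open>u\<close> and a normal density in \<open>z\<close>, the conditional law of the
  latent variable given \<open>u\<close>, which integrates to 1. No matrix inverse or determinant
  has to be computed.\<close>

lemma mixture_density:
  fixes d :: nat
  shows "(\<integral>\<^sup>+z. ennreal (\<phi> z * (\<Prod>i<d. cdens z (u i))) \<partial>lborel) =
     ennreal (gdens d u)"
proof -
  define S2 where "S2 = (\<Sum>i<d. (u i)\<^sup>2)"
  define S where "S = (\<Sum>i<d. u i)"
  \<comment> \<open>One more than the number of candidates: the coefficient of \<open>z^2\<close> in
    the exponent is \<open>1/2 + d / 4 = m / 4\<close>, whence
    \<open>\<sigma>^2 = 2 / m\<close>.\<close>
  define m where "m = real d + 2"
  define \<mu> where "\<mu> = 2 * sqrt 3 * S / m"
  define \<sigma> where "\<sigma> = sqrt (2 / m)"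
  have m0: "m > 0" by (simp add: m_def)
  have \<sigma>: "\<sigma> > 0" "\<sigma>\<^sup>2 = 2 / m" using m0 by (simp_all add: \<sigma>_def)
  have prod: "(\<Prod>i<d. cdens z (u i)) = (sqrt 6 / sqrt (2 * pi)) ^ d * exp (- (3 * S2 - sqrt 3 * z * S + real d * z\<^sup>2 / 4))" for z
  proof -
    have "cdens z t = (sqrt 6 / sqrt (2 * pi)) * exp (- (3 * t\<^sup>2 - sqrt 3 * z * t + z\<^sup>2 / 4))" for t
    proof -
      have s12: "sqrt 12 = 2 * sqrt (3::real)" using real_sqrt_mult[of 4 3] by simp
      have "(sqrt 6 * (t - z / sqrt 12))\<^sup>2 / 2 = 3 * (t - z / (2 * sqrt 3))\<^sup>2"
        unfolding s12 by (simp add: power_mult_distrib)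
      also have "\<dots> = 3 * t\<^sup>2 - sqrt 3 * z * t + z\<^sup>2 / 4"
      proof -
        have e: "z / (2 * sqrt 3) = z * sqrt 3 / 6" using real_div_sqrt[of 3] by (simp add: field_simps)
        show ?thesis unfolding e by (simp add: power2_diff power_mult_distrib power_divide algebra_simps)
      qed
      finally have e: "- (sqrt 6 * (t - z / sqrt 12))\<^sup>2 / 2 = - (3 * t\<^sup>2 - sqrt 3 * z * t + z\<^sup>2 / 4)" by simp
      show ?thesis unfolding cdens_def std_normal_density_def e by simp
    qed
    then have "(\<Prod>i<d. cdens z (u i)) = (sqrt 6 / sqrt (2 * pi)) ^ d * (\<Prod>i<d. exp (- (3 * (u i)\<^sup>2 - sqrt 3 * z * u i + z\<^sup>2 / 4)))"
      by (simp only: prod.distrib prod_constant card_lessThan)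
    also have "(\<Prod>i<d. exp (- (3 * (u i)\<^sup>2 - sqrt 3 * z * u i + z\<^sup>2 / 4))) = exp (\<Sum>i<d. - (3 * (u i)\<^sup>2 - sqrt 3 * z * u i + z\<^sup>2 / 4))"
      by (rule exp_sum[symmetric]) simp
    also have "(\<Sum>i<d. - (3 * (u i)\<^sup>2 - sqrt 3 * z * u i + z\<^sup>2 / 4)) = - (3 * S2 - sqrt 3 * z * S + real d * z\<^sup>2 / 4)"
      by (simp add: S2_def S_def sum_negf sum.distrib sum_subtractf sum_distrib_left)
    finally show ?thesis .
  qed
  have q: "quadH (Suc d) u / 2 = 3 * S2 - 3 / m * S\<^sup>2"
  proof -
    have e: "6 / (real (Suc d) + 1) = 2 * (3 / m)" by (simp add: m_def)
    show ?thesis unfolding quadH_eq e S2_def S_def by (simp add: diff_divide_distrib)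
  qed
  define K where "K = 1 / sqrt (2 * pi) * (sqrt 6 / sqrt (2 * pi)) ^ d * sqrt (2 * pi * \<sigma>\<^sup>2)"
  have K: "K = normconst (Suc d)"
  proof -
    have e1: "sqrt (2 * pi * \<sigma>\<^sup>2) = sqrt (2 * pi) * sqrt (2 / m)" by (simp only: \<sigma>(2) real_sqrt_mult)
    have "K = (sqrt 6 / sqrt (2 * pi)) ^ d * sqrt (2 / m)" unfolding K_def e1 by simp
    also have "\<dots> = sqrt ((6 / (2 * pi)) ^ d * (2 / m))"
      by (simp only: real_sqrt_mult real_sqrt_power real_sqrt_divide)
    also have "(6 / (2 * pi)) ^ d * (2 / m) = 1 / ((2 * pi) ^ d * detH (Suc d))"
    proof -
      define P where "P = (2 * pi) ^ d"
      have "P > 0" by (simp add: P_def)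
      then show ?thesis
        unfolding detH_def power_divide P_def[symmetric] m_def by (simp add: field_simps)
    qed
    finally show ?thesis by (simp add: normconst_def real_sqrt_divide)
  qed
  have "\<phi> z * (\<Prod>i<d. cdens z (u i)) = gdens d u * normal_density \<mu> \<sigma> z" for z
  proof -
    have ex: "- z\<^sup>2 / 2 + - (3 * S2 - sqrt 3 * z * S + real d * z\<^sup>2 / 4) = - (3 * S2 - 3 / m * S\<^sup>2) + (- (z - \<mu>)\<^sup>2 / (2 * \<sigma>\<^sup>2))"
    proof -
      have "(z - \<mu>)\<^sup>2 / (2 * \<sigma>\<^sup>2) = (z - \<mu>)\<^sup>2 * m / 4" using m0 by (simp add: \<sigma>(2))
      also have "\<dots> = z\<^sup>2 * m / 4 - z * (\<mu> * m) / 2 + \<mu> * (\<mu> * m) / 4"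
        by (simp add: power2_eq_square algebra_simps add_divide_distrib diff_divide_distrib)
      also have "\<mu> * m = 2 * sqrt 3 * S" using m0 by (simp add: \<mu>_def)
      also have "\<mu> * (2 * sqrt 3 * S) = 12 * S\<^sup>2 / m" by (simp add: \<mu>_def power2_eq_square)
      finally have Q: "(z - \<mu>)\<^sup>2 / (2 * \<sigma>\<^sup>2) = z\<^sup>2 * m / 4 - z * (2 * sqrt 3 * S) / 2 + 12 * S\<^sup>2 / m / 4" .
      have rd: "real d = m - 2" by (simp add: m_def)
      show ?thesis unfolding rd minus_divide_left[symmetric] Q
        by (simp add: algebra_simps add_divide_distrib diff_divide_distrib)
    qed
    have nd: "exp (- (z - \<mu>)\<^sup>2 / (2 * \<sigma>\<^sup>2)) = sqrt (2 * pi * \<sigma>\<^sup>2) * normal_density \<mu> \<sigma> z"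
      using \<sigma> m0 by (simp add: normal_density_def)
    have "\<phi> z * (\<Prod>i<d. cdens z (u i)) =
       1 / sqrt (2 * pi) * (sqrt 6 / sqrt (2 * pi)) ^ d * (exp (- z\<^sup>2 / 2) * exp (- (3 * S2 - sqrt 3 * z * S + real d * z\<^sup>2 / 4)))"
      unfolding prod std_normal_density_def by (simp only: mult_ac)
    also have "exp (- z\<^sup>2 / 2) * exp (- (3 * S2 - sqrt 3 * z * S + real d * z\<^sup>2 / 4)) =
       exp (- (3 * S2 - 3 / m * S\<^sup>2)) * (sqrt (2 * pi * \<sigma>\<^sup>2) * normal_density \<mu> \<sigma> z)"
      unfolding mult_exp_exp ex unfolding exp_add nd ..
    also have "- (3 * S2 - 3 / m * S\<^sup>2) = - quadH (Suc d) u / 2" using q by simp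
    finally show ?thesis unfolding K[symmetric] K_def by (simp only: mult_ac)
  qed
  moreover have n0: "0 \<le> gdens d u"
    by (simp add: normconst_def detH_def)
  ultimately have "(\<integral>\<^sup>+z. ennreal (\<phi> z * (\<Prod>i<d. cdens z (u i))) \<partial>lborel) =
    (\<integral>\<^sup>+z. ennreal (gdens d u) * ennreal (normal_density \<mu> \<sigma> z) \<partial>lborel)"
    by (simp only: ennreal_mult'[OF n0])
  also have "\<dots> = ennreal (gdens d u) * (\<integral>\<^sup>+z. ennreal (normal_density \<mu> \<sigma> z) \<partial>lborel)"
    by (rule nn_integral_cmult) measurable
  also have "(\<integral>\<^sup>+z. ennreal (normal_density \<mu> \<sigma> z) \<partial>lborel) = 1"
    using \<sigma>(1) by (subst nn_integral_eq_integral) auto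
  finally show ?thesis by simp
qed

text \<open>Tonelli exchanges the integral over the orthant with that over the latent
  \<open>z\<close>, and given \<open>z\<close> both the orthant indicator and the weight factor over
  coordinates. Nonnegative integrals are used so that integrability need not be established
  beforehand; the weights \<open>g i\<close> allow for a single distinguished coordinate.\<close>

lemma orthant_mixture:
  fixes g :: "nat \<Rightarrow> real \<Rightarrow> real" and d :: nat
  assumes g [measurable]: "\<And>i. g i \<in> borel_measurable borel" and g0: "\<And>i t. 0 \<le> g i t"
  shows "(\<integral>\<^sup>+u. ennreal (indicator (pos_orthant d) u * (\<Prod>i<d. g i (u i)) * (gdens d u)) \<partial>lebesgue_dim d) =
    (\<integral>\<^sup>+z. ennreal (\<phi> z) * (\<Prod>i<d. \<integral>\<^sup>+t. ennreal (indicator {0<..} t * (g i t * cdens z t)) \<partial>lborel) \<partial>lborel)"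
proof -
  interpret product_sigma_finite "\<lambda>_::nat. lborel :: real measure" by standard
  interpret fin: finite_product_sigma_finite "\<lambda>_::nat. lborel :: real measure" "{..<d}" by standard simp
  interpret P: pair_sigma_finite "lborel :: real measure" "lebesgue_dim d" ..
  have orth: "indicator (pos_orthant d) u = (\<Prod>i<d. indicator {0<..} (u i) :: real)" if "u \<in> space (lebesgue_dim d)" for u
  proof (cases "\<forall>i<d. u i > 0")
    case True
    then show ?thesis using that by (auto simp: pos_orthant_def indicator_def)
  next
    case False
    then obtain i where "i < d" "\<not> u i > 0" by blast
    then have "(\<Prod>i<d. indicator {0<..} (u i) :: real) = 0" by (intro prod_zero bexI[of _ i]) auto
    then show ?thesis using False by (auto simp: pos_orthant_def indicator_def)
  qed
  let ?f = "\<lambda>z u. ennreal (\<phi> z) * (\<Prod>i<d. ennreal (indicator {0<..} (u i) * (g i (u i) * cdens z (u i))))"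
  have meas: "case_prod ?f \<in> borel_measurable (lborel \<Otimes>\<^sub>M lebesgue_dim d)"
  proof -
    have "(\<lambda>p. cdens (fst p) (snd p i)) \<in> borel_measurable (lborel \<Otimes>\<^sub>M lebesgue_dim d)" if "i < d" for i
    proof -
      have "(\<lambda>p. (fst p, snd p i)) \<in> measurable (lborel \<Otimes>\<^sub>M lebesgue_dim d) (borel \<Otimes>\<^sub>M borel)"
        using that by (intro measurable_Pair measurable_compose[OF measurable_snd measurable_component_singleton[of i]]) simp_all
      from measurable_compose[OF this cdens_measurable] show ?thesis by simp
    qed
    moreover have si: "(\<lambda>p. snd p i) \<in> borel_measurable (lborel \<Otimes>\<^sub>M lebesgue_dim d)" if "i < d" for i
      using measurable_compose[OF measurable_snd measurable_component_singleton[of i]] that by simp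
    ultimately have "(\<lambda>p. ennreal (indicator {0<..} (snd p i) * (g i (snd p i) * cdens (fst p) (snd p i)))) \<in> borel_measurable (lborel \<Otimes>\<^sub>M lebesgue_dim d)"
      if "i \<in> {..<d}" for i
      using that
      by (intro measurable_compose[OF _ measurable_ennreal] borel_measurable_times measurable_compose[OF si g]
            measurable_compose[OF si borel_measurable_indicator]) auto
    then have "(\<lambda>p. \<Prod>i<d. ennreal (indicator {0<..} (snd p i) * (g i (snd p i) * cdens (fst p) (snd p i)))) \<in> borel_measurable (lborel \<Otimes>\<^sub>M lebesgue_dim d)"
      by (rule borel_measurable_prod_ennreal)
    moreover have "(\<lambda>p. ennreal (\<phi> (fst p))) \<in> borel_measurable (lborel \<Otimes>\<^sub>M lebesgue_dim d)"
      by measurable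
    ultimately show ?thesis unfolding split_beta' by (intro borel_measurable_times_ennreal)
  qed
  have "(\<integral>\<^sup>+u. ennreal (indicator (pos_orthant d) u * (\<Prod>i<d. g i (u i)) * (gdens d u)) \<partial>lebesgue_dim d) =
    (\<integral>\<^sup>+u. (\<integral>\<^sup>+z. ?f z u \<partial>lborel) \<partial>lebesgue_dim d)"
  proof (rule nn_integral_cong)
    fix u assume u: "u \<in> space (lebesgue_dim d)"
    define A where "A = (\<Prod>i<d. indicator {0<..} (u i) * g i (u i))"
    have A0: "0 \<le> A" unfolding A_def using g0 by (intro prod_nonneg) auto
    have "?f z u = ennreal A * ennreal (\<phi> z * (\<Prod>i<d. cdens z (u i)))" for z
    proof -
      have "(\<Prod>i<d. ennreal (indicator {0<..} (u i) * (g i (u i) * cdens z (u i)))) = ennreal (\<Prod>i<d. indicator {0<..} (u i) * (g i (u i) * cdens z (u i)))"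
        using g0 cdens_nonneg by (intro prod_ennreal) auto
      also have "(\<Prod>i<d. indicator {0<..} (u i) * (g i (u i) * cdens z (u i))) = A * (\<Prod>i<d. cdens z (u i))"
        unfolding A_def prod.distrib[symmetric] by (simp only: mult.assoc)
      finally have "(\<Prod>i<d. ennreal (indicator {0<..} (u i) * (g i (u i) * cdens z (u i)))) = ennreal A * ennreal (\<Prod>i<d. cdens z (u i))"
        using A0 by (simp add: ennreal_mult')
      then show ?thesis by (simp only: ennreal_mult'[OF normal_density_nonneg] mult.left_commute)
    qed
    then have "(\<integral>\<^sup>+z. ?f z u \<partial>lborel) = (\<integral>\<^sup>+z. ennreal A * ennreal (\<phi> z * (\<Prod>i<d. cdens z (u i))) \<partial>lborel)"
      by (simp only:)
    also have "\<dots> = ennreal A * (\<integral>\<^sup>+z. ennreal (\<phi> z * (\<Prod>i<d. cdens z (u i))) \<partial>lborel)"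
      by (rule nn_integral_cmult) (unfold cdens_def, measurable)
    also have "\<dots> = ennreal (A * (gdens d u))"
      unfolding mixture_density using A0 by (simp only: ennreal_mult')
    also have "A = indicator (pos_orthant d) u * (\<Prod>i<d. g i (u i))"
      unfolding A_def orth[OF u] prod.distrib ..
    finally show "ennreal (indicator (pos_orthant d) u * (\<Prod>i<d. g i (u i)) * (gdens d u)) =
      (\<integral>\<^sup>+z. ?f z u \<partial>lborel)" ..
  qed
  also have "\<dots> = (\<integral>\<^sup>+z. (\<integral>\<^sup>+u. ?f z u \<partial>lebesgue_dim d) \<partial>lborel)"
    by (rule P.Fubini'[OF meas])
  also have "\<dots> = (\<integral>\<^sup>+z. ennreal (\<phi> z) * (\<Prod>i<d. \<integral>\<^sup>+t. ennreal (indicator {0<..} t * (g i t * cdens z t)) \<partial>lborel) \<partial>lborel)"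
  proof (rule nn_integral_cong)
    fix z :: real
    have m: "(\<lambda>t. ennreal (indicator {0<..} t * (g i t * cdens z t))) \<in> borel_measurable lborel" for i
      unfolding cdens_def by measurable
    have "(\<lambda>u. ennreal (indicator {0<..} (u i) * (g i (u i) * cdens z (u i)))) \<in> borel_measurable (lebesgue_dim d)" if "i \<in> {..<d}" for i
      by (rule measurable_compose[OF measurable_component_singleton[OF that, of "\<lambda>_. lborel"] m[of i]])
    then have "(\<lambda>u. \<Prod>i<d. ennreal (indicator {0<..} (u i) * (g i (u i) * cdens z (u i)))) \<in> borel_measurable (lebesgue_dim d)"
      by (rule borel_measurable_prod_ennreal)
    then have "(\<integral>\<^sup>+u. ?f z u \<partial>lebesgue_dim d) = ennreal (\<phi> z) * (\<integral>\<^sup>+u. (\<Prod>i<d. ennreal (indicator {0<..} (u i) * (g i (u i) * cdens z (u i)))) \<partial>lebesgue_dim d)"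
      by (rule nn_integral_cmult)
    also have "(\<integral>\<^sup>+u. (\<Prod>i<d. ennreal (indicator {0<..} (u i) * (g i (u i) * cdens z (u i)))) \<partial>lebesgue_dim d) =
        (\<Prod>i<d. \<integral>\<^sup>+t. ennreal (indicator {0<..} t * (g i t * cdens z t)) \<partial>lborel)"
      by (rule product_nn_integral_prod) (simp, rule m)
    finally show "(\<integral>\<^sup>+u. ?f z u \<partial>lebesgue_dim d) = ennreal (\<phi> z) * (\<Prod>i<d. \<integral>\<^sup>+t. ennreal (indicator {0<..} t * (g i t * cdens z t)) \<partial>lborel)" .
  qed
  finally show ?thesis .
qed

lemma sqrt6_ratio: "sqrt 6 * (z / sqrt 12) = z / sqrt 2"
proof -
  have "sqrt 12 = sqrt 6 * sqrt (2::real)" by (simp add: real_sqrt_mult[symmetric])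
  then show ?thesis by simp
qed

lemma cdens_mass: "(\<integral>\<^sup>+t. ennreal (indicator {0<..} t * cdens z t) \<partial>lborel) = ennreal (Phi (z / sqrt 2))"
  using nn_integral_normal_halfline[of "sqrt 6" "z / sqrt 12"] unfolding cdens_def sqrt6_ratio by simp

section \<open>Gaussian limits, the truncated mean and integration by parts\<close>

lemma std_normal_density_at_top: "(\<phi> \<longlongrightarrow> 0) at_top"
  and std_normal_density_at_bot: "(\<phi> \<longlongrightarrow> 0) at_bot"
proof -
  have "((\<lambda>x::real. exp (- x\<^sup>2 / 2)) \<longlongrightarrow> 0) at_top" "((\<lambda>x::real. exp (- x\<^sup>2 / 2)) \<longlongrightarrow> 0) at_bot"
    by real_asymp+
  from this[THEN tendsto_mult_left, of "1 / sqrt (2 * pi)"]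
  show "(\<phi> \<longlongrightarrow> 0) at_top" "(\<phi> \<longlongrightarrow> 0) at_bot"
    unfolding std_normal_density_def[abs_def] by simp_all
qed

lemma Phi_at_top: "(Phi \<longlongrightarrow> 1) at_top"
proof -
  interpret real_distribution std_normal_distribution by (rule real_dist_normal_dist)
  have "Phi = cdf std_normal_distribution" by (auto simp: Phi_def cdf_def fun_eq_iff)
  then show ?thesis using cdf_lim_at_top_prob by simp
qed

text \<open>Expectation, restricted to the positive half-line, of a normal variable with mean
  \<open>z / sqrt 12\<close> and variance 1/6.\<close>

definition cdens_mean :: "real \<Rightarrow> real" where
  "cdens_mean z = z / sqrt 12 * Phi (z / sqrt 2) + \<phi> (z / sqrt 2) / sqrt 6"

text \<open>\<open>F\<close> is an antiderivative of \<open>t * cdens z t\<close>, obtained by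
  writing \<open>t\<close> as mean plus deviation: the mean integrates to a multiple of
  \<open>Phi\<close> and the deviation to a multiple of \<open>- \<phi>\<close>. It increases on the
  half-line, which gives the sign of its total increment \<open>c - F 0\<close>.\<close>

lemma cdens_first_moment:
  "(\<integral>\<^sup>+t. ennreal (indicator {0<..} t * (\<bar>t\<bar> * cdens z t)) \<partial>lborel) = ennreal (cdens_mean z)"
  and cdens_mean_nonneg: "0 \<le> cdens_mean z"
proof -
  define c where "c = z / sqrt 12"
  define F where "F t = c * Phi (sqrt 6 * (t - c)) - \<phi> (sqrt 6 * (t - c)) / sqrt 6" for t
  have F: "(F has_real_derivative t * cdens z t) (at t)" for t
  proof -
    have l: "((\<lambda>t. sqrt 6 * (t - c)) has_real_derivative sqrt 6) (at t)" by (auto intro!: derivative_eq_intros)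
    have "(F has_real_derivative c * (\<phi> (sqrt 6 * (t - c)) * sqrt 6)
        - (- (sqrt 6 * (t - c)) * \<phi> (sqrt 6 * (t - c)) * sqrt 6) / sqrt 6) (at t)"
      unfolding F_def by (intro DERIV_diff DERIV_cmult DERIV_cdivide DERIV_chain2[OF DERIV_Phi l] DERIV_chain2[OF DERIV_std_normal_density l])
    moreover have "c * (\<phi> (sqrt 6 * (t - c)) * sqrt 6)
        - (- (sqrt 6 * (t - c)) * \<phi> (sqrt 6 * (t - c)) * sqrt 6) / sqrt 6 = t * cdens z t"
    proof -
      have "c * (X * r) - (- (r * e) * X * r) / r = (c + e) * (r * X)" if "r \<noteq> 0" for X r e :: real
        using that by (simp add: algebra_simps)
      from this[of "sqrt 6" "\<phi> (sqrt 6 * (t - c))" "t - c"] show ?thesis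
        unfolding cdens_def c_def[symmetric] by simp
    qed
    ultimately show ?thesis by simp
  qed
  have lin: "filterlim (\<lambda>t. sqrt 6 * (t - c)) at_top at_top"
    by real_asymp
  have "(F \<longlongrightarrow> c * 1 - 0 / sqrt 6) at_top"
    unfolding F_def
    by (intro tendsto_diff tendsto_mult tendsto_divide tendsto_const filterlim_compose[OF Phi_at_top lin]
          filterlim_compose[OF std_normal_density_at_top lin]) simp
  then have lim: "(F \<longlongrightarrow> c) at_top" by simp
  have "(\<integral>\<^sup>+t. ennreal (t * cdens z t) * indicator {0..} t \<partial>lborel) = ennreal (c - F 0)"
    by (rule nn_integral_FTC_atLeast[OF _ F _ lim]) (auto simp: cdens_nonneg, simp add: cdens_def)
  moreover have cF: "c - F 0 = cdens_mean z"
  proof -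
    have "sqrt 6 * (0 - c) = - (z / sqrt 2)" using sqrt6_ratio[of z] by (simp add: c_def)
    then have "F 0 = c * Phi (- (z / sqrt 2)) - \<phi> (- (z / sqrt 2)) / sqrt 6"
      by (simp only: F_def)
    moreover have "\<phi> (- (z / sqrt 2)) = \<phi> (z / sqrt 2)"
      by (simp add: std_normal_density_def)
    ultimately show ?thesis by (simp add: Phi_minus cdens_mean_def c_def algebra_simps)
  qed
  moreover have "(\<integral>\<^sup>+t. ennreal (indicator {0<..} t * (\<bar>t\<bar> * cdens z t)) \<partial>lborel) = (\<integral>\<^sup>+t. ennreal (t * cdens z t) * indicator {0..} t \<partial>lborel)"
    by (intro nn_integral_cong) (auto simp: indicator_def)
  ultimately show "(\<integral>\<^sup>+t. ennreal (indicator {0<..} t * (\<bar>t\<bar> * cdens z t)) \<partial>lborel) = ennreal (cdens_mean z)"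
    by simp
  have "F 0 \<le> F t" if "0 \<le> t" for t
    using F cdens_nonneg by (intro DERIV_nonneg_imp_nondecreasing[OF that]) (meson mult_nonneg_nonneg)
  then have "eventually (\<lambda>t. F 0 \<le> F t) at_top"
    using eventually_ge_at_top[of 0] by (rule eventually_mono[rotated])
  then have "F 0 \<le> c" by (rule tendsto_lowerbound[OF lim]) simp
  then show "0 \<le> cdens_mean z" using cF by simp
qed

text \<open>Since \<open>\<phi>' z = - z * \<phi> z\<close>, the function
  \<open>- \<phi> z * Phi (z / sqrt 2) ^ d\<close> has the difference of the two integrands as
  derivative and vanishes at both infinities. This removes the weight \<open>z\<close> brought in by
  \<open>cdens_mean\<close>, so that both its parts become multiples of one integral.\<close>

lemma stein_Phi_power:
  "(LBINT z. \<phi> z * (z * Phi (z / sqrt 2) ^ d)) =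
   (LBINT z. \<phi> z * (real d * Phi (z / sqrt 2) ^ (d - 1) * \<phi> (z / sqrt 2))) / sqrt 2"
  and stein_integrable:
  "integrable lborel (\<lambda>z. \<phi> z * (z * Phi (z / sqrt 2) ^ d))"
  "integrable lborel (\<lambda>z. \<phi> z * (Phi (z / sqrt 2) ^ d * \<phi> (z / sqrt 2)))"
proof -
  let ?F = "\<lambda>z. - \<phi> z * Phi (z / sqrt 2) ^ d"
  let ?f1 = "\<lambda>z. \<phi> z * (z * Phi (z / sqrt 2) ^ d)"
  let ?f2 = "\<lambda>z. \<phi> z * (real d * Phi (z / sqrt 2) ^ (d - 1) * \<phi> (z / sqrt 2))"
  have [measurable]: "Phi \<in> borel_measurable borel" using bddC_Phi[of 0] by simp
  have pd: "\<bar>Phi x ^ k\<bar> \<le> 1" for x k using Phi_bounds[of x] by (simp add: power_abs power_le_one)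
  have i1: "integrable lborel (\<lambda>z. \<phi> z * (z * Phi (z / sqrt 2) ^ k))" for k
  proof (rule Bochner_Integration.integrable_bound[OF integrable_std_normal_moment[of 1]])
    show "AE z in lborel. norm (\<phi> z * (z * Phi (z / sqrt 2) ^ k)) \<le> norm (\<phi> z * z ^ 1)"
    proof (rule AE_I2)
      fix z :: real
      have "\<bar>z\<bar> * \<bar>Phi (z / sqrt 2) ^ k\<bar> \<le> \<bar>z\<bar> * 1" by (rule mult_left_mono[OF pd]) simp
      then show "norm (\<phi> z * (z * Phi (z / sqrt 2) ^ k)) \<le> norm (\<phi> z * z ^ 1)"
        by (simp only: real_norm_def abs_mult power_one_right mult_1_right) (rule mult_left_mono, auto)
    qed
  qed measurable
  obtain B where B: "\<And>z. \<bar>\<phi> z\<bar> \<le> B" using bddC_power_gauss[of 0 0] by auto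
  have B0: "B \<ge> 0" using B[of 0] by linarith
  have i2: "integrable lborel (\<lambda>z. \<phi> z * (Phi (z / sqrt 2) ^ k * \<phi> (z / sqrt 2)))" for k
  proof (rule Bochner_Integration.integrable_bound[OF integrable_mult_right[OF integrable_std_normal_moment[of 0], of B]])
    show "AE z in lborel. norm (\<phi> z * (Phi (z / sqrt 2) ^ k * \<phi> (z / sqrt 2))) \<le> norm (B * (\<phi> z * z ^ 0))"
    proof (rule AE_I2)
      fix z :: real
      have "\<bar>Phi (z / sqrt 2) ^ k\<bar> * \<bar>\<phi> (z / sqrt 2)\<bar> \<le> 1 * B" by (rule mult_mono[OF pd B]) auto
      then have "\<bar>\<phi> z\<bar> * (\<bar>Phi (z / sqrt 2) ^ k\<bar> * \<bar>\<phi> (z / sqrt 2)\<bar>) \<le> \<bar>\<phi> z\<bar> * (1 * B)"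
        by (rule mult_left_mono) simp
      then show "norm (\<phi> z * (Phi (z / sqrt 2) ^ k * \<phi> (z / sqrt 2))) \<le> norm (B * (\<phi> z * z ^ 0))"
        using B0 by (simp add: abs_mult mult.commute)
    qed
  qed measurable
  show "integrable lborel ?f1" by (rule i1)
  show "integrable lborel (\<lambda>z. \<phi> z * (Phi (z / sqrt 2) ^ d * \<phi> (z / sqrt 2)))" by (rule i2)
  have i2': "integrable lborel ?f2"
    using integrable_mult_right[OF i2[of "d - 1"], of "real d"] by (simp only: mult.left_commute mult.assoc)
  have dF: "(?F has_real_derivative ?f1 z - ?f2 z / sqrt 2) (at z)" for z
  proof -
    have l: "((\<lambda>z. z / sqrt 2) has_real_derivative 1 / sqrt 2) (at z)"
      by (rule DERIV_cdivide[OF DERIV_ident])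
    have P: "((\<lambda>z. Phi (z / sqrt 2) ^ d) has_real_derivative
        real d * (\<phi> (z / sqrt 2) * (1 / sqrt 2) * Phi (z / sqrt 2) ^ (d - Suc 0))) (at z)"
      by (rule DERIV_power[OF DERIV_chain2[OF DERIV_Phi l]])
    show ?thesis
    proof -
      have "- (- z * N) * A + D * (M * (1 / r) * C) * - N = N * (z * A) - N * (D * C * M) / r" for N A D M C r :: real
        by (simp add: algebra_simps)
      then show ?thesis
        using DERIV_mult[OF DERIV_minus[OF DERIV_std_normal_density[of z UNIV]] P] by (simp only: One_nat_def)
    qed
  qed
  have cont: "isCont (\<lambda>z. ?f1 z - ?f2 z / sqrt 2) z" for z
    by (intro continuous_intros isCont_o2[OF _ DERIV_isCont[OF DERIV_Phi]] isCont_o2[OF _ DERIV_isCont[OF DERIV_std_normal_density]] DERIV_isCont[OF DERIV_std_normal_density]) auto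
  have il: "integrable lborel (\<lambda>z. ?f1 z - ?f2 z / sqrt 2)"
    by (rule Bochner_Integration.integrable_diff[OF i1 integrable_divide[OF i2']])
  have lims: "(?F \<longlongrightarrow> 0) at_top" "(?F \<longlongrightarrow> 0) at_bot"
  proof -
    have z: "(?F \<longlongrightarrow> 0) G" if "(\<phi> \<longlongrightarrow> 0) G" for G
    proof (rule tendsto_0_le[OF that, where K=1])
      show "\<forall>\<^sub>F x in G. norm (?F x) \<le> norm (\<phi> x) * 1"
        using mult_left_mono[OF pd, of "\<bar>\<phi> x\<bar>" for x] by (intro always_eventually) (auto simp: abs_mult)
    qed
    show "(?F \<longlongrightarrow> 0) at_top" "(?F \<longlongrightarrow> 0) at_bot"
      by (rule z std_normal_density_at_top std_normal_density_at_bot)+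
  qed
  have "(LBINT z=-\<infinity>..\<infinity>. ?f1 z - ?f2 z / sqrt 2) = 0 - 0"
  proof (rule interval_integral_FTC_integrable)
    show "(?F has_vector_derivative ?f1 z - ?f2 z / sqrt 2) (at z)" for z
      using dF[of z] by (simp only: has_real_derivative_iff_has_vector_derivative)
    show "set_integrable lborel (einterval (-\<infinity>) \<infinity>) (\<lambda>z. ?f1 z - ?f2 z / sqrt 2)"
      using il by (simp add: set_integrable_def einterval_def)
    show "((?F \<circ> real_of_ereal) \<longlongrightarrow> 0) (at_right (-\<infinity>))" "((?F \<circ> real_of_ereal) \<longlongrightarrow> 0) (at_left \<infinity>)"
      unfolding ereal_tendsto_simps by (rule lims)+
  qed (use cont in auto)
  then have "(LBINT z. ?f1 z - ?f2 z / sqrt 2) = 0"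
    by (simp add: interval_lebesgue_integral_def set_lebesgue_integral_def einterval_def)
  then show "(LBINT z. ?f1 z) = (LBINT z. ?f2 z) / sqrt 2"
    unfolding Bochner_Integration.integral_diff[OF i1 integrable_divide[OF i2']] integral_divide_zero right_minus_eq .
qed

section \<open>Evaluation of the two coefficients\<close>

lemma quadH_measurable: "(\<lambda>u. quadH (Suc d) u) \<in> borel_measurable (lebesgue_dim d)"
proof -
  have "(\<lambda>u. u i) \<in> borel_measurable (lebesgue_dim d)" if "i < d" for i
    using measurable_component_singleton[of i "{..<d}" "\<lambda>_. lborel"] that by simp
  then show ?thesis unfolding quadH_eq
    by (intro borel_measurable_diff borel_measurable_times borel_measurable_const borel_measurable_power borel_measurable_sum) auto
qed

lemma pos_orthant_measurable: "pos_orthant d \<in> sets (lebesgue_dim d)"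
proof -
  have "{u \<in> space (lebesgue_dim d). 0 < u i} \<in> sets (lebesgue_dim d)" if "i \<in> {..<d}" for i
  proof (rule borel_measurable_less[OF borel_measurable_const])
    show "(\<lambda>u. u i) \<in> borel_measurable (lebesgue_dim d)"
      using measurable_component_singleton[OF that, of "\<lambda>_. lborel"] by simp
  qed
  then have "{u \<in> space (lebesgue_dim d). \<forall>i\<in>{..<d}. 0 < u i} \<in> sets (lebesgue_dim d)"
    by (rule sets.sets_Collect_finite_All) simp_all
  then show ?thesis unfolding pos_orthant_def Ball_def lessThan_iff .
qed

lemma normconst_nonneg: "0 \<le> normconst m"
  by (simp add: normconst_def detH_def)

text \<open>\<open>orthant_mixture\<close> handles product weights only, so \<open>W\<close> is
  presented as a finite sum of products: one for the constant 1, and \<open>d\<close> of them for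
  the sum of the coordinates. Equality with \<open>W\<close> is asked on the orthant alone, where a
  coordinate equals its absolute value.\<close>

lemma orthant_integral_eq:
  fixes W :: "(nat \<Rightarrow> real) \<Rightarrow> real" and g :: "nat \<Rightarrow> nat \<Rightarrow> real \<Rightarrow> real"
  assumes J: "finite J" and g: "\<And>j i. g j i \<in> borel_measurable borel" and g0: "\<And>j i t. 0 \<le> g j i t"
    and W: "\<And>u. u \<in> pos_orthant d \<Longrightarrow> W u = (\<Sum>j\<in>J. \<Prod>i<d. g j i (u i))"
    and Wm: "W \<in> borel_measurable (lebesgue_dim d)"
  shows "normconst (Suc d) * (\<integral>u\<in>pos_orthant d. W u * exp (- quadH (Suc d) u / 2) \<partial>lebesgue_dim d) =
    enn2real (\<integral>\<^sup>+z. ennreal (\<phi> z) * (\<Sum>j\<in>J. \<Prod>i<d. \<integral>\<^sup>+t. ennreal (indicator {0<..} t * (g j i t * cdens z t)) \<partial>lborel) \<partial>lborel)"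
proof -
  let ?F = "\<lambda>u. indicator (pos_orthant d) u * W u * (gdens d u)"
  let ?Fj = "\<lambda>j u. indicator (pos_orthant d) u * (\<Prod>i<d. g j i (u i)) * (gdens d u)"
  have em: "(\<lambda>u. gdens d u) \<in> borel_measurable (lebesgue_dim d)"
    using quadH_measurable[of d] by measurable
  have Fm: "?F \<in> borel_measurable (lebesgue_dim d)"
    by (intro borel_measurable_times em Wm borel_measurable_indicator pos_orthant_measurable)
  have Fjm: "?Fj j \<in> borel_measurable (lebesgue_dim d)" for j
    using measurable_compose[OF measurable_component_singleton[of _ "{..<d}" "\<lambda>_. lborel"]] g
    by (intro borel_measurable_times em borel_measurable_indicator pos_orthant_measurable borel_measurable_prod) auto
  have F: "?F u = (\<Sum>j\<in>J. ?Fj j u)" for u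
    using W[of u] by (simp add: indicator_def sum_distrib_right)
  have Fj0: "0 \<le> ?Fj j u" for j u
    using g0 normconst_nonneg by (intro mult_nonneg_nonneg prod_nonneg) auto
  have "normconst (Suc d) * (\<integral>u\<in>pos_orthant d. W u * exp (- quadH (Suc d) u / 2) \<partial>lebesgue_dim d) = (\<integral>u. ?F u \<partial>lebesgue_dim d)"
    unfolding set_lebesgue_integral_def
    by (subst integral_mult_right_zero[symmetric]) (intro Bochner_Integration.integral_cong refl, simp)
  also have "\<dots> = enn2real (\<integral>\<^sup>+u. ennreal (?F u) \<partial>lebesgue_dim d)"
    by (rule integral_eq_nn_integral[OF Fm]) (simp only: F, intro AE_I2 sum_nonneg Fj0)
  also have "(\<integral>\<^sup>+u. ennreal (?F u) \<partial>lebesgue_dim d) = (\<integral>\<^sup>+u. (\<Sum>j\<in>J. ennreal (?Fj j u)) \<partial>lebesgue_dim d)"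
    by (simp only: F sum_ennreal[OF Fj0])
  also have "\<dots> = (\<Sum>j\<in>J. \<integral>\<^sup>+u. ennreal (?Fj j u) \<partial>lebesgue_dim d)"
    by (rule nn_integral_sum) (intro measurable_compose[OF Fjm measurable_ennreal])
  also have "\<dots> = (\<Sum>j\<in>J. \<integral>\<^sup>+z. ennreal (\<phi> z) * (\<Prod>i<d. \<integral>\<^sup>+t. ennreal (indicator {0<..} t * (g j i t * cdens z t)) \<partial>lborel) \<partial>lborel)"
    by (intro sum.cong refl orthant_mixture g g0)
  also have "\<dots> = (\<integral>\<^sup>+z. (\<Sum>j\<in>J. ennreal (\<phi> z) * (\<Prod>i<d. \<integral>\<^sup>+t. ennreal (indicator {0<..} t * (g j i t * cdens z t)) \<partial>lborel)) \<partial>lborel)"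
  proof (rule nn_integral_sum[symmetric])
    fix j
    have [measurable]: "g j i \<in> borel_measurable borel" for i by (rule g)
    have "(\<lambda>z. \<integral>\<^sup>+t. ennreal (indicator {0<..} t * (g j i t * cdens z t)) \<partial>lborel) \<in> borel_measurable lborel" for i
      unfolding cdens_def by measurable
    then show "(\<lambda>z. ennreal (\<phi> z) * (\<Prod>i<d. \<integral>\<^sup>+t. ennreal (indicator {0<..} t * (g j i t * cdens z t)) \<partial>lborel)) \<in> borel_measurable lborel"
      by (intro borel_measurable_times_ennreal borel_measurable_prod_ennreal) measurable
  qed
  finally show ?thesis by (simp only: sum_distrib_left)
qed

text \<open>Given the latent \<open>z\<close>, the coordinates are positive independently with
  probability \<open>Phi (z / sqrt 2)\<close> each; averaging over \<open>z\<close> gives the mass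
  of the orthant.\<close>

lemma a0_eq: "a0 (Suc d) = (\<integral>z. Phi (z / sqrt 2) ^ d \<partial>N01)"
proof -
  have [measurable]: "Phi \<in> borel_measurable borel" using bddC_Phi[of 0] by simp
  have "a0 (Suc d) = normconst (Suc d) * (\<integral>u\<in>pos_orthant d. 1 * exp (- quadH (Suc d) u / 2) \<partial>lebesgue_dim d)"
    by (simp add: a0_def normconst_def)
  also have "\<dots> = enn2real (\<integral>\<^sup>+z. ennreal (\<phi> z) * (\<Sum>j\<in>{0::nat}. \<Prod>i<d. \<integral>\<^sup>+t. ennreal (indicator {0<..} t * (1 * cdens z t)) \<partial>lborel) \<partial>lborel)"
    by (rule orthant_integral_eq[where g="\<lambda>_ _ _. 1"]) auto
  also have "\<dots> = enn2real (\<integral>\<^sup>+z. ennreal (\<phi> z * Phi (z / sqrt 2) ^ d) \<partial>lborel)"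
    unfolding mult_1_left cdens_mass prod_constant card_lessThan ennreal_power[OF Phi_bounds(1)]
    by (simp add: ennreal_mult'[OF normal_density_nonneg])
  also have "\<dots> = (LBINT z. \<phi> z * Phi (z / sqrt 2) ^ d)"
    using Phi_bounds by (intro integral_eq_nn_integral[symmetric]) auto
  also have "\<dots> = (\<integral>z. Phi (z / sqrt 2) ^ d \<partial>N01)"
    by (subst integral_density) auto
  finally show ?thesis .
qed

text \<open>By symmetry all coordinates contribute alike. After \<open>stein_Phi_power\<close> the
  two parts of \<open>cdens_mean\<close> combine to \<open>d * I * (d + 2) / (2 * sqrt 6)\<close>;
  the factor \<open>d + 2\<close>, one more than the number of candidates, cancels the prefactor
  \<open>6 / (m + 1)\<close>, and \<open>3 / sqrt 6\<close> is \<open>c0\<close>.\<close>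

lemma a1_eq:
  assumes d: "d \<ge> 1"
  shows "a1 (Suc d) n = - (parity_shift n * (\<integral>z. real d * Phi (z / sqrt 2) ^ (d - 1) * \<phi> (z / sqrt 2) * c0 \<partial>N01))"
proof (cases "odd n")
  case True
  then show ?thesis by (simp add: a1_def parity_shift_def)
next
  case False
  have [measurable]: "Phi \<in> borel_measurable borel" using bddC_Phi[of 0] by simp
  have cm: "(\<lambda>u. u i) \<in> borel_measurable (lebesgue_dim d)" if "i \<in> {..<d}" for i
    using measurable_component_singleton[OF that, of "\<lambda>_. lborel"] by simp
  \<comment> \<open>Each summand is a product with a single nontrivial factor. The absolute value
    makes the factors nonnegative everywhere, as the Tonelli argument demands, and changes nothing
    on the orthant.\<close>
  have W: "(\<Sum>i<d. u i) = (\<Sum>j<d. \<Prod>i<d. if i = j then \<bar>u i\<bar> else 1)" if "u \<in> pos_orthant d" for u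
  proof (rule sum.cong[OF refl])
    fix j assume "j \<in> {..<d}"
    then show "u j = (\<Prod>i<d. if i = j then \<bar>u i\<bar> else 1)"
      using that by (simp add: pos_orthant_def less_imp_le)
  qed
  define I where "I = (LBINT z. \<phi> z * (Phi (z / sqrt 2) ^ (d - 1) * \<phi> (z / sqrt 2)))"
  have "normconst (Suc d) * (\<integral>u\<in>pos_orthant d. (\<Sum>i<d. u i) * exp (- quadH (Suc d) u / 2) \<partial>lebesgue_dim d) =
    enn2real (\<integral>\<^sup>+z. ennreal (\<phi> z) * (\<Sum>j<d. \<Prod>i<d. \<integral>\<^sup>+t. ennreal (indicator {0<..} t * ((if i = j then \<bar>t\<bar> else 1) * cdens z t)) \<partial>lborel) \<partial>lborel)"
  proof (rule orthant_integral_eq[where g="\<lambda>j i t. if i = j then \<bar>t\<bar> else 1"])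
    show "(\<lambda>u. \<Sum>i<d. u i) \<in> borel_measurable (lebesgue_dim d)" by (rule borel_measurable_sum[OF cm])
    show "(\<lambda>t::real. if i = j then \<bar>t\<bar> else 1) \<in> borel_measurable borel" for i j :: nat
      by (cases "i = j") simp_all
    show "0 \<le> (if i = j then \<bar>t\<bar> else 1)" for i j :: nat and t :: real by simp
    show "finite {..<d}" by simp
    show "(\<Sum>i<d. u i) = (\<Sum>j<d. \<Prod>i<d. if i = j then \<bar>u i\<bar> else 1)" if "u \<in> pos_orthant d" for u
      by (rule W[OF that])
  qed
  also have "\<dots> = enn2real (\<integral>\<^sup>+z. ennreal (\<phi> z * (real d * (cdens_mean z * Phi (z / sqrt 2) ^ (d - 1)))) \<partial>lborel)"
  proof (intro arg_cong[where f=enn2real] nn_integral_cong)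
    fix z :: real
    have "(\<Prod>i<d. \<integral>\<^sup>+t. ennreal (indicator {0<..} t * ((if i = j then \<bar>t\<bar> else 1) * cdens z t)) \<partial>lborel) = ennreal (cdens_mean z * Phi (z / sqrt 2) ^ (d - 1))"
      if j: "j \<in> {..<d}" for j
    proof -
      have "(\<Prod>i<d. \<integral>\<^sup>+t. ennreal (indicator {0<..} t * ((if i = j then \<bar>t\<bar> else 1) * cdens z t)) \<partial>lborel) =
         (\<integral>\<^sup>+t. ennreal (indicator {0<..} t * (\<bar>t\<bar> * cdens z t)) \<partial>lborel) *
         (\<Prod>i\<in>{..<d} - {j}. \<integral>\<^sup>+t. ennreal (indicator {0<..} t * ((if i = j then \<bar>t\<bar> else 1) * cdens z t)) \<partial>lborel)"
        by (rule trans[OF prod.remove[OF finite_lessThan j]]) (simp only: if_True refl)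
      also have "(\<Prod>i\<in>{..<d} - {j}. \<integral>\<^sup>+t. ennreal (indicator {0<..} t * ((if i = j then \<bar>t\<bar> else 1) * cdens z t)) \<partial>lborel) =
         (\<Prod>i\<in>{..<d} - {j}. ennreal (Phi (z / sqrt 2)))"
      proof (rule prod.cong[OF refl])
        fix i assume "i \<in> {..<d} - {j}"
        then have "i \<noteq> j" by simp
        then show "(\<integral>\<^sup>+t. ennreal (indicator {0<..} t * ((if i = j then \<bar>t\<bar> else 1) * cdens z t)) \<partial>lborel) = ennreal (Phi (z / sqrt 2))"
          by (simp only: if_False mult_1_left cdens_mass)
      qed
      also have "\<dots> = ennreal (Phi (z / sqrt 2) ^ (d - 1))"
        using j Phi_bounds by (simp add: ennreal_power)
      finally show ?thesis using cdens_mean_nonneg by (simp only: cdens_first_moment ennreal_mult')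
    qed
    then have "(\<Sum>j<d. \<Prod>i<d. \<integral>\<^sup>+t. ennreal (indicator {0<..} t * ((if i = j then \<bar>t\<bar> else 1) * cdens z t)) \<partial>lborel) =
        (\<Sum>j<d. ennreal (cdens_mean z * Phi (z / sqrt 2) ^ (d - 1)))"
      by (rule sum.cong[OF refl])
    also have "\<dots> = ennreal (real d * (cdens_mean z * Phi (z / sqrt 2) ^ (d - 1)))"
      by (simp add: ennreal_mult' ennreal_of_nat_eq_real_of_nat)
    finally show "ennreal (\<phi> z) * (\<Sum>j<d. \<Prod>i<d. \<integral>\<^sup>+t. ennreal (indicator {0<..} t * ((if i = j then \<bar>t\<bar> else 1) * cdens z t)) \<partial>lborel) =
      ennreal (\<phi> z * (real d * (cdens_mean z * Phi (z / sqrt 2) ^ (d - 1))))"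
      by (simp only: ennreal_mult'[OF normal_density_nonneg])
  qed
  also have "\<dots> = (LBINT z. \<phi> z * (real d * (cdens_mean z * Phi (z / sqrt 2) ^ (d - 1))))"
  proof (rule integral_eq_nn_integral[symmetric])
    show "(\<lambda>z. \<phi> z * (real d * (cdens_mean z * Phi (z / sqrt 2) ^ (d - 1)))) \<in> borel_measurable lborel"
      unfolding cdens_mean_def by measurable
    show "AE z in lborel. 0 \<le> \<phi> z * (real d * (cdens_mean z * Phi (z / sqrt 2) ^ (d - 1)))"
      using Phi_bounds cdens_mean_nonneg by (intro AE_I2 mult_nonneg_nonneg) auto
  qed
  also have "\<dots> = (\<integral>z. real d / sqrt 12 * (\<phi> z * (z * Phi (z / sqrt 2) ^ d)) +
      real d / sqrt 6 * (\<phi> z * (Phi (z / sqrt 2) ^ (d - 1) * \<phi> (z / sqrt 2))) \<partial>lborel)"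
  proof (intro Bochner_Integration.integral_cong refl)
    fix z :: real
    have "Phi (z / sqrt 2) ^ d = Phi (z / sqrt 2) * Phi (z / sqrt 2) ^ (d - 1)"
      using d by (cases d) auto
    then show "\<phi> z * (real d * (cdens_mean z * Phi (z / sqrt 2) ^ (d - 1))) =
      real d / sqrt 12 * (\<phi> z * (z * Phi (z / sqrt 2) ^ d)) +
      real d / sqrt 6 * (\<phi> z * (Phi (z / sqrt 2) ^ (d - 1) * \<phi> (z / sqrt 2)))"
      unfolding cdens_mean_def by (simp add: algebra_simps add_divide_distrib)
  qed
  also have "\<dots> = real d / sqrt 12 * (LBINT z. \<phi> z * (z * Phi (z / sqrt 2) ^ d)) + real d / sqrt 6 * I"
    unfolding I_def
    by (subst Bochner_Integration.integral_add[OF integrable_mult_right[OF stein_integrable(1)] integrable_mult_right[OF stein_integrable(2)]])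
       (simp only: integral_mult_right_zero)
  also have "(LBINT z. \<phi> z * (z * Phi (z / sqrt 2) ^ d)) = real d * I / sqrt 2"
  proof -
    have "(LBINT z. \<phi> z * (real d * Phi (z / sqrt 2) ^ (d - 1) * \<phi> (z / sqrt 2))) =
       (LBINT z. real d * (\<phi> z * (Phi (z / sqrt 2) ^ (d - 1) * \<phi> (z / sqrt 2))))"
      by (intro Bochner_Integration.integral_cong) (simp_all only: mult_ac)
    also have "\<dots> = real d * I" unfolding I_def integral_mult_right_zero ..
    finally show ?thesis unfolding stein_Phi_power by simp
  qed
  also have "real d / sqrt 12 * (real d * I / sqrt 2) + real d / sqrt 6 * I = real d * I * (real d + 2) / (2 * sqrt 6)"
  proof -
    have "sqrt 12 * sqrt 2 = 2 * sqrt (6::real)"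
      using real_sqrt_mult[of 4 6] by (simp add: real_sqrt_mult[symmetric])
    then have e: "real d / sqrt 12 * (real d * I / sqrt 2) = real d * (real d * I) / (2 * sqrt 6)"
      by (simp only: times_divide_times_eq)
    have f: "real d / sqrt 6 * I = 2 * (real d * I) / (2 * sqrt 6)" by simp
    have "real d * (real d * I) + 2 * (real d * I) = real d * I * (real d + 2)" by (simp add: algebra_simps)
    then show ?thesis unfolding e f add_divide_distrib[symmetric] by (simp only:)
  qed
  finally have main: "normconst (Suc d) * (\<integral>u\<in>pos_orthant d. (\<Sum>i<d. u i) * exp (- quadH (Suc d) u / 2) \<partial>lebesgue_dim d) =
     real d * I * (real d + 2) / (2 * sqrt 6)" .
  have c06: "3 / sqrt 6 = c0"
  proof -
    have "(3 / sqrt 6)\<^sup>2 = c0\<^sup>2" by (simp add: c0_def power_divide)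
    then show ?thesis by (rule power2_eq_imp_eq) (simp_all add: c0_def)
  qed
  have "a1 (Suc d) n = - (6 / (real d + 2)) * (normconst (Suc d) * (\<integral>u\<in>pos_orthant d. (\<Sum>i<d. u i) * exp (- quadH (Suc d) u / 2) \<partial>lebesgue_dim d))"
    using False by (simp add: a1_def normconst_def add.commute)
  also have "\<dots> = - (real d * I * (3 / sqrt 6))"
  proof -
    have "- (6 / x) * (y * x / (2 * r)) = - (y * (3 / r))" if "x > 0" "r > 0" for x y r :: real
      using that by (simp add: field_simps)
    then show ?thesis unfolding main by simp
  qed
  also have "\<dots> = - (real d * I * c0)" unfolding c06 ..
  also have "real d * I * c0 = (\<integral>z. real d * Phi (z / sqrt 2) ^ (d - 1) * \<phi> (z / sqrt 2) * c0 \<partial>N01)"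
  proof -
    have eq: "(\<integral>z. real d * Phi (z / sqrt 2) ^ (d - 1) * \<phi> (z / sqrt 2) * c0 \<partial>N01) =
      (LBINT z. (real d * c0) * (\<phi> z * (Phi (z / sqrt 2) ^ (d - 1) * \<phi> (z / sqrt 2))))"
    proof -
      have "(\<integral>z. real d * Phi (z / sqrt 2) ^ (d - 1) * \<phi> (z / sqrt 2) * c0 \<partial>N01) =
        (LBINT z. \<phi> z *\<^sub>R (real d * Phi (z / sqrt 2) ^ (d - 1) * \<phi> (z / sqrt 2) * c0))"
        by (rule integral_density) auto
      also have "\<dots> = (LBINT z. (real d * c0) * (\<phi> z * (Phi (z / sqrt 2) ^ (d - 1) * \<phi> (z / sqrt 2))))"
        by (intro Bochner_Integration.integral_cong refl) (simp only: real_scaleR_def mult_ac)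
      finally show ?thesis .
    qed
    show ?thesis unfolding eq integral_mult_right_zero I_def[symmetric] by (simp only: mult_ac)
  qed
  finally show ?thesis using False by (simp add: parity_shift_def)
qed

theorem theorem10:
  fixes m :: nat
  assumes "m \<ge> 2"
  shows "(\<lambda>n. prob_CW_IC m n - a0 m - a1 m n / sqrt (real n)) \<in> O(\<lambda>n. 1 / real n)"
proof -
  define d where "d = m - 1"
  have d: "d \<ge> 1" "m = Suc d" using assms by (auto simp: d_def)
  obtain C where C: "\<And>n. n > 0 \<Longrightarrow> \<bar>(\<integral>s. win n s ^ d \<partial>PU {..<n}) - (\<integral>z. Phi (z / sqrt 2) ^ d \<partial>N01)
      + parity_shift n / sqrt n * (\<integral>z. real d * Phi (z / sqrt 2) ^ (d - 1) * \<phi> (z / sqrt 2) * c0 \<partial>N01)\<bar> \<le> C / n"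
    using win_power_asymptotics[of d] by blast
  have "norm (prob_CW_IC m n - a0 m - a1 m n / sqrt (real n)) \<le> C * norm (1 / real n)" if "n > 0" for n
  proof -
    have "prob_CW_IC m n = (\<integral>s. win n s ^ d \<partial>PU {..<n})"
      using prob_CW_IC_eq_integral[of m n] assms by (simp add: d_def)
    then show ?thesis using C[OF that] unfolding d(2) a0_eq a1_eq[OF d(1)] by simp
  qed
  then have "\<forall>\<^sub>F n in at_top. norm (prob_CW_IC m n - a0 m - a1 m n / sqrt (real n)) \<le> C * norm (1 / real n)"
    using eventually_gt_at_top[of 0] by (rule eventually_mono[rotated])
  then show ?thesis by (rule bigoI)
qed

end
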